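(* Let $\mathfrak X=(X,\{R_i\}_{0\le i\le d})$ be a symmetric association scheme, and suppose that $\mathfrak X$ has a primitive idempotent $E_1$ of rank $m_1=3$ such that the spherical embedding of $\mathfrak X$ with respect to $E_1$ is faithful. Then the embedded point set $\overline X=\{\overline x : x\in X\}\subset S^2\subset\mathbb R^3$ is, up to an orthogonal transformation of $\mathbb R^3$, the vertex set (inscribed in the unit sphere $S^2$) of one of the following polyhedra: the regular tetrahedron ($|X|=4$), the regular octahedron ($|X|=6$), the cube ($|X|=8$), the regular icosahedron ($|X|=12$), the quasi-regular polyhedron of type $[3,4,3,4]$ ($|X|=12$), the regular dodecahedron ($|X|=20$), or the quasi-regular polyhedron of type $[3,5,3,5]$ ($|X|=30$).
   Context: A symmetric association scheme $\mathfrak X=(X,\{R_i\}_{0\le i\le d})$ consists of a finite nonempty set $X$ and a partition of $X\times X$ into nonempty symmetric relations $R_0,\dots,R_d$ with $R_0=\{(x,x):x\in X\}$, such that for all $i,j,k$ there is a constant $p_{ij}^k$ with $|\{z\in X:(x,z)\in R_i,(z,y)\in R_j\}|=p_{ij}^k$ for every $(x,y)\in R_k$. Let $A_i$ be the adjacency matrix of $R_i$. The real span of $A_0,\dots,A_d$ (the Bose-Mesner algebra) is a commutative algebra of symmetric matrices; its primitive idempotents are denoted $E_0=\frac1{|X|}J,E_1,\dots,E_d$, where $J$ is the all-ones matrix, and $m_i=\operatorname{rank}E_i$. The spherical embedding of $\mathfrak X$ with respect to a primitive idempotent $E_i$ is the map $X\to\mathbb R^{m_i}$, $x\mapsto\overline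 x=\sqrt{|X|/m_i}\,E_i\phi_x$, where $\phi_x\in\mathbb R^X$ is the characteristic (column) vector of $x$ and the column space of $E_i$ is identified isometrically with $\mathbb R^{m_i}$. All $\overline x$ lie on the unit sphere $S^{m_i-1}$. The embedding is faithful if $x\mapsto\overline x$ is injective, equivalently $\langle\overline x,\overline y\rangle\ne1$ for all $x\neq y$. The quasi-regular polyhedron of type $[3,4,3,4]$ (cuboctahedron) is the Archimedean solid in which a triangle, a square, a triangle, a square meet in cyclic order at each vertex; the one of type $[3,5,3,5]$ (icosidodecahedron) is the Archimedean solid in which a triangle, a regular pentagon, a triangle, a regular pentagon meet in cyclic order at each vertex. *)

theory Defs
  imports "HOL-Analysis.Analysis"
begin

section \<open>Symmetric association schemes and their Bose--Mesner algebra\<close>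

text \<open>The underlying point set is the finite (and automatically nonempty) type \<open>'x\<close>;
  only the relations \<open>R 0, \<dots>, R d\<close> matter.\<close>

definition symmetric_association_scheme :: "nat \<Rightarrow> (nat \<Rightarrow> ('x::finite \<times> 'x) set) \<Rightarrow> bool" where
  "symmetric_association_scheme d R \<longleftrightarrow>
     R 0 = Id \<and>
     (\<forall>i\<le>d. R i \<noteq> {} \<and> sym (R i)) \<and>
     (\<Union>i\<le>d. R i) = UNIV \<and> disjoint_family_on R {..d} \<and>
     (\<forall>i\<le>d. \<forall>j\<le>d. \<forall>k\<le>d. \<exists>p. \<forall>x y. (x, y) \<in> R k \<longrightarrow>
        card {z. (x, z) \<in> R i \<and> (z, y) \<in> R j} = p)"

definition adjacency_matrix :: "('x::finite \<times> 'x) set \<Rightarrow> real^'x^'x" where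
  "adjacency_matrix r = (\<chi> x y. if (x, y) \<in> r then 1 else 0)"

definition bose_mesner_algebra :: "nat \<Rightarrow> (nat \<Rightarrow> ('x::finite \<times> 'x) set) \<Rightarrow> (real^'x^'x) set" where
  "bose_mesner_algebra d R = span ((\<lambda>i. adjacency_matrix (R i)) ` {..d})"

definition primitive_idempotent_of :: "real^'x^'x \<Rightarrow> (real^'x^'x) set \<Rightarrow> bool" where
  "primitive_idempotent_of E \<A> \<longleftrightarrow>
     E \<in> \<A> \<and> E ** E = E \<and> E \<noteq> 0 \<and>
     \<not> (\<exists>F\<in>\<A>. \<exists>G\<in>\<A>. F \<noteq> 0 \<and> G \<noteq> 0 \<and> F ** F = F \<and> G ** G = G \<and>
          F ** G = 0 \<and> G ** F = 0 \<and> E = F + G)"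


section \<open>Spherical embeddings\<close>

text \<open>\<open>\<iota>\<close> identifies the column space of \<open>E\<close> isometrically with \<open>\<real>\<^sup>m\<close>. Its values outside the
  column space play no role; linearity on the whole space is no restriction, since a linear map
  on a subspace always extends.\<close>

definition column_space_identification :: "real^'x^'x \<Rightarrow> (real^'x \<Rightarrow> real^'m) \<Rightarrow> bool" where
  "column_space_identification E \<iota> \<longleftrightarrow>
     linear \<iota> \<and> \<iota> ` span (columns E) = UNIV \<and> (\<forall>v \<in> span (columns E). norm (\<iota> v) = norm v)"

lemma column_space_identification_exists:
  fixes E :: "real^'x^'x"
  assumes "rank E = CARD('m::finite)"
  shows "\<exists>\<iota> :: real^'x \<Rightarrow> real^'m. column_space_identification E \<iota>"
proof -
  have "dim (span (columns E)) = dim (UNIV :: (real^'m) set)"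
    using assms by (simp add: column_rank_def)
  then obtain f where "linear f" "f ` span (columns E) = (UNIV :: (real^'m) set)"
      "\<And>x. x \<in> span (columns E) \<Longrightarrow> norm (f x) = norm x"
    using isometries_subspaces [OF subspace_span subspace_UNIV] by metis
  then show ?thesis
    by (auto simp: column_space_identification_def)
qed

text \<open>\<open>axis x 1\<close> is the characteristic vector of \<open>x\<close>.\<close>

definition spherical_embedding ::
    "real^'x^'x \<Rightarrow> (real^'x \<Rightarrow> real^'m) \<Rightarrow> 'x::finite \<Rightarrow> real^'m" where
  "spherical_embedding E \<iota> x =
     \<iota> (sqrt (real CARD('x) / real (rank E)) *\<^sub>R (E *v axis x 1))"

definition faithful_embedding :: "('x \<Rightarrow> real^'m) \<Rightarrow> bool" where
  "faithful_embedding f \<longleftrightarrow> inj f"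


section \<open>Regular and quasi-regular polyhedra\<close>

text \<open>A regular \<open>n\<close>-gon in space, of circumradius \<open>r\<close>, as a two-dimensional convex region:
  \<open>c\<close> is its centre and \<open>u, w\<close> is an orthonormal basis of the direction of its plane.\<close>

definition regular_polygon :: "nat \<Rightarrow> real \<Rightarrow> (real^3) set \<Rightarrow> bool" where
  "regular_polygon n r F \<longleftrightarrow> n \<ge> 3 \<and> r > 0 \<and>
     (\<exists>c u w. norm u = 1 \<and> norm w = 1 \<and> u \<bullet> w = 0 \<and>
        F = convex hull
              ((\<lambda>k. c + (r * cos (2 * pi * real k / real n)) *\<^sub>R u
                      + (r * sin (2 * pi * real k / real n)) *\<^sub>R w) ` {..<n}))"

definition vertices :: "(real^3) set \<Rightarrow> (real^3) set" where
  "vertices P = {v. v extreme_point_of P}"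

definition convex_polyhedron :: "(real^3) set \<Rightarrow> bool" where
  "convex_polyhedron P \<longleftrightarrow> polytope P \<and> aff_dim P = 3"

text \<open>The regular polyhedron with Schlaefli symbol \<open>{p, q}\<close>: all faces are congruent regular
  \<open>p\<close>-gons (the common circumradius \<open>r\<close> expresses congruence) and \<open>q\<close> of them meet at each
  vertex.\<close>

definition regular_polyhedron :: "nat \<Rightarrow> nat \<Rightarrow> (real^3) set \<Rightarrow> bool" where
  "regular_polyhedron p q P \<longleftrightarrow> convex_polyhedron P \<and>
     (\<exists>r. \<forall>F. F facet_of P \<longrightarrow> regular_polygon p r F) \<and>
     (\<forall>v \<in> vertices P. card {F. F facet_of P \<and> v \<in> F} = q)"

text \<open>The faces at \<open>v\<close> are, in cyclic order, a regular \<open>ns ! 0\<close>-gon, a regular \<open>ns ! 1\<close>-gon, \<dots>.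
  Two distinct faces through \<open>v\<close> are adjacent around \<open>v\<close> iff they share an edge (which then
  contains \<open>v\<close>).\<close>

definition vertex_type :: "(real^3) set \<Rightarrow> real^3 \<Rightarrow> nat list \<Rightarrow> bool" where
  "vertex_type P v ns \<longleftrightarrow>
     (\<exists>Fs. length Fs = length ns \<and> distinct Fs \<and> set Fs = {F. F facet_of P \<and> v \<in> F} \<and>
        (\<forall>i < length ns. (\<exists>r. regular_polygon (ns ! i) r (Fs ! i)) \<and>
           (Fs ! i \<inter> Fs ! (Suc i mod length ns)) edge_of P))"

text \<open>Convex polyhedra with regular faces whose symmetry group is transitive on the vertices.
  Platonic solids, prisms and antiprisms are not excluded here; they are excluded by the vertex
  types \<open>[3,4,3,4]\<close> and \<open>[3,5,3,5]\<close>.\<close>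

definition uniform_polyhedron :: "(real^3) set \<Rightarrow> bool" where
  "uniform_polyhedron P \<longleftrightarrow> convex_polyhedron P \<and>
     (\<forall>F. F facet_of P \<longrightarrow> (\<exists>n r. regular_polygon n r F)) \<and>
     (\<forall>v \<in> vertices P. \<forall>w \<in> vertices P.
        \<exists>g :: real^3 \<Rightarrow> real^3. (\<forall>x y. dist (g x) (g y) = dist x y) \<and> g ` P = P \<and> g v = w)"

definition quasi_regular_polyhedron :: "nat list \<Rightarrow> (real^3) set \<Rightarrow> bool" where
  "quasi_regular_polyhedron ns P \<longleftrightarrow>
     uniform_polyhedron P \<and> (\<forall>v \<in> vertices P. vertex_type P v ns)"

definition regular_tetrahedron :: "(real^3) set \<Rightarrow> bool" where
  "regular_tetrahedron = regular_polyhedron 3 3"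

definition regular_octahedron :: "(real^3) set \<Rightarrow> bool" where
  "regular_octahedron = regular_polyhedron 3 4"

definition cube :: "(real^3) set \<Rightarrow> bool" where
  "cube = regular_polyhedron 4 3"

definition regular_icosahedron :: "(real^3) set \<Rightarrow> bool" where
  "regular_icosahedron = regular_polyhedron 3 5"

definition regular_dodecahedron :: "(real^3) set \<Rightarrow> bool" where
  "regular_dodecahedron = regular_polyhedron 5 3"

end

theory Submission
  imports Defs
begin

text \<open>Write \<open>X\<close> for the embedded point set and \<open>\<theta>\<close> for the largest inner product of two different points
of \<open>X\<close>; call two points neighbours if their inner product is \<open>\<theta>\<close>.  The faces of the convex hull of
\<open>X\<close> turn out to be visible in this graph of minimal distances, and the scheme makes the graph so
regular that it can be listed.

Multiplying a primitive idempotent \<open>E\<close> by any element \<open>M\<close> of the Bose--Mesner algebra gives a multiple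
of \<open>E\<close> (\<open>primitive_eigenspace\<close>).  In the embedding this says that the points in a fixed
relation to \<open>x\<close> have their centroid on the axis through \<open>x\<close> (\<open>relation_sum\<close>).  Moreover \<open>X\<close> spans the
space, and the numbers of neighbours and of common neighbours of two neighbours are constant.

Seen from \<open>x\<close>, two neighbours of \<open>x\<close> are separated by more than 60 degrees, so there
are at most five of them.  One relation alone cannot provide just one neighbour, because of the
centroid, nor two: these would be opposite to each other, the neighbours would trace regular
polygons on great circles, and two such polygons come too close where their circles meet
(\<open>no_two_valent_neighbours\<close>).  So exactly one relation has the inner product \<open>\<theta>\<close>, and its valency \<open>q\<close> is 3, 4 or 5.
For \<open>q = 3\<close> the three directions are 120 degrees apart.  For \<open>q = 4\<close> they form two opposite pairs, and for
\<open>q \<ge> 4\<close> every edge lies in a triangle, since otherwise the next edges at its two ends, on one side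
of it, would end too close to each other (\<open>common_neighbour_if_two_sided\<close>).  For \<open>q = 5\<close> a parity argument puts every edge
in two triangles.

Always turning by the same angle at the vertices one walks along a circle inside \<open>X\<close>.  The points
visited are no closer to each other than consecutive ones, which forces the walk to close up
after 3, 4 or 5 steps (\<open>separated_multiples\<close>) and so determines \<open>\<theta>\<close>.  The circumradius of such a polygon is
less than its edge, therefore the spherical cap over it contains no further point of \<open>X\<close>
(\<open>cap_of_inscribed_polygon_empty\<close>): the polygon is a face of the convex hull.  The polygons around a point
leave no gap, so they are all the facets there (\<open>facets_at_vertex\<close>).

A nonempty subset of \<open>X\<close> that contains the neighbours of its members is all of \<open>X\<close>
(\<open>neighbour_closed_eq\<close>).  Hence the points can be enumerated from one point by following edges, with exact
coordinates over the ring of integers extended by the golden ratio.  By the same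
connectedness an isometry that fits around one point fits everywhere, which yields the
transitive symmetry group of the quasi-regular polyhedra.\<close>

section \<open>Vectors in space\<close>

lemma orthogonal_to_basis_zero:
  fixes a b c d :: "real^3"
  assumes "a \<bullet> b = 0" "a \<bullet> c = 0" "b \<bullet> c = 0" "a \<noteq> 0" "b \<noteq> 0" "c \<noteq> 0"
    and "d \<bullet> a = 0" "d \<bullet> b = 0" "d \<bullet> c = 0"
  shows "d = 0"
proof -
  have neq: "a \<noteq> b" "a \<noteq> c" "b \<noteq> c" using assms by auto
  have po: "pairwise orthogonal {a, b, c}"
    using assms by (auto simp: pairwise_def orthogonal_def inner_commute)
  have ind: "independent {a, b, c}"
    by (rule pairwise_orthogonal_independent [OF po]) (use assms in auto)
  have "card {a, b, c} = 3" using neq by auto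
  hence "span {a, b, c} = UNIV"
    using ind by (simp add: basis_card_eq_dim independent_card_le_dim
      card_ge_dim_independent[of "{a,b,c}" UNIV] top.extremum_uniqueI)
  hence "d \<in> span {a, b, c}" by simp
  hence "orthogonal d d"
    by (rule orthogonal_to_span) (use assms in \<open>auto simp: orthogonal_def inner_commute\<close>)
  thus ?thesis by (simp add: orthogonal_def)
qed

lemma dot_cross_self3: "(x::real^3) \<bullet> cross3 x y = 0" "y \<bullet> cross3 x y = 0"
  "cross3 x y \<bullet> x = 0" "cross3 x y \<bullet> y = 0"
  by (simp_all add: dot_cross_self inner_commute)

lemma cross3_inner_self:
  "cross3 x y \<bullet> cross3 x y = (x \<bullet> x) * (y \<bullet> y) - (x \<bullet> y)\<^sup>2"
  by (simp add: Lagrange power2_eq_square inner_commute dot_cross)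

text \<open>The set of points with prescribed inner products with two independent vectors is a line,
  and a line meets a sphere at most twice.\<close>

lemma line_meets_sphere_at_most_twice:
  fixes x s :: "real^3"
  assumes "cross3 x s \<noteq> 0" and ne: "z1 \<noteq> z2"
    and n: "z \<bullet> z = z1 \<bullet> z1" "z2 \<bullet> z2 = z1 \<bullet> z1"
    and x: "z \<bullet> x = z1 \<bullet> x" "z2 \<bullet> x = z1 \<bullet> x"
    and s: "z \<bullet> s = z1 \<bullet> s" "z2 \<bullet> s = z1 \<bullet> s"
  shows "z = z1 \<or> z = z2"
proof -
  have par: "\<exists>t. w = t *\<^sub>R cross3 x s" if w: "w \<bullet> x = 0" "w \<bullet> s = 0" for w
  proof -
    let ?n = "cross3 x s"
    let ?s = "(x \<bullet> x) *\<^sub>R s - (x \<bullet> s) *\<^sub>R x"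
    have x0: "x \<noteq> 0" using assms(1) by auto
    have s0: "?s \<noteq> 0"
    proof
      assume "?s = 0"
      then have "cross3 x ?s = 0" by simp
      then have "(x \<bullet> x) *\<^sub>R cross3 x s = 0"
        by (simp add: Cross3.right_diff_distrib cross_mult_right)
      thus False using x0 assms(1) by simp
    qed
    have "w - ((w \<bullet> ?n) / (?n \<bullet> ?n)) *\<^sub>R ?n = 0"
      by (rule orthogonal_to_basis_zero [of x ?s ?n])
        (use x0 s0 assms(1) w in \<open>auto simp: inner_diff_left inner_diff_right dot_cross_self3 inner_commute\<close>)
    thus ?thesis by (metis eq_iff_diff_eq_0)
  qed
  obtain t where t: "z - z1 = t *\<^sub>R cross3 x s" using par[of "z - z1"] x s by (auto simp: inner_diff_left)
  obtain u where u: "z2 - z1 = u *\<^sub>R cross3 x s" using par[of "z2 - z1"] x s by (auto simp: inner_diff_left)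
  have u0: "u \<noteq> 0" using u ne by auto
  define m where "m = z2 - z1"
  have m0: "m \<noteq> 0" using ne by (simp add: m_def)
  have z: "z = z1 + (t / u) *\<^sub>R m" using t u u0 by (simp add: m_def algebra_simps)
  define r where "r = t / u"
  have 1: "2 * (z1 \<bullet> m) + m \<bullet> m = 0"
    using n(2) unfolding m_def by (simp add: algebra_simps inner_commute)
  have "2 * r * (z1 \<bullet> m) + r * r * (m \<bullet> m) = 0"
    using n(1) unfolding z r_def[symmetric] by (simp add: algebra_simps inner_commute)
  moreover have "z1 \<bullet> m = - (m \<bullet> m) / 2" using 1 by simp
  ultimately have "r * (r - 1) * (m \<bullet> m) = 0" by (simp add: algebra_simps)
  hence "r = 0 \<or> r = 1" using m0 by auto
  thus ?thesis using z unfolding r_def[symmetric] by (auto simp: m_def)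
qed

text \<open>The vectors \<open>x\<close>, \<open>y - \<theta> *\<^sub>R x\<close> and \<open>cross3 x y\<close> form an orthogonal basis; the last two have the same
length, so that \<open>a\<close> and \<open>b\<close> are the cosine and sine of the angle at \<open>x\<close> from \<open>y\<close> to \<open>z\<close>.\<close>

lemma circle_coordinates:
  fixes x y z :: "real^3"
  assumes "norm x = 1" "norm y = 1" "norm z = 1" "x \<bullet> y = \<theta>" "x \<bullet> z = \<theta>" "\<bar>\<theta>\<bar> < 1"
  obtains a b where "z = \<theta> *\<^sub>R x + a *\<^sub>R (y - \<theta> *\<^sub>R x) + b *\<^sub>R cross3 x y" "a\<^sup>2 + b\<^sup>2 = 1"
    "a * (1 - \<theta>\<^sup>2) = y \<bullet> z - \<theta>\<^sup>2"
proof -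
  let ?n = "cross3 x y" and ?u = "y - \<theta> *\<^sub>R x"
  have th: "\<theta>\<^sup>2 < 1" using assms(6) by (simp add: abs_square_less_1)
  have xx: "x \<bullet> x = 1" "y \<bullet> y = 1" "z \<bullet> z = 1" using assms by (simp_all add: norm_eq_1)
  have yx: "y \<bullet> x = \<theta>" "z \<bullet> x = \<theta>" using assms by (simp_all add: inner_commute)
  have nn: "?n \<bullet> ?n = 1 - \<theta>\<^sup>2" by (simp add: cross3_inner_self xx assms)
  have uu: "?u \<bullet> ?u = 1 - \<theta>\<^sup>2" by (simp add: inner_diff_left inner_diff_right xx yx assms power2_eq_square algebra_simps)
  define a where "a = (z \<bullet> ?u) / (1 - \<theta>\<^sup>2)"
  define b where "b = (z \<bullet> ?n) / (1 - \<theta>\<^sup>2)"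
  have un: "?u \<bullet> ?n = 0" "x \<bullet> ?n = 0" "x \<bullet> ?u = 0" "?u \<bullet> x = 0" "?n \<bullet> x = 0" "?n \<bullet> ?u = 0"
    by (simp_all add: inner_diff_left inner_diff_right dot_cross_self3 xx yx assms)
  have "z - (\<theta> *\<^sub>R x + a *\<^sub>R ?u + b *\<^sub>R ?n) = 0"
  proof (rule orthogonal_to_basis_zero [of x ?u ?n])
    show "x \<noteq> 0" "?u \<noteq> 0" "?n \<noteq> 0" using xx uu nn th by (metis inner_zero_left less_irrefl diff_gt_0_iff_gt zero_neq_one)+
    show "(z - (\<theta> *\<^sub>R x + a *\<^sub>R ?u + b *\<^sub>R ?n)) \<bullet> x = 0"
      using un by (simp add: inner_diff_left inner_add_left xx yx) 
    show "(z - (\<theta> *\<^sub>R x + a *\<^sub>R ?u + b *\<^sub>R ?n)) \<bullet> ?u = 0"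
      unfolding inner_diff_left[of z] inner_add_left inner_scaleR_left un uu using th by (simp add: a_def)
    show "(z - (\<theta> *\<^sub>R x + a *\<^sub>R ?u + b *\<^sub>R ?n)) \<bullet> ?n = 0"
      unfolding inner_diff_left[of z] inner_add_left inner_scaleR_left un nn using th by (simp add: b_def)
  qed (use un in auto)
  hence z: "z = \<theta> *\<^sub>R x + a *\<^sub>R ?u + b *\<^sub>R ?n" by simp
  have "1 = z \<bullet> z" using xx by simp
  also have "\<dots> = \<theta>\<^sup>2 + (a\<^sup>2 + b\<^sup>2) * (1 - \<theta>\<^sup>2)"
    apply (subst (1 2) z)
    unfolding inner_add_left inner_add_right inner_scaleR_left inner_scaleR_right un uu nn xx
    by (simp add: power2_eq_square algebra_simps)
  finally have "(a\<^sup>2 + b\<^sup>2 - 1) * (1 - \<theta>\<^sup>2) = 0" by (simp add: algebra_simps)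
  hence "a\<^sup>2 + b\<^sup>2 = 1" using th by simp
  moreover have "a * (1 - \<theta>\<^sup>2) = y \<bullet> z - \<theta>\<^sup>2"
    using th by (simp add: a_def inner_diff_right inner_commute yx power2_eq_square assms)
  ultimately show ?thesis using z that by blast
qed

section \<open>Regular polygons inscribed in the sphere\<close>

definition circle_point :: "'v::real_inner \<Rightarrow> 'v \<Rightarrow> 'v \<Rightarrow> real \<Rightarrow> nat \<Rightarrow> 'v" where
  "circle_point a e1 e2 \<phi> k = a + cos (real k * \<phi>) *\<^sub>R e1 + sin (real k * \<phi>) *\<^sub>R e2"

lemma circle_point_inner:
  assumes "a \<bullet> e1 = 0" "a \<bullet> e2 = 0" "e1 \<bullet> e2 = 0" "e1 \<bullet> e1 = \<rho>" "e2 \<bullet> e2 = \<rho>"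
  shows "circle_point a e1 e2 \<phi> i \<bullet> circle_point a e1 e2 \<phi> j
    = a \<bullet> a + \<rho> * cos ((real i - real j) * \<phi>)"
  using assms unfolding circle_point_def
  by (simp add: inner_add_left inner_add_right inner_commute cos_diff left_diff_distrib algebra_simps)

lemma nearest_multiple:
  assumes "0 < \<phi>" "\<phi> \<le> pi" "0 \<le> \<psi>"
  obtains k :: nat where "cos (\<phi> / 2) \<le> cos (real k * \<phi> - \<psi>)"
proof -
  define k where "k = nat \<lfloor>\<psi> / \<phi> + 1 / 2\<rfloor>"
  have "real k = of_int \<lfloor>\<psi> / \<phi> + 1 / 2\<rfloor>" using assms by (simp add: k_def)
  hence "\<bar>real k - \<psi> / \<phi>\<bar> \<le> 1 / 2" by linarith
  hence "\<bar>real k * \<phi> - \<psi>\<bar> \<le> \<phi> / 2" using assms by (simp add: abs_le_iff field_simps)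
  hence "cos (\<phi> / 2) \<le> cos \<bar>real k * \<phi> - \<psi>\<bar>" using assms by (intro cos_monotone_0_pi_le) auto
  thus ?thesis using that[of k] by simp
qed

lemma cos_double_step: "cos (t + \<phi> + \<phi>) = 2 * cos \<phi> * cos (t + \<phi>) - cos (t::real)"
  using cos_plus_cos[of "t + \<phi> + \<phi>" t] by (simp add: add_divide_distrib algebra_simps)

lemma sin_double_step: "sin (t + \<phi> + \<phi>) = 2 * cos \<phi> * sin (t + \<phi>) - sin (t::real)"
  using sin_plus_sin[of "t + \<phi> + \<phi>" t] by (simp add: add_divide_distrib algebra_simps)

lemma circle_point_step:
  "circle_point a e1 e2 \<phi> (Suc (Suc k)) =
     (2 * cos \<phi>) *\<^sub>R circle_point a e1 e2 \<phi> (Suc k) - circle_point a e1 e2 \<phi> k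
     + (2 - 2 * cos \<phi>) *\<^sub>R a"
proof -
  have e: "real (Suc (Suc k)) * \<phi> = real k * \<phi> + \<phi> + \<phi>" "real (Suc k) * \<phi> = real k * \<phi> + \<phi>"
    by (simp_all add: algebra_simps)
  show ?thesis
    unfolding circle_point_def e cos_double_step sin_double_step
    by (simp add: algebra_simps scaleR_2)
qed

text \<open>Subtracting two consecutive steps eliminates the centre: a polygon is continued from its last
three vertices by a linear rule.\<close>

lemma circle_point_walk:
  "circle_point a e1 e2 \<phi> (Suc (Suc (Suc k))) = circle_point a e1 e2 \<phi> k
     + (1 + 2 * cos \<phi>) *\<^sub>R (circle_point a e1 e2 \<phi> (Suc (Suc k)) - circle_point a e1 e2 \<phi> (Suc k))"
proof -
  have "(2 - 2 * cos \<phi>) *\<^sub>R a = circle_point a e1 e2 \<phi> (Suc (Suc k))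
      - (2 * cos \<phi>) *\<^sub>R circle_point a e1 e2 \<phi> (Suc k) + circle_point a e1 e2 \<phi> k"
    by (simp add: circle_point_step)
  thus ?thesis
    unfolding circle_point_step[of a e1 e2 \<phi> "Suc k"] by (simp add: algebra_simps)
qed

text \<open>The second axis is the part of \<open>p1\<close> that is orthogonal to \<open>a\<close> and to the first axis \<open>p0 - a\<close>.\<close>

lemma circle_through_two_points:
  fixes a p0 p1 :: "'v::real_inner"
  assumes "sin \<phi> \<noteq> 0" "a \<bullet> p0 = a \<bullet> a" "a \<bullet> p1 = a \<bullet> a"
    and "p0 \<bullet> p0 = a \<bullet> a + \<rho>" "p1 \<bullet> p1 = a \<bullet> a + \<rho>" "p0 \<bullet> p1 = a \<bullet> a + \<rho> * cos \<phi>"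
  obtains e1 e2 where "a \<bullet> e1 = 0" "a \<bullet> e2 = 0" "e1 \<bullet> e2 = 0" "e1 \<bullet> e1 = \<rho>" "e2 \<bullet> e2 = \<rho>"
    "circle_point a e1 e2 \<phi> 0 = p0" "circle_point a e1 e2 \<phi> 1 = p1"
proof
  define e1 where "e1 = p0 - a"
  define f where "f = p1 - a - cos \<phi> *\<^sub>R e1"
  let ?e2 = "(1 / sin \<phi>) *\<^sub>R f"
  have i: "p0 \<bullet> a = a \<bullet> a" "p1 \<bullet> a = a \<bullet> a" "p1 \<bullet> p0 = a \<bullet> a + \<rho> * cos \<phi>" using assms by (simp_all add: inner_commute)
  note s = i assms inner_diff_left inner_diff_right
  show ae: "a \<bullet> e1 = 0" by (simp add: e1_def s)
  have ea: "e1 \<bullet> a = 0" using ae by (simp add: inner_commute)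
  show ee: "e1 \<bullet> e1 = \<rho>" by (simp add: e1_def s)
  have pe: "p1 \<bullet> e1 = \<rho> * cos \<phi>" by (simp add: e1_def s)
  have ep: "e1 \<bullet> p1 = \<rho> * cos \<phi>" using pe by (simp add: inner_commute)
  have af: "a \<bullet> f = 0" by (simp add: f_def s ae)
  have ef: "e1 \<bullet> f = 0" by (simp add: f_def s ee ea ep)
  have "f \<bullet> f = \<rho> * (1 - (cos \<phi>)\<^sup>2)"
    by (simp add: f_def s ee ea ep pe ae power2_eq_square algebra_simps)
  hence ff: "f \<bullet> f = \<rho> * (sin \<phi>)\<^sup>2" by (simp add: sin_squared_eq)
  show "a \<bullet> ?e2 = 0" by (simp add: af)
  show "e1 \<bullet> ?e2 = 0" by (simp add: ef)
  show "?e2 \<bullet> ?e2 = \<rho>" using assms(1) by (simp add: ff power2_eq_square)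
  show "circle_point a e1 ?e2 \<phi> 0 = p0" by (simp add: circle_point_def e1_def)
  show "circle_point a e1 ?e2 \<phi> 1 = p1" using assms(1) by (simp add: circle_point_def f_def)
qed

text \<open>Unless \<open>\<phi>\<close> is one of the three angles, \<open>4 * \<phi>\<close> or \<open>5 * \<phi>\<close> differs from a full turn by less than \<open>\<phi>\<close>, but
not by zero.\<close>

lemma separated_multiples:
  assumes \<phi>: "pi / 3 < \<phi>" "\<phi> \<le> 2 * pi / 3"
    and sep: "\<And>k::nat. cos (real k * \<phi>) \<le> cos \<phi> \<or> cos (real k * \<phi>) = 1"
  shows "\<phi> = 2 * pi / 3 \<or> \<phi> = 2 * pi / 4 \<or> \<phi> = 2 * pi / 5"
proof (rule ccontr)
  assume neg: "\<not> ?thesis"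
  have pi0: "pi > 0" by simp
  have clash: False if "0 < \<psi>" "\<psi> < \<phi>" "cos (real k * \<phi>) = cos \<psi>" for k \<psi>
  proof -
    have "cos \<phi> < cos \<psi>" by (rule cos_monotone_0_pi) (use that \<phi> pi0 in linarith)+
    moreover have "cos \<psi> < cos 0" by (rule cos_monotone_0_pi) (use that \<phi> pi0 in linarith)+
    ultimately show False using sep[of k] that by auto
  qed
  consider "\<phi> > pi / 2" "\<phi> < 2 * pi / 3" | "2 * pi / 5 < \<phi>" "\<phi> < pi / 2" | "pi / 3 < \<phi>" "\<phi> < 2 * pi / 5"
    using \<phi> neg by linarith
  thus False
  proof cases
    case 1
    have "cos (real 4 * \<phi>) = cos (4 * \<phi> - 2 * pi)" by (simp add: cos_diff)
    thus False using clash[of "4 * \<phi> - 2 * pi" 4] 1 by linarith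
  next
    case 2
    have "cos (real 4 * \<phi>) = cos (2 * pi - 4 * \<phi>)" by (simp add: cos_diff)
    thus False using clash[of "2 * pi - 4 * \<phi>" 4] 2 by linarith
  next
    case 3
    have "cos (real 5 * \<phi>) = cos (2 * pi - 5 * \<phi>)" by (simp add: cos_diff)
    thus False using clash[of "2 * pi - 5 * \<phi>" 5] 3 by linarith
  qed
qed

definition golden :: real where "golden = (1 + sqrt 5) / 2"

lemma golden_square: "golden * golden = golden + 1"
  by (simp add: golden_def field_simps)

lemma golden_bounds: "1.6 < golden" "golden < 1.7"
proof -
  have "sqrt 5 > 2.2" by (rule real_less_rsqrt) (simp add: power2_eq_square)
  moreover have "sqrt 5 < 2.4" by (rule real_less_lsqrt) (simp_all add: power2_eq_square)
  ultimately show "1.6 < golden" "golden < 1.7" by (simp_all add: golden_def)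
qed

text \<open>For \<open>x = 2 * pi / 5\<close> the angles \<open>2 * x\<close> and \<open>3 * x\<close> have the same cosine, which gives a cubic equation for
\<open>cos x\<close> with the trivial root 1.\<close>

lemma cos_72: "cos (2 * pi / 5) = (golden - 1) / 2"
proof -
  define x where "x = 2 * pi / 5"
  define c where "c = cos x"
  have "cos (3 * x) = cos (2 * pi - 3 * x)" by (simp add: cos_diff)
  also have "2 * pi - 3 * x = 2 * x" by (simp add: x_def)
  finally have "4 * c ^ 3 - 3 * c = 2 * c\<^sup>2 - 1"
    by (simp add: cos_treble_cos cos_double_cos c_def)
  hence "(c - 1) * (4 * c\<^sup>2 + 2 * c - 1) = 0" by (simp add: power2_eq_square power3_eq_cube algebra_simps)
  moreover have "c < cos 0" unfolding c_def by (rule cos_monotone_0_pi) (simp_all add: x_def)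
  ultimately have q: "4 * c\<^sup>2 + 2 * c - 1 = 0" by simp
  have c0: "c > 0" unfolding c_def by (rule cos_gt_zero) (simp_all add: x_def)
  define g where "g = 2 * c + 1"
  have "(g - golden) * (g + golden - 1) = 0"
    using q golden_square by (simp add: g_def power2_eq_square algebra_simps)
  hence "g = golden" using golden_bounds c0 by (auto simp: g_def)
  thus ?thesis by (simp add: c_def x_def g_def)
qed

text \<open>In a circle of radius \<open>r\<close> the chord of the angle \<open>2 * pi / p\<close> has the squared length
\<open>2 * r\<^sup>2 * (1 - cos (2 * pi / p))\<close>; between unit vectors with inner product \<open>\<theta>\<close> the squared distance is
\<open>2 * (1 - \<theta>)\<close>.\<close>

definition circumradius :: "real \<Rightarrow> nat \<Rightarrow> real" where
  "circumradius \<theta> p = sqrt ((1 - \<theta>) / (1 - cos (2 * pi / real p)))"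

text \<open>The vertices are unit vectors, adjacent ones have inner product \<open>\<theta>\<close>, and \<open>a\<close> is the centre.  The
condition \<open>\<theta> < norm a\<close> compares the cosines of the side and of the circumradius on the sphere: the
circumradius is the smaller arc.\<close>

definition inscribed_polygon :: "real \<Rightarrow> nat \<Rightarrow> real^3 \<Rightarrow> (real^3) set \<Rightarrow> bool" where
  "inscribed_polygon \<theta> p a G \<longleftrightarrow> p \<in> {3, 4, 5} \<and> \<theta> < norm a \<and> a \<noteq> 0 \<and> a \<bullet> a < 1 \<and>
     (\<exists>e1 e2. a \<bullet> e1 = 0 \<and> a \<bullet> e2 = 0 \<and> e1 \<bullet> e2 = 0 \<and>
        e1 \<bullet> e1 = 1 - a \<bullet> a \<and> e2 \<bullet> e2 = 1 - a \<bullet> a \<and>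
        a \<bullet> a + (1 - a \<bullet> a) * cos (2 * pi / real p) = \<theta> \<and>
        G = circle_point a e1 e2 (2 * pi / real p) ` {..<p})"

lemma circle_point_mod:
  assumes "p > 0"
  shows "circle_point a e1 e2 (2 * pi / real p) (k mod p) = circle_point a e1 e2 (2 * pi / real p) k"
proof -
  have "real k = real (k mod p) + real p * real (k div p)"
    by (metis mod_mult_div_eq of_nat_add of_nat_mult)
  hence e: "real k * (2 * pi / real p) = real (k mod p) * (2 * pi / real p) + real (k div p) * (2 * pi)"
    using assms by (simp add: field_simps)
  have *: "cos (t + real n * (2 * pi)) = cos t \<and> sin (t + real n * (2 * pi)) = sin t" for t n
    by (induction n) (auto simp: algebra_simps sin_add cos_add)
  show ?thesis unfolding circle_point_def e using * by simp
qed

lemma circle_point_range: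
  assumes "p > 0"
  shows "circle_point a e1 e2 (2 * pi / real p) ` {..<p} = range (circle_point a e1 e2 (2 * pi / real p))"
proof
  show "range (circle_point a e1 e2 (2 * pi / real p)) \<subseteq> circle_point a e1 e2 (2 * pi / real p) ` {..<p}"
    using circle_point_mod[OF assms] assms
    by (metis image_subsetI image_eqI lessThan_iff mod_less_divisor)
qed auto

text \<open>As the circumradius is less than the side, every point of the spherical cap bounded by the
circumcircle is closer to some vertex than adjacent vertices are to each other.  A point \<open>z\<close> of
the cap at height \<open>u\<close> has a vertex within half a central angle of its own longitude.  The resulting
bound on the inner product is concave in \<open>u\<close>, so that only the centre and the rim of the cap have
to be compared with \<open>\<theta>\<close>.\<close>

lemma cap_of_inscribed_polygon_empty:
  assumes G: "inscribed_polygon \<theta> p a G"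
    and z: "norm z = 1" "a \<bullet> z \<ge> a \<bullet> a" and sep: "\<And>g. g \<in> G \<Longrightarrow> z \<bullet> g \<le> \<theta> \<or> z = g"
  shows "z \<in> G"
proof (rule ccontr)
  assume "z \<notin> G"
  obtain e1 e2 where p: "p \<in> {3, 4, 5}" and ha: "\<theta> < norm a" "a \<noteq> 0" "a \<bullet> a < 1"
    and e: "a \<bullet> e1 = 0" "a \<bullet> e2 = 0" "e1 \<bullet> e2 = 0" "e1 \<bullet> e1 = 1 - a \<bullet> a" "e2 \<bullet> e2 = 1 - a \<bullet> a"
    and th: "a \<bullet> a + (1 - a \<bullet> a) * cos (2 * pi / real p) = \<theta>"
    and Gd: "G = circle_point a e1 e2 (2 * pi / real p) ` {..<p}"
    using G unfolding inscribed_polygon_def by blast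
  define \<phi> where "\<phi> = 2 * pi / real p"
  have p0: "p > 0" using p by auto
  have \<phi>: "\<phi> > 0" "\<phi> \<le> 2 * pi / 3" using p by (auto simp: \<phi>_def)
  have sep': "z \<bullet> circle_point a e1 e2 \<phi> k \<le> \<theta>" for k
    using sep \<open>z \<notin> G\<close> unfolding Gd circle_point_range[OF p0] \<phi>_def by blast
  define h where "h = norm a"
  have hh: "a \<bullet> a = h\<^sup>2" by (simp add: h_def power2_norm_eq_inner)
  have h: "h > 0" "h < 1" "\<theta> < h"
    using ha by (auto simp: h_def norm_lt_square)
  define \<rho> where "\<rho> = 1 - h\<^sup>2"
  have \<rho>: "\<rho> > 0" using ha(3) by (simp add: \<rho>_def hh)
  define u where "u = (z \<bullet> a) / h"
  have za: "z \<bullet> a = u * h" using h by (simp add: u_def)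
  have uh: "u \<ge> h" using z(2) h by (simp add: u_def hh inner_commute power2_eq_square pos_le_divide_eq)
  have u1: "u \<le> 1"
    using Cauchy_Schwarz_ineq2[of z a] z(1) h by (simp add: u_def h_def[symmetric] divide_le_eq)
  let ?x = "z \<bullet> e1" and ?y = "z \<bullet> e2"
  have comp: "?x\<^sup>2 + ?y\<^sup>2 = \<rho> * (1 - u\<^sup>2)"
  proof -
    have e': "e1 \<bullet> a = 0" "e2 \<bullet> a = 0" "e2 \<bullet> e1 = 0" using e by (simp_all add: inner_commute)
    define d where "d = z - ((u / h) *\<^sub>R a + (?x / \<rho>) *\<^sub>R e1 + (?y / \<rho>) *\<^sub>R e2)"
    have "d = 0"
    proof (rule orthogonal_to_basis_zero [OF e(1,2,3)])
      show "a \<noteq> 0" "e1 \<noteq> 0" "e2 \<noteq> 0" using ha e \<rho> unfolding \<rho>_def hh by auto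
      show "d \<bullet> a = 0" "d \<bullet> e1 = 0" "d \<bullet> e2 = 0"
        unfolding d_def inner_diff_left inner_add_left inner_scaleR_left e' e hh za \<rho>_def[symmetric]
        using h \<rho> by (simp_all add: power2_eq_square)
    qed
    hence "z = (u / h) *\<^sub>R a + (?x / \<rho>) *\<^sub>R e1 + (?y / \<rho>) *\<^sub>R e2" by (simp add: d_def)
    hence "z \<bullet> z = z \<bullet> ((u / h) *\<^sub>R a + (?x / \<rho>) *\<^sub>R e1 + (?y / \<rho>) *\<^sub>R e2)" by simp
    also have "\<dots> = u\<^sup>2 + (?x\<^sup>2 + ?y\<^sup>2) / \<rho>"
      using h by (simp add: inner_add_right za power2_eq_square add_divide_distrib)
    finally have "1 = u\<^sup>2 + (?x\<^sup>2 + ?y\<^sup>2) / \<rho>" using z by (simp add: norm_eq_1)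
    thus ?thesis using \<rho> by (simp add: field_simps)
  qed
  define D where "D = sqrt (?x\<^sup>2 + ?y\<^sup>2)"
  obtain \<psi> where \<psi>: "0 \<le> \<psi>" "\<psi> < 2 * pi" "?x = D * cos \<psi>" "?y = D * sin \<psi>"
  proof (cases "D = 0")
    case True
    hence "?x = 0 \<and> ?y = 0" by (simp add: D_def sum_power2_eq_zero_iff)
    thus ?thesis using that[of 0] True by simp
  next
    case False
    have "(?x / D)\<^sup>2 + (?y / D)\<^sup>2 = 1"
      using False by (simp add: D_def power_divide add_divide_distrib[symmetric])
    then obtain t where "0 \<le> t" "t < 2 * pi" "?x / D = cos t" "?y / D = sin t"
      using sincos_total_2pi by metis
    thus ?thesis using that[of t] False by (simp add: field_simps)
  qed
  define c' where "c' = cos (\<phi> / 2)"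
  obtain k :: nat where near: "cos (real k * \<phi> - \<psi>) \<ge> c'"
    using nearest_multiple[of \<phi> \<psi>] \<psi> \<phi> unfolding c'_def by auto
  have c': "c' \<ge> 1 / 2" "c' < 1"
  proof -
    have "cos (\<phi> / 2) \<ge> cos (pi / 3)"
      by (rule cos_monotone_0_pi_le) (use \<phi> in auto)
    thus "c' \<ge> 1 / 2" by (simp add: c'_def cos_60)
    have "cos (\<phi> / 2) < cos 0"
      by (rule cos_monotone_0_pi) (use \<phi> in auto)
    thus "c' < 1" by (simp add: c'_def)
  qed
  have c: "cos \<phi> = 2 * c'\<^sup>2 - 1" using cos_double_cos[of "\<phi> / 2"] by (simp add: c'_def)
  \<comment> \<open>The semicircle \<open>D\<close> over \<open>u\<close> lies above its chord between the rim and the centre.\<close>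
  have D: "D \<ge> (1 + h) * (1 - u)"
  proof -
    have "((1 + h) * (1 - u))\<^sup>2 \<le> \<rho> * (1 - u\<^sup>2)"
    proof -
      have "\<rho> * (1 - u\<^sup>2) - ((1 + h) * (1 - u))\<^sup>2 = 2 * ((1 + h) * (1 - u)) * (u - h)"
        by (simp add: \<rho>_def power2_eq_square algebra_simps)
      moreover have "\<dots> \<ge> 0" using h u1 uh by simp
      ultimately show ?thesis by linarith
    qed
    thus ?thesis unfolding D_def comp by (rule real_le_rsqrt)
  qed
  have "z \<bullet> circle_point a e1 e2 \<phi> k = u * h + D * cos (real k * \<phi> - \<psi>)"
    by (simp add: circle_point_def inner_add_right za \<psi>(3,4) cos_diff algebra_simps)
  also have "\<dots> \<ge> u * h + D * c'"
    using near by (simp add: D_def mult_left_mono)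
  finally have "u * h + D * c' \<le> \<theta>" using sep'[of k] by linarith
  moreover have "(1 + h) * (1 - u) * c' \<le> D * c'" using D c' by (intro mult_right_mono) auto
  ultimately have le: "u * h + (1 + h) * (1 - u) * c' \<le> \<theta>" by linarith
  have rim: "h\<^sup>2 + c' * (1 - h\<^sup>2) > \<theta>"
  proof -
    have "h\<^sup>2 + c' * (1 - h\<^sup>2) - \<theta> = (1 - h\<^sup>2) * ((1 - c') * (1 + 2 * c'))"
      unfolding th[symmetric] hh \<phi>_def[symmetric] c by (simp add: power2_eq_square algebra_simps)
    moreover have "\<dots> > 0" using \<rho> c' by (simp add: \<rho>_def)
    ultimately show ?thesis by linarith
  qed
  have "(1 - h) * (u * h + (1 + h) * (1 - u) * c' - \<theta>)
      = (u - h) * (h - \<theta>) + (1 - u) * (h\<^sup>2 + c' * (1 - h\<^sup>2) - \<theta>)"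
    by (simp add: power2_eq_square algebra_simps)
  moreover have "\<dots> > 0"
  proof (cases "u = h")
    case True
    thus ?thesis using rim h by simp
  next
    case False
    have "(u - h) * (h - \<theta>) > 0" using False uh h by simp
    moreover have "(1 - u) * (h\<^sup>2 + c' * (1 - h\<^sup>2) - \<theta>) \<ge> 0" using u1 rim by simp
    ultimately show ?thesis by linarith
  qed
  ultimately have "0 < (1 - h) * (u * h + (1 + h) * (1 - u) * c' - \<theta>)" by linarith
  thus False using le h by (simp add: zero_less_mult_iff)
qed

lemma inscribed_polygon_plane:
  assumes "inscribed_polygon \<theta> p a G" "g \<in> G"
  shows "a \<bullet> g = a \<bullet> a" "norm g = 1"
proof -
  obtain e1 e2 where e: "a \<bullet> e1 = 0" "a \<bullet> e2 = 0" "e1 \<bullet> e2 = 0" "e1 \<bullet> e1 = 1 - a \<bullet> a" "e2 \<bullet> e2 = 1 - a \<bullet> a"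
    and Gd: "G = circle_point a e1 e2 (2 * pi / real p) ` {..<p}"
    using assms unfolding inscribed_polygon_def by blast
  obtain k where g: "g = circle_point a e1 e2 (2 * pi / real p) k" using assms Gd by auto
  show "a \<bullet> g = a \<bullet> a" by (simp add: g circle_point_def inner_add_right e)
  have "g \<bullet> g = 1" unfolding g circle_point_inner[OF e] by simp
  thus "norm g = 1" by (simp add: norm_eq_1)
qed

lemma inscribed_polygon_regular:
  assumes "inscribed_polygon \<theta> p a G"
  shows "regular_polygon p (circumradius \<theta> p) (convex hull G)"
proof -
  obtain e1 e2 where p: "p \<in> {3, 4, 5}" and ha: "a \<bullet> a < 1"
    and e: "a \<bullet> e1 = 0" "a \<bullet> e2 = 0" "e1 \<bullet> e2 = 0" "e1 \<bullet> e1 = 1 - a \<bullet> a" "e2 \<bullet> e2 = 1 - a \<bullet> a"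
    and th: "a \<bullet> a + (1 - a \<bullet> a) * cos (2 * pi / real p) = \<theta>"
    and Gd: "G = circle_point a e1 e2 (2 * pi / real p) ` {..<p}"
    using assms unfolding inscribed_polygon_def by blast
  let ?r = "circumradius \<theta> p"
  have "cos (2 * pi / real p) < cos 0" by (rule cos_monotone_0_pi) (use p in auto)
  hence "(1 - \<theta>) / (1 - cos (2 * pi / real p)) = 1 - a \<bullet> a"
    unfolding th[symmetric] by (simp add: field_simps)
  hence r: "?r\<^sup>2 = 1 - a \<bullet> a" "?r > 0" using ha by (simp_all add: circumradius_def)
  have "norm e1 = ?r" "norm e2 = ?r"
    using r e by (metis less_imp_le norm_eq_sqrt_inner real_sqrt_unique)+
  hence nr: "norm ((1 / ?r) *\<^sub>R e1) = 1" "norm ((1 / ?r) *\<^sub>R e2) = 1" using r by simp_all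
  moreover have eq: "(\<lambda>k. a + (?r * cos (2 * pi * real k / real p)) *\<^sub>R ((1 / ?r) *\<^sub>R e1)
        + (?r * sin (2 * pi * real k / real p)) *\<^sub>R ((1 / ?r) *\<^sub>R e2))
      = circle_point a e1 e2 (2 * pi / real p)"
    using r by (simp add: circle_point_def fun_eq_iff mult_ac)
  ultimately show ?thesis
    unfolding regular_polygon_def Gd using p r(2) e(3) nr
    by (intro conjI exI[of _ a] exI[of _ "(1 / ?r) *\<^sub>R e1"] exI[of _ "(1 / ?r) *\<^sub>R e2"])
      (simp_all only:, auto)
qed

section \<open>From vertex figures to facets\<close>

definition neighbours :: "(real^3) set \<Rightarrow> real \<Rightarrow> real^3 \<Rightarrow> (real^3) set" where
  "neighbours X \<theta> x = {y \<in> X. x \<bullet> y = \<theta>}"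

text \<open>The neighbours \<open>y i\<close> of \<open>v\<close> are in cyclic order and \<open>G i\<close> is the face between \<open>y i\<close> and \<open>y (Suc i mod q)\<close>.  The
cyclic order is expressed without angles, by the last condition: the sectors spanned by
consecutive neighbours cover all directions from \<open>v\<close>.\<close>

definition vertex_figure :: "(real^3) set \<Rightarrow> real \<Rightarrow> real^3 \<Rightarrow> nat \<Rightarrow> (nat \<Rightarrow> real^3) \<Rightarrow>
    (nat \<Rightarrow> nat) \<Rightarrow> (nat \<Rightarrow> real^3) \<Rightarrow> (nat \<Rightarrow> (real^3) set) \<Rightarrow> bool" where
  "vertex_figure X \<theta> v q y p a G \<longleftrightarrow>
     3 \<le> q \<and> inj_on y {..<q} \<and> y ` {..<q} = neighbours X \<theta> v \<and>
     (\<forall>i<q. inscribed_polygon \<theta> (p i) (a i) (G i) \<and> G i \<subseteq> X \<and>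
        {v, y i, y (Suc i mod q)} \<subseteq> G i) \<and>
     (\<forall>w. \<exists>i<q. \<exists>l m k. 0 \<le> l \<and> 0 \<le> m \<and>
        w = l *\<^sub>R y i + m *\<^sub>R y (Suc i mod q) + k *\<^sub>R v)"

locale separated_points =
  fixes X :: "(real^3) set" and \<theta> :: real
  assumes finite: "finite X" and nonempty: "X \<noteq> {}"
    and unit: "x \<in> X \<Longrightarrow> norm x = 1"
    and separated: "x \<in> X \<Longrightarrow> y \<in> X \<Longrightarrow> x \<noteq> y \<Longrightarrow> x \<bullet> y \<le> \<theta>"
    and theta: "- 1 < \<theta>" "\<theta> < 1"
    and spanning: "span X = UNIV"
begin

abbreviation nbrs :: "real^3 \<Rightarrow> (real^3) set" where
  "nbrs \<equiv> neighbours X \<theta>"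

lemma unit_inner: "x \<in> X \<Longrightarrow> x \<bullet> x = 1"
  using unit by (simp add: norm_eq_1)

lemma neighbours_sym: "x \<in> X \<Longrightarrow> y \<in> nbrs x \<Longrightarrow> x \<in> nbrs y"
  by (auto simp: neighbours_def inner_commute)

lemma neighbours_subset: "nbrs x \<subseteq> X"
  by (auto simp: neighbours_def)

lemma neighbour_neq: "x \<in> X \<Longrightarrow> y \<in> nbrs x \<Longrightarrow> y \<noteq> x"
  using unit_inner theta by (auto simp: neighbours_def)

lemma vertices_hull: "vertices (convex hull X) = X"
proof
  show "vertices (convex hull X) \<subseteq> X"
    by (auto simp: vertices_def extreme_point_of_convex_hull)
  show "X \<subseteq> vertices (convex hull X)"
  proof
    fix x assume x: "x \<in> X"
    have sub: "convex hull X \<subseteq> cball 0 1"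
      by (rule hull_minimal) (use unit in \<open>auto simp: convex_cball\<close>)
    have le: "y \<bullet> x \<le> 1" if "y \<in> convex hull X" for y
      using norm_cauchy_schwarz[of y x] sub that unit[OF x] by fastforce
    have eq: "y = x" if y: "y \<in> convex hull X" "y \<bullet> x = 1" for y
    proof -
      have "norm y \<le> 1" using sub y by auto
      hence "y \<bullet> y \<le> 1" using power2_norm_eq_inner[of y] abs_square_le_1[of "norm y"] by simp
      moreover have "(y - x) \<bullet> (y - x) = y \<bullet> y - 1"
        using unit_inner[OF x] y by (simp add: inner_diff_left inner_diff_right inner_commute)
      ultimately have "(y - x) \<bullet> (y - x) \<le> 0" by simp
      thus "y = x" by (metis inner_ge_zero inner_eq_zero_iff dual_order.antisym eq_iff_diff_eq_0)
    qed
    have False if ab: "a \<in> convex hull X" "b \<in> convex hull X" "x \<in> open_segment a b" for a b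
    proof -
      obtain u where u: "0 < u" "u < 1" "x = (1 - u) *\<^sub>R a + u *\<^sub>R b" "a \<noteq> b"
        using ab(3) by (auto simp: in_segment)
      have "1 = x \<bullet> x" using unit_inner[OF x] by simp
      also have "\<dots> = ((1 - u) *\<^sub>R a + u *\<^sub>R b) \<bullet> x" by (subst (1) u(3)) simp
      finally have "(1 - u) * (1 - a \<bullet> x) + u * (1 - b \<bullet> x) = 0"
        by (simp add: inner_add_left algebra_simps)
      moreover have "(1 - u) * (1 - a \<bullet> x) \<ge> 0" "u * (1 - b \<bullet> x) \<ge> 0"
        using u le ab by simp_all
      ultimately have "(1 - u) * (1 - a \<bullet> x) = 0" "u * (1 - b \<bullet> x) = 0" by linarith+
      hence "a \<bullet> x = 1" "b \<bullet> x = 1" using u by simp_all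
      hence "a = x" "b = x" using eq ab by simp_all
      thus False using u(4) by simp
    qed
    thus "x \<in> vertices (convex hull X)"
      using hull_inc[OF x, of convex] by (auto simp: vertices_def extreme_point_of_def)
  qed
qed

end

text \<open>The condition on the sum is the contribution of the primitive idempotent: the centroid of the
neighbours of a point lies on its axis.\<close>

locale neighbour_balanced = separated_points +
  fixes q :: nat
  assumes q_ge_3: "3 \<le> q"
    and card_neighbours: "x \<in> X \<Longrightarrow> card (nbrs x) = q"
    and sum_neighbours: "x \<in> X \<Longrightarrow> (\<Sum>y\<in>nbrs x. y) = (real q * \<theta>) *\<^sub>R x"
begin

lemma vertex_figureD:
  assumes vf: "vertex_figure X \<theta> v q y p a G" and i: "i < q"
  shows "Suc i mod q < q" "Suc i mod q \<noteq> i" "inj_on y {..<q}" "y ` {..<q} = nbrs v"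
    "y i \<in> nbrs v" "y (Suc i mod q) \<in> nbrs v"
    "y i \<in> X" "y (Suc i mod q) \<in> X" "y i \<noteq> y (Suc i mod q)"
    "inscribed_polygon \<theta> (p i) (a i) (G i)" "G i \<subseteq> X" "v \<in> G i" "y i \<in> G i" "y (Suc i mod q) \<in> G i"
proof -
  show S: "Suc i mod q < q" "Suc i mod q \<noteq> i" using i q_ge_3 by (auto simp: mod_Suc)
  show inj: "inj_on y {..<q}" and im: "y ` {..<q} = nbrs v"
    and "inscribed_polygon \<theta> (p i) (a i) (G i)" "G i \<subseteq> X" "v \<in> G i" "y i \<in> G i" "y (Suc i mod q) \<in> G i"
    using assms unfolding vertex_figure_def by auto
  show "y i \<in> nbrs v" "y (Suc i mod q) \<in> nbrs v"
    unfolding im[symmetric] using S i by auto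
  thus "y i \<in> X" "y (Suc i mod q) \<in> X" using neighbours_subset by auto
  show "y i \<noteq> y (Suc i mod q)" using inj S i by (metis inj_onD lessThan_iff)
qed

lemma vertex_figure_sector:
  assumes "vertex_figure X \<theta> v q y p a G"
  obtains i l m k where "i < q" "0 \<le> l" "0 \<le> m"
    "w = l *\<^sub>R y i + m *\<^sub>R y (Suc i mod q) + k *\<^sub>R v"
proof -
  have "\<exists>i<q. \<exists>l m k. 0 \<le> l \<and> 0 \<le> m \<and> w = l *\<^sub>R y i + m *\<^sub>R y (Suc i mod q) + k *\<^sub>R v"
    using assms unfolding vertex_figure_def by simp
  thus ?thesis using that by auto
qed

lemma obtain_neighbour:
  assumes x: "x \<in> X"
  obtains y where "y \<in> nbrs x"
  using card_neighbours[OF x] q_ge_3 by (cases "nbrs x = {}") auto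

text \<open>Summing the neighbours of all points of \<open>S\<close> counts every point of \<open>S\<close> exactly \<open>q\<close> times, but also
multiplies the sum of \<open>S\<close> by \<open>q * \<theta>\<close>.\<close>

lemma neighbour_closed_sum_zero:
  assumes S: "S \<subseteq> X" "\<And>x. x \<in> S \<Longrightarrow> nbrs x \<subseteq> S"
  shows "(\<Sum>x\<in>S. x) = 0"
proof -
  have finS: "finite S" using S(1) finite by (rule finite_subset)
  have card: "card {x \<in> S. y \<bullet> x = \<theta>} = q" if y: "y \<in> S" for y
  proof -
    have "{x \<in> S. y \<bullet> x = \<theta>} = nbrs y"
      using S y by (auto simp: neighbours_def)
    thus ?thesis using card_neighbours y S by auto
  qed
  have "(\<Sum>x\<in>S. \<Sum>y\<in>{y \<in> S. x \<bullet> y = \<theta>}. y) = (\<Sum>x\<in>S. (real q * \<theta>) *\<^sub>R x)"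
  proof (rule sum.cong [OF refl])
    fix x assume x: "x \<in> S"
    have "{y \<in> S. x \<bullet> y = \<theta>} = nbrs x"
      using S x by (auto simp: neighbours_def)
    thus "(\<Sum>y\<in>{y \<in> S. x \<bullet> y = \<theta>}. y) = (real q * \<theta>) *\<^sub>R x"
      using sum_neighbours x S by auto
  qed
  moreover have "(\<Sum>x\<in>S. \<Sum>y\<in>{y \<in> S. x \<bullet> y = \<theta>}. y) = (\<Sum>y\<in>S. \<Sum>x\<in>{x \<in> S. x \<bullet> y = \<theta>}. y)"
    by (rule sum.swap_restrict [OF finS finS])
  moreover have "\<dots> = (\<Sum>y\<in>S. real q *\<^sub>R y)"
    using card by (intro sum.cong) (simp_all add: inner_commute sum_constant_scaleR del: sum_constant)
  ultimately have "real q *\<^sub>R (\<Sum>x\<in>S. x) = (real q * \<theta>) *\<^sub>R (\<Sum>x\<in>S. x)"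
    by (simp add: scaleR_sum_right)
  hence "(real q * (1 - \<theta>)) *\<^sub>R (\<Sum>x\<in>S. x) = 0"
    by (simp add: right_diff_distrib scaleR_left_diff_distrib)
  thus ?thesis using theta q_ge_3 by simp
qed

lemma sum_zero: "(\<Sum>x\<in>X. x) = 0"
  by (rule neighbour_closed_sum_zero) (use neighbours_subset in auto)

text \<open>Let \<open>z\<close> be a point outside a union \<open>S\<close> of connected components and \<open>s \<in> S\<close> a point
  nearest to it.  Writing \<open>z\<close> in the sector of the vertex figure at \<open>s\<close> that contains it, \<open>z\<close>
  would lie beyond the plane of a face whose distance from the origin exceeds \<open>\<theta>\<close>, and so be
  nearer to \<open>s\<close> than \<open>\<theta>\<close> allows.\<close>

lemma neighbour_closed_eq:
  assumes vf: "\<And>v. v \<in> X \<Longrightarrow> \<exists>y p a G. vertex_figure X \<theta> v q y p a G"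
    and S: "S \<subseteq> X" "S \<noteq> {}" "\<And>x. x \<in> S \<Longrightarrow> nbrs x \<subseteq> S"
  shows "S = X"
proof (rule ccontr)
  assume "S \<noteq> X"
  then obtain z where z: "z \<in> X" "z \<notin> S" using S(1) by blast
  have finS: "finite S" using S(1) finite by (rule finite_subset)
  obtain s where s: "s \<in> S" "\<And>x. x \<in> S \<Longrightarrow> z \<bullet> x \<le> z \<bullet> s"
  proof -
    have "Max ((\<lambda>x. z \<bullet> x) ` S) \<in> (\<lambda>x. z \<bullet> x) ` S"
      using finS S(2) by (intro Max_in) auto
    then obtain s where "s \<in> S" "z \<bullet> s = Max ((\<lambda>x. z \<bullet> x) ` S)" by auto
    thus ?thesis using that[of s] finS by simp
  qed
  have pos: "0 \<le> z \<bullet> s"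
  proof (rule ccontr)
    assume "\<not> 0 \<le> z \<bullet> s"
    hence "(\<Sum>x\<in>S. z \<bullet> x) < (\<Sum>x\<in>S. 0)"
      using s(2) finS S(2) by (intro sum_strict_mono) (force simp: not_le)+
    moreover have "(\<Sum>x\<in>S. z \<bullet> x) = z \<bullet> (\<Sum>x\<in>S. x)" by (simp add: inner_sum_right)
    ultimately show False using neighbour_closed_sum_zero[OF S(1,3)] by simp
  qed
  have zs: "z \<bullet> s \<le> \<theta>" using separated[OF z(1), of s] z s(1) S(1) by auto
  obtain y p a G where vf': "vertex_figure X \<theta> s q y p a G" using vf s(1) S(1) by blast
  obtain i l m k where i: "i < q" and lm: "0 \<le> l" "0 \<le> m"
    and zl: "z = l *\<^sub>R y i + m *\<^sub>R y (Suc i mod q) + k *\<^sub>R s"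
    by (rule vertex_figure_sector[OF vf'])
  note D = vertex_figureD[OF vf' i]
  have nb: "y i \<in> S" "y (Suc i mod q) \<in> S" using D S(3)[OF s(1)] by auto
  note face = D(10,12,13,14)
  define h where "h = norm (a i)"
  have h: "\<theta> < h" "0 < h" using face(1) by (auto simp: inscribed_polygon_def h_def)
  have hh: "a i \<bullet> a i = h\<^sup>2" by (simp add: h_def power2_norm_eq_inner)
  have "a i \<bullet> z = (l + m + k) * h\<^sup>2"
    unfolding zl inner_add_right inner_scaleR_right
    by (simp add: inscribed_polygon_plane[OF face(1)] face hh algebra_simps)
  moreover have "a i \<bullet> z \<le> h * 1" using norm_cauchy_schwarz[of "a i" z] unit[OF z(1)] by (simp add: h_def)
  ultimately have b: "(l + m + k) * h \<le> 1"
    using h by (simp add: power2_eq_square mult.assoc[symmetric])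
  have "1 = z \<bullet> z" using unit_inner z by simp
  also have "\<dots> = l * (z \<bullet> y i) + m * (z \<bullet> y (Suc i mod q)) + k * (z \<bullet> s)"
    by (subst (2) zl) (simp add: inner_add_right)
  also have "\<dots> \<le> l * (z \<bullet> s) + m * (z \<bullet> s) + k * (z \<bullet> s)"
    using lm s(2) nb by (intro add_right_mono add_mono mult_left_mono) auto
  also have "\<dots> = (l + m + k) * (z \<bullet> s)" by (simp add: algebra_simps)
  finally have 1: "1 \<le> (l + m + k) * (z \<bullet> s)" .
  hence sz: "z \<bullet> s > 0" using pos by (cases "z \<bullet> s = 0") auto
  hence lmk: "l + m + k > 0" using 1 by (smt (verit) mult_nonpos_nonneg)
  hence "(l + m + k) * (z \<bullet> s) < (l + m + k) * h" using zs h by simp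
  thus False using 1 b by linarith
qed

text \<open>A functional whose maximum on \<open>X\<close> is not positive vanishes on \<open>X\<close>, because \<open>X\<close> has sum zero.  In other
words, the origin is an interior point of the hull.\<close>

lemma supporting_functional_positive:
  assumes v: "v \<in> X" and le: "\<And>x. x \<in> X \<Longrightarrow> n \<bullet> x \<le> n \<bullet> v" and "n \<noteq> 0"
  shows "0 < n \<bullet> v"
proof (rule ccontr)
  assume "\<not> ?thesis"
  hence neg: "n \<bullet> x \<le> 0" if "x \<in> X" for x using le[OF that] by linarith
  have "(\<Sum>x\<in>X. - (n \<bullet> x)) = - (n \<bullet> (\<Sum>x\<in>X. x))" by (simp add: inner_sum_right sum_negf)
  hence "(\<Sum>x\<in>X. - (n \<bullet> x)) = 0" by (simp add: sum_zero)
  hence "\<forall>x\<in>X. - (n \<bullet> x) = 0"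
    using neg finite by (subst (asm) sum_nonneg_eq_0_iff) auto
  hence "orthogonal n x" if "x \<in> X" for x using that by (simp add: orthogonal_def)
  hence "orthogonal n n" by (rule orthogonal_to_span[rotated]) (auto simp: spanning)
  thus False using \<open>n \<noteq> 0\<close> by (simp add: orthogonal_def)
qed

lemma hull_full_dim: "aff_dim (convex hull X) = 3"
proof -
  have "0 \<in> convex hull X"
  proof -
    have "(\<Sum>x\<in>X. (1 / card X) *\<^sub>R x) \<in> convex hull X"
      using finite nonempty by (intro convex_sum) (auto simp: hull_inc)
    thus ?thesis by (simp add: scaleR_sum_right[symmetric] sum_zero)
  qed
  hence "0 \<in> affine hull X" using convex_hull_subset_affine_hull by blast
  hence "aff_dim X = int (dim X)" by (rule aff_dim_zero)
  also have "dim X = 3" using dim_span[of X] spanning by simp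
  finally show ?thesis by (simp add: aff_dim_convex_hull)
qed

lemma hull_polyhedron: "convex_polyhedron (convex hull X)"
  by (simp add: convex_polyhedron_def polytope_convex_hull finite hull_full_dim)

lemma inscribed_polygon_face:
  assumes G: "inscribed_polygon \<theta> p a G" "G \<subseteq> X"
  shows "convex hull G = convex hull X \<inter> {x. a \<bullet> x = a \<bullet> a}"
    and "convex hull G face_of convex hull X"
    and "\<And>x. x \<in> convex hull X \<Longrightarrow> a \<bullet> x \<le> a \<bullet> a"
proof -
  have mem: "x \<in> G" if "x \<in> X" "a \<bullet> x \<ge> a \<bullet> a" for x
    by (rule cap_of_inscribed_polygon_empty [OF G(1)])
      (use that unit separated G(2) in auto)
  have leX: "a \<bullet> x \<le> a \<bullet> a" if "x \<in> X" for x
    using mem[OF that] inscribed_polygon_plane[OF G(1)] by force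
  have "convex hull X \<subseteq> {x. a \<bullet> x \<le> a \<bullet> a}"
    by (rule hull_minimal) (use leX in \<open>auto simp: convex_halfspace_le\<close>)
  thus le: "a \<bullet> x \<le> a \<bullet> a" if "x \<in> convex hull X" for x using that by auto
  let ?F = "convex hull X \<inter> {x. a \<bullet> x = a \<bullet> a}"
  have face: "?F face_of convex hull X"
    by (rule face_of_Int_supporting_hyperplane_le) (use le in auto)
  show eq: "convex hull G = ?F"
  proof
    have "convex hull G \<subseteq> {x. a \<bullet> x = a \<bullet> a}"
      by (rule hull_minimal) (use inscribed_polygon_plane[OF G(1)] in \<open>auto simp: convex_hyperplane\<close>)
    thus "convex hull G \<subseteq> ?F" using hull_mono[OF G(2)] by blast
    obtain S' where S': "S' \<subseteq> X" "?F = convex hull S'"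
      using face_of_convex_hull_subset[OF finite_imp_compact[OF finite] face] by blast
    have "S' \<subseteq> ?F" using S'(2) hull_subset by metis
    hence "S' \<subseteq> G" using mem S'(1) by fastforce
    thus "?F \<subseteq> convex hull G" using S'(2) hull_mono by metis
  qed
  show "convex hull G face_of convex hull X" using face eq by simp
qed

lemma not_collinear_on_sphere:
  assumes "x \<in> X" "y \<in> X" "z \<in> X" "x \<noteq> y" "y \<noteq> z" "x \<noteq> z"
  shows "\<not> collinear {x, y, z}"
proof
  assume "collinear {x, y, z}"
  then obtain u where u: "y = u *\<^sub>R x + (1 - u) *\<^sub>R z"
    using assms by (auto simp: collinear_3_expand)
  have "1 = y \<bullet> y" using unit_inner assms by simp
  also have "\<dots> = u\<^sup>2 + (1 - u)\<^sup>2 + 2 * u * (1 - u) * (x \<bullet> z)"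
    unfolding u by (simp add: inner_add_left inner_add_right unit_inner assms inner_commute
        power2_eq_square algebra_simps)
  finally have "u * (1 - u) * (1 - x \<bullet> z) = 0" by (simp add: power2_eq_square algebra_simps)
  moreover have "x \<bullet> z < 1" using separated[of x z] assms theta by fastforce
  ultimately have "u = 0 \<or> u = 1" by auto
  thus False using u assms by auto
qed

lemma aff_dim_polygon:
  assumes vf: "vertex_figure X \<theta> v q y p a G" and v: "v \<in> X" and i: "i < q"
  shows "aff_dim (convex hull (G i)) = 2" "convex hull (G i) facet_of convex hull X"
proof -
  note D = vertex_figureD[OF vf i]
  have nc: "\<not> collinear {v, y i, y (Suc i mod q)}"
    using D neighbour_neq[OF v] by (intro not_collinear_on_sphere v) metis+
  note G = D(10,11)
  have sub: "{v, y i, y (Suc i mod q)} \<subseteq> G i" using D by simp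
  have "2 \<le> aff_dim {v, y i, y (Suc i mod q)}" using nc by (simp add: collinear_aff_dim)
  also have "\<dots> \<le> aff_dim (convex hull (G i))"
    using sub by (metis aff_dim_convex_hull aff_dim_subset)
  finally have 2: "2 \<le> aff_dim (convex hull (G i))" .
  have "a i \<noteq> 0" using G by (simp add: inscribed_polygon_def)
  hence "aff_dim (convex hull (G i)) < 3"
  proof -
    have "aff_dim {x. a i \<bullet> x = a i \<bullet> a i} = 2"
      using \<open>a i \<noteq> 0\<close> by (simp add: aff_dim_hyperplane)
    moreover have "aff_dim (convex hull (G i)) \<le> aff_dim {x. a i \<bullet> x = a i \<bullet> a i}"
      by (rule aff_dim_subset) (use inscribed_polygon_face(1)[OF G] in auto)
    ultimately show ?thesis by simp
  qed
  thus d: "aff_dim (convex hull (G i)) = 2" using 2 by simp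
  show "convex hull (G i) facet_of convex hull X"
    using inscribed_polygon_face(2)[OF G] d hull_full_dim sub
    by (auto simp: facet_of_def)
qed

lemma facet_eq_of_subset:
  assumes "F facet_of P" "F' facet_of P" "F \<subseteq> F'"
  shows "F = F'"
proof (rule ccontr)
  assume "F \<noteq> F'"
  have "F face_of F'"
    using assms by (meson face_of_subset facet_of_imp_face_of facet_of_imp_subset)
  moreover have "convex F'" using assms(2) face_of_imp_convex facet_of_imp_face_of by blast
  ultimately have "aff_dim F < aff_dim F'" using \<open>F \<noteq> F'\<close> face_of_aff_dim_lt by blast
  thus False using assms by (simp add: facet_of_def)
qed

text \<open>A facet through \<open>v\<close> has a relative interior point in some sector of the vertex figure.
  Both the facet and the plane of the face in that sector support the hull, which forces the
  point into that face.\<close>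

lemma facets_at_vertex:
  assumes vf: "vertex_figure X \<theta> v q y p a G" and v: "v \<in> X"
  shows "{F. F facet_of convex hull X \<and> v \<in> F} = (\<lambda>i. convex hull (G i)) ` {..<q}"
proof (intro equalityI subsetI)
  fix F assume "F \<in> (\<lambda>i. convex hull (G i)) ` {..<q}"
  then obtain i where i: "i < q" "F = convex hull (G i)" by auto
  have "v \<in> G i" using vertex_figureD(12)[OF vf i(1)] .
  thus "F \<in> {F. F facet_of convex hull X \<and> v \<in> F}"
    using aff_dim_polygon(2)[OF vf v i(1)] i hull_inc[of v "G i"] by simp
next
  fix F assume "F \<in> {F. F facet_of convex hull X \<and> v \<in> F}"
  hence F: "F facet_of convex hull X" "v \<in> F" by auto
  have Fface: "F face_of convex hull X" using F facet_of_imp_face_of by blast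
  have "F exposed_face_of convex hull X"
    using exposed_face_of_polyhedron[OF polyhedron_convex_hull[OF finite]] Fface by blast
  then obtain n b where n: "convex hull X \<subseteq> {x. n \<bullet> x \<le> b}" "F = convex hull X \<inter> {x. n \<bullet> x = b}"
    by (auto simp: exposed_face_of_def)
  have b: "n \<bullet> v = b" using F n by auto
  have le: "n \<bullet> x \<le> n \<bullet> v" if "x \<in> X" for x using n(1) hull_inc[OF that] b by auto
  have n0: "n \<noteq> 0"
  proof
    assume "n = 0"
    hence "F = convex hull X" using n F b by auto
    thus False using F by simp
  qed
  have pos: "0 < n \<bullet> v" by (rule supporting_functional_positive[OF v le n0])
  have "convex F" using Fface face_of_imp_convex by blast
  hence "rel_interior F \<noteq> {}" using F by (auto simp: rel_interior_eq_empty)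
  then obtain w where w: "w \<in> rel_interior F" by auto
  have wF: "w \<in> F" using w rel_interior_subset by auto
  obtain i l m k where i: "i < q" and lm: "0 \<le> l" "0 \<le> m"
    and wl: "w = l *\<^sub>R y i + m *\<^sub>R y (Suc i mod q) + k *\<^sub>R v"
    by (rule vertex_figure_sector[OF vf])
  note D = vertex_figureD[OF vf i]
  note nb = D(7,8) and G = D(10,11) and mem = D(12,13,14)
  have a0: "a i \<bullet> a i > 0" using G by (simp add: inscribed_polygon_def)
  have aw: "a i \<bullet> w = (l + m + k) * (a i \<bullet> a i)"
    unfolding wl inner_add_right inner_scaleR_right
    by (simp add: inscribed_polygon_plane[OF G(1)] mem algebra_simps)
  moreover have "a i \<bullet> w \<le> a i \<bullet> a i"
    by (rule inscribed_polygon_face(3)[OF G]) (use wF n in auto)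
  ultimately have "l + m + k \<le> 1" using a0 by (simp add: mult_le_cancel_right1)
  moreover have "1 \<le> l + m + k"
  proof -
    have "n \<bullet> v = n \<bullet> w" using wF n b by auto
    also have "\<dots> = l * (n \<bullet> y i) + m * (n \<bullet> y (Suc i mod q)) + k * (n \<bullet> v)"
      unfolding wl by (simp add: inner_add_right)
    also have "\<dots> \<le> l * (n \<bullet> v) + m * (n \<bullet> v) + k * (n \<bullet> v)"
      using lm le nb by (intro add_right_mono add_mono mult_left_mono) auto
    also have "\<dots> = (l + m + k) * (n \<bullet> v)" by (simp add: algebra_simps)
    finally show ?thesis using pos by (simp add: mult_le_cancel_right1)
  qed
  ultimately have "a i \<bullet> w = a i \<bullet> a i" using aw by simp
  hence "w \<in> convex hull (G i)" using wF n inscribed_polygon_face(1)[OF G] by auto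
  hence "F \<subseteq> convex hull (G i)"
    using w by (intro subset_of_face_of[OF inscribed_polygon_face(2)[OF G]])
      (use F facet_of_imp_subset in auto)
  hence "F = convex hull (G i)" using facet_eq_of_subset[OF F(1) aff_dim_polygon(2)[OF vf v i]] by blast
  thus "F \<in> (\<lambda>i. convex hull (G i)) ` {..<q}" using i by auto
qed

text \<open>The plane of a face through \<open>v\<close> meets the sphere and the plane of the neighbours of \<open>v\<close> in at most
two points, so a face contains only two neighbours of \<open>v\<close> and determines its place in the cyclic
order.\<close>

lemma vertex_figure_facets_inj:
  assumes vf: "vertex_figure X \<theta> v q y p a G" and v: "v \<in> X"
  shows "inj_on (\<lambda>i. convex hull (G i)) {..<q}"
proof (rule inj_onI)
  fix i j assume i: "i \<in> {..<q}" and j: "j \<in> {..<q}" and eq: "convex hull (G i) = convex hull (G j)"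
  have G: "inscribed_polygon \<theta> (p i) (a i) (G i)" "G i \<subseteq> X"
    and mi: "v \<in> G i" "y i \<in> G i" "y (Suc i mod q) \<in> G i"
    and mj: "v \<in> G j" "y j \<in> G j" "y (Suc j mod q) \<in> G j"
    using vf i j unfolding vertex_figure_def by auto
  have inj: "inj_on y {..<q}" and im: "y ` {..<q} = nbrs v" using vf unfolding vertex_figure_def by auto
  have nb: "v \<bullet> y t = \<theta>" "y t \<bullet> y t = 1" if "t < q" for t
  proof -
    have "y t \<in> nbrs v" using im that by auto
    thus "v \<bullet> y t = \<theta>" "y t \<bullet> y t = 1" using unit_inner by (auto simp: neighbours_def)
  qed
  have two: "t = i \<or> t = Suc i mod q" if t: "t < q" "y t \<in> convex hull (G i)" for t
  proof -
    have S: "Suc i mod q < q" "i < q" using i by auto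
    have "y i \<noteq> y (Suc i mod q)" using vertex_figureD(9)[OF vf S(2)] .
    moreover have "cross3 v (a i) \<noteq> 0"
    proof
      assume "cross3 v (a i) = 0"
      hence "(v \<bullet> v) * (a i \<bullet> a i) = (v \<bullet> a i)\<^sup>2" using cross3_inner_self[of v "a i"] by simp
      hence "a i \<bullet> a i = (a i \<bullet> a i)\<^sup>2"
        using unit_inner[OF v] inscribed_polygon_plane(1)[OF G(1) mi(1)] by (simp add: inner_commute)
      thus False using G by (auto simp: inscribed_polygon_def power2_eq_square)
    qed
    moreover have "a i \<bullet> y t = a i \<bullet> a i" using t(2) inscribed_polygon_face(1)[OF G] by auto
    ultimately have "y t = y i \<or> y t = y (Suc i mod q)"
      using line_meets_sphere_at_most_twice[of v "a i" "y i" "y (Suc i mod q)" "y t"]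
        nb t S inscribed_polygon_plane(1)[OF G(1)] mi by (simp add: inner_commute)
    thus ?thesis using inj S t by (metis inj_onD lessThan_iff)
  qed
  have "y j \<in> convex hull (G i)" "y (Suc j mod q) \<in> convex hull (G i)"
    unfolding eq using mj hull_inc by metis+
  hence "j = i \<or> j = Suc i mod q" "Suc j mod q = i \<or> Suc j mod q = Suc i mod q"
    using two[of j] two[of "Suc j mod q"] j by auto
  thus "i = j" using i j q_ge_3 by (auto simp: mod_Suc split: if_splits)
qed

lemma card_facets_at_vertex:
  assumes "vertex_figure X \<theta> v q y p a G" "v \<in> X"
  shows "card {F. F facet_of convex hull X \<and> v \<in> F} = q"
  using facets_at_vertex[OF assms] vertex_figure_facets_inj[OF assms] by (simp add: card_image)

lemma facet_contains_vertex:
  assumes "F facet_of convex hull X"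
  obtains v where "v \<in> X" "v \<in> F"
proof -
  have "F face_of convex hull X" using assms facet_of_imp_face_of by blast
  then obtain S' where S': "S' \<subseteq> X" "F = convex hull S'"
    using face_of_convex_hull_subset[OF finite_imp_compact[OF finite]] by metis
  moreover have "S' \<noteq> {}" using assms S' by (auto simp: facet_of_def)
  ultimately show ?thesis using that hull_inc[of _ S' convex] by blast
qed

text \<open>Two different facets intersect in a proper face of both, and these two have \<open>v\<close> and a neighbour of
\<open>v\<close> in common.\<close>

lemma adjacent_facets_share_edge:
  assumes vf: "vertex_figure X \<theta> v q y p a G" and v: "v \<in> X" and i: "i < q"
  shows "(convex hull (G i) \<inter> convex hull (G (Suc i mod q))) edge_of convex hull X"
proof -
  define j where "j = Suc i mod q"
  have j: "j < q" "j \<noteq> i" using i q_ge_3 by (auto simp: j_def mod_Suc)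
  let ?F = "convex hull (G i)" and ?F' = "convex hull (G j)"
  have fi: "?F facet_of convex hull X" and fj: "?F' facet_of convex hull X"
    using aff_dim_polygon(2)[OF vf v] i j by auto
  have ne: "?F \<noteq> ?F'" using vertex_figure_facets_inj[OF vf v] i j by (auto dest: inj_onD)
  have face: "(?F \<inter> ?F') face_of convex hull X"
    using fi fj by (intro face_of_Int) (auto simp: facet_of_imp_face_of)
  have "?F \<inter> ?F' \<noteq> ?F" using facet_eq_of_subset[OF fi fj] ne by blast
  moreover have "(?F \<inter> ?F') face_of ?F"
    using face fi by (meson face_of_subset facet_of_imp_subset inf_le1)
  ultimately have "aff_dim (?F \<inter> ?F') < 2"
    using face_of_aff_dim_lt[of ?F "?F \<inter> ?F'"] aff_dim_polygon(1)[OF vf v i] by simp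
  moreover have "1 \<le> aff_dim (?F \<inter> ?F')"
  proof -
    have "{v, y j} \<subseteq> G i" "{v, y j} \<subseteq> G j" using vf i j unfolding vertex_figure_def j_def by auto
    hence "{v, y j} \<subseteq> ?F \<inter> ?F'" using hull_subset[of "G i" convex] hull_subset[of "G j" convex] by blast
    moreover have "v \<noteq> y j"
      using vertex_figureD(5)[OF vf j(1)] neighbour_neq[OF v] by metis
    ultimately show ?thesis using aff_dim_2[of v "y j"] aff_dim_subset by metis
  qed
  ultimately show ?thesis using face by (simp add: edge_of_def j_def)
qed

theorem regular_polyhedron_from_vertex_figures:
  assumes vf: "\<And>v. v \<in> X \<Longrightarrow> \<exists>y a G. vertex_figure X \<theta> v q y (\<lambda>_. p) a G"
  shows "regular_polyhedron p q (convex hull X)"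
  unfolding regular_polyhedron_def
proof (intro conjI exI allI impI ballI)
  show "convex_polyhedron (convex hull X)" by (rule hull_polyhedron)
next
  fix F assume F: "F facet_of convex hull X"
  then obtain v where v: "v \<in> X" "v \<in> F" by (rule facet_contains_vertex)
  obtain y a G where vf': "vertex_figure X \<theta> v q y (\<lambda>_. p) a G" using vf v by blast
  then obtain i where "i < q" "F = convex hull (G i)" using facets_at_vertex[OF vf' v(1)] F v by auto
  thus "regular_polygon p (circumradius \<theta> p) F"
    using inscribed_polygon_regular[OF vertex_figureD(10)[OF vf']] by blast
next
  fix v assume "v \<in> vertices (convex hull X)"
  hence "v \<in> X" by (simp add: vertices_hull)
  thus "card {F. F facet_of convex hull X \<and> v \<in> F} = q"
    using vf card_facets_at_vertex by blast
qed

theorem quasi_regular_polyhedron_from_vertex_figures: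
  assumes vf: "\<And>v. v \<in> X \<Longrightarrow> \<exists>y a G. vertex_figure X \<theta> v (length ns) y (\<lambda>i. ns ! i) a G"
    and q: "q = length ns"
    and trans: "\<And>v w. v \<in> X \<Longrightarrow> w \<in> X \<Longrightarrow>
        \<exists>g. orthogonal_transformation g \<and> g ` X = X \<and> g v = w"
  shows "quasi_regular_polyhedron ns (convex hull X)"
  unfolding quasi_regular_polyhedron_def uniform_polyhedron_def vertices_hull
proof (intro conjI allI impI ballI)
  show "convex_polyhedron (convex hull X)" by (rule hull_polyhedron)
next
  fix F assume F: "F facet_of convex hull X"
  then obtain v where v: "v \<in> X" "v \<in> F" by (rule facet_contains_vertex)
  obtain y a G where vf': "vertex_figure X \<theta> v q y (\<lambda>i. ns ! i) a G" using vf v q by blast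
  then obtain i where "i < q" "F = convex hull (G i)" using facets_at_vertex[OF vf' v(1)] F v by auto
  thus "\<exists>n r. regular_polygon n r F"
    using inscribed_polygon_regular[OF vertex_figureD(10)[OF vf']] by blast
next
  fix v w assume "v \<in> X" "w \<in> X"
  then obtain g where g: "orthogonal_transformation g" "g ` X = X" "g v = w" using trans by blast
  have "g ` (convex hull X) = convex hull X"
    using g convex_hull_linear_image[of g X] by (simp add: orthogonal_transformation_linear)
  moreover have "dist (g x) (g y) = dist x y" for x y
    using g(1) by (simp add: orthogonal_transformation_isometry)
  ultimately show "\<exists>g. (\<forall>x y. dist (g x) (g y) = dist x y) \<and>
      g ` (convex hull X) = convex hull X \<and> g v = w" using g by blast
next
  fix v assume v: "v \<in> X"
  obtain y a G where vf': "vertex_figure X \<theta> v q y (\<lambda>i. ns ! i) a G" using vf v q by blast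
  let ?Fs = "map (\<lambda>i. convex hull (G i)) [0..<q]"
  show "vertex_type (convex hull X) v ns"
    unfolding vertex_type_def
  proof (intro exI[of _ ?Fs] conjI allI impI)
    show "length ?Fs = length ns" using q by simp
    show "distinct ?Fs"
      using vertex_figure_facets_inj[OF vf' v] by (simp add: distinct_map lessThan_atLeast0)
    show "set ?Fs = {F. F facet_of convex hull X \<and> v \<in> F}"
      using facets_at_vertex[OF vf' v] by (simp add: lessThan_atLeast0)
    fix i assume i: "i < length ns"
    hence S: "Suc i mod length ns < length ns" by (intro mod_less_divisor) auto
    show "\<exists>r. regular_polygon (ns ! i) r (?Fs ! i)"
      using i q inscribed_polygon_regular[OF vertex_figureD(10)[OF vf']] by auto
    show "(?Fs ! i \<inter> ?Fs ! (Suc i mod length ns)) edge_of convex hull X"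
      using adjacent_facets_share_edge[OF vf' v, of i] i S q by simp
  qed
qed

end

section \<open>Neighbours of a point\<close>

text \<open>If \<open>a\<close> and \<open>b\<close> are the cosine and sine of an angle, this is the neighbour \<open>y\<close> of \<open>x\<close> turned around \<open>x\<close> by
that angle.\<close>

definition polar :: "real \<Rightarrow> real^3 \<Rightarrow> real^3 \<Rightarrow> real \<Rightarrow> real \<Rightarrow> real^3" where
  "polar \<theta> x y a b = \<theta> *\<^sub>R x + a *\<^sub>R (y - \<theta> *\<^sub>R x) + b *\<^sub>R cross3 x y"

lemma polar_inner:
  assumes "x \<bullet> x = 1" "y \<bullet> y = 1" "x \<bullet> y = \<theta>"
  shows "polar \<theta> x y a b \<bullet> polar \<theta> x y a' b' = \<theta>\<^sup>2 + (1 - \<theta>\<^sup>2) * (a * a' + b * b')"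
    and "x \<bullet> polar \<theta> x y a b = \<theta>"
    and "y \<bullet> polar \<theta> x y a b = \<theta>\<^sup>2 + (1 - \<theta>\<^sup>2) * a"
proof -
  have yx: "y \<bullet> x = \<theta>" using assms by (simp add: inner_commute)
  have n: "cross3 x y \<bullet> cross3 x y = 1 - \<theta>\<^sup>2" by (simp add: cross3_inner_self assms)
  note s = polar_def inner_add_left inner_add_right inner_diff_left inner_diff_right
    dot_cross_self3 assms yx n
  show "polar \<theta> x y a b \<bullet> polar \<theta> x y a' b' = \<theta>\<^sup>2 + (1 - \<theta>\<^sup>2) * (a * a' + b * b')"
    by (simp add: s power2_eq_square algebra_simps)
  show "x \<bullet> polar \<theta> x y a b = \<theta>" by (simp add: s)
  show "y \<bullet> polar \<theta> x y a b = \<theta>\<^sup>2 + (1 - \<theta>\<^sup>2) * a" by (simp add: s power2_eq_square algebra_simps)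
qed

text \<open>Both ends of an edge are used as centres here.  Exchanging them reverses the normal \<open>cross3 x y\<close>,
so points on the same side of the edge have \<open>b\<close> and \<open>b'\<close> of opposite sign.\<close>

lemma polar_inner_swap:
  assumes "x \<bullet> x = 1" "y \<bullet> y = 1" "x \<bullet> y = \<theta>"
  shows "polar \<theta> x y a b \<bullet> polar \<theta> y x a' b'
    = \<theta> + (1 - \<theta>\<^sup>2) * (- (b * b') - \<theta> * (1 - a) * (1 - a'))"
proof -
  have yx: "y \<bullet> x = \<theta>" using assms by (simp add: inner_commute)
  have n: "cross3 x y \<bullet> cross3 x y = 1 - \<theta>\<^sup>2" by (simp add: cross3_inner_self assms)
  have n': "cross3 y x = - cross3 x y" by (rule cross_skew)
  show ?thesis
    by (simp add: polar_def n' inner_add_left inner_add_right inner_diff_left inner_diff_right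
      dot_cross_self3 assms yx n power2_eq_square algebra_simps)
qed

text \<open>Removing the largest point frees a length of at least \<open>\<delta>\<close>.\<close>

lemma spaced_points_spread:
  fixes T :: "real set"
  assumes "finite T" "card T = Suc n" "\<And>s t. s \<in> T \<Longrightarrow> t \<in> T \<Longrightarrow> s \<noteq> t \<Longrightarrow> \<delta> \<le> \<bar>s - t\<bar>"
  shows "real n * \<delta> \<le> Max T - Min T"
  using assms
proof (induction n arbitrary: T)
  case 0
  then obtain t where "T = {t}" by (auto simp: card_Suc_eq)
  thus ?case by simp
next
  case (Suc n)
  let ?M = "Max T" and ?T = "T - {Max T}"
  have M: "?M \<in> T" using Suc.prems by (intro Max_in) auto
  have c: "card ?T = Suc n" using Suc.prems M by simp
  hence ne: "?T \<noteq> {}" by force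
  have IH: "real n * \<delta> \<le> Max ?T - Min ?T" by (rule Suc.IH) (use Suc.prems c in auto)
  have m: "Max ?T \<in> ?T" using ne Suc.prems(1) by (intro Max_in) auto
  have "\<delta> \<le> \<bar>?M - Max ?T\<bar>" using m M Suc.prems(3)[of ?M "Max ?T"] by auto
  moreover have "Max ?T \<le> ?M" using m Suc.prems(1) by simp
  moreover have "Min T \<le> Min ?T" using ne Suc.prems(1) by (intro Min_antimono) auto
  ultimately show ?case using IH by (simp add: algebra_simps)
qed

text \<open>The orbits have two elements.\<close>

lemma even_card_involution:
  assumes "finite A" "\<And>x. x \<in> A \<Longrightarrow> f x \<in> A" "\<And>x. x \<in> A \<Longrightarrow> f (f x) = x" "\<And>x. x \<in> A \<Longrightarrow> f x \<noteq> x"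
  shows "even (card A)"
  using assms
proof (induction "card A" arbitrary: A rule: less_induct)
  case less
  show ?case
  proof (cases "A = {}")
    case False
    then obtain x where x: "x \<in> A" by auto
    have fx: "f x \<in> A" "f x \<noteq> x" "f (f x) = x" using less.prems x by auto
    let ?B = "A - {x, f x}"
    have c: "card A = card ?B + 2"
    proof -
      have "A = insert x (insert (f x) ?B)" using x fx by auto
      moreover have "card (insert x (insert (f x) ?B)) = card ?B + 2"
        using less.prems(1) fx by (simp add: card_insert_if)
      ultimately show ?thesis by simp
    qed
    have "even (card ?B)"
    proof (rule less.hyps)
      show "card ?B < card A" using c by simp
      show "f y \<in> ?B" if "y \<in> ?B" for y
      proof -
        have "f y \<noteq> x" using less.prems(3)[of y] that by auto
        moreover have "f y \<noteq> f x" using less.prems(3)[of y] less.prems(3)[of x] x that by auto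
        ultimately show ?thesis using less.prems(2) that by auto
      qed
    qed (use less.prems in auto)
    thus ?thesis using c by simp
  qed simp
qed

context separated_points
begin

lemma theta_square: "\<theta>\<^sup>2 < 1"
  using theta by (simp add: abs_square_less_1 abs_less_iff)

lemma neighbour_polar:
  assumes x: "x \<in> X" and y: "y \<in> nbrs x" and z: "z \<in> nbrs x"
  obtains a b where "z = polar \<theta> x y a b" "a\<^sup>2 + b\<^sup>2 = 1" "y \<bullet> z = \<theta>\<^sup>2 + (1 - \<theta>\<^sup>2) * a"
proof -
  have "norm x = 1" "norm y = 1" "norm z = 1" "x \<bullet> y = \<theta>" "x \<bullet> z = \<theta>"
    using x y z unit by (auto simp: neighbours_def)
  moreover have "\<bar>\<theta>\<bar> < 1" using theta by simp
  ultimately obtain a b where "z = \<theta> *\<^sub>R x + a *\<^sub>R (y - \<theta> *\<^sub>R x) + b *\<^sub>R cross3 x y" "a\<^sup>2 + b\<^sup>2 = 1"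
    "a * (1 - \<theta>\<^sup>2) = y \<bullet> z - \<theta>\<^sup>2"
    by (rule circle_coordinates)
  thus ?thesis using that[of a b] by (simp add: polar_def mult.commute)
qed

lemma neighbour_inner:
  assumes "x \<in> X" "y \<in> nbrs x"
  shows "x \<bullet> x = 1" "y \<bullet> y = 1" "x \<bullet> y = \<theta>" "y \<bullet> x = \<theta>" "y \<in> X"
  using assms unit_inner by (auto simp: neighbours_def inner_commute)

text \<open>The elements of \<open>T\<close> are the angles at \<open>x\<close> from \<open>y\<close> to the other neighbours of \<open>x\<close>.  The angle \<open>\<alpha>\<close> is that of an
equilateral spherical triangle with sides \<open>arccos \<theta>\<close>; it exceeds that of a plane equilateral
triangle.  Two neighbours at a smaller angle would be too close to each other.\<close>

lemma neighbour_angles: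
  assumes x: "x \<in> X" and y: "y \<in> nbrs x" and two: "2 \<le> card (nbrs x)"
  obtains T \<alpha> where "finite T" "card T = card (nbrs x) - 1" "cos \<alpha> = \<theta> / (1 + \<theta>)"
    "pi / 3 < \<alpha>" "\<alpha> \<le> pi"
    "\<And>t. t \<in> T \<Longrightarrow> \<alpha> \<le> t \<and> t \<le> 2 * pi - \<alpha> \<and> polar \<theta> x y (cos t) (sin t) \<in> nbrs x"
    "\<And>s t. s \<in> T \<Longrightarrow> t \<in> T \<Longrightarrow> s \<noteq> t \<Longrightarrow> \<alpha> \<le> \<bar>s - t\<bar>"
proof -
  note xy = neighbour_inner[OF x y]
  let ?P = "\<lambda>t. polar \<theta> x y (cos t) (sin t)"
  let ?N = "nbrs x - {y}"
  define T where "T = {t. 0 \<le> t \<and> t < 2 * pi \<and> ?P t \<in> ?N}"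
  have P0: "?P 0 = y" by (simp add: polar_def)
  have PP: "?P s \<bullet> ?P t = \<theta>\<^sup>2 + (1 - \<theta>\<^sup>2) * cos (s - t)" for s t
    by (simp add: polar_inner(1)[OF xy(1-3)] cos_diff)
  have inj: "s = t" if "0 \<le> s" "s < 2 * pi" "0 \<le> t" "t < 2 * pi" "?P s = ?P t" for s t
  proof -
    have "?P s \<bullet> ?P s = ?P s \<bullet> ?P t" using that by simp
    hence "(1 - \<theta>\<^sup>2) * (1 - cos (s - t)) = 0" unfolding PP by (simp add: algebra_simps)
    hence "cos (s - t) = 1" using theta_square by simp
    then obtain n :: int where n: "s - t = of_int n * 2 * pi" by (auto simp: cos_one_2pi_int)
    have "of_int n * (2 * pi) < 1 * (2 * pi)" "(- 1) * (2 * pi) < of_int n * (2 * pi)" using n that by linarith+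
    hence "of_int n < (1::real)" "(- 1::real) < of_int n"
      by (simp_all only: mult_less_cancel_right_pos[of "2 * pi"] pi_gt_zero mult_pos_pos zero_less_numeral)
    hence "n = 0" by linarith
    thus ?thesis using n by simp
  qed
  have im: "?P ` T = ?N"
  proof
    show "?N \<subseteq> ?P ` T"
    proof
      fix z assume z: "z \<in> ?N"
      obtain a b where ab: "z = polar \<theta> x y a b" "a\<^sup>2 + b\<^sup>2 = 1"
        using neighbour_polar[OF x y, of z] z by blast
      obtain t where "0 \<le> t" "t < 2 * pi" "a = cos t" "b = sin t"
        using sincos_total_2pi[OF ab(2)] by metis
      thus "z \<in> ?P ` T" using ab z by (auto simp: T_def)
    qed
  qed (auto simp: T_def)
  have injT: "inj_on ?P T" by (rule inj_onI) (use inj in \<open>auto simp: T_def\<close>)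
  have finN: "finite (nbrs x)" using finite neighbours_subset by (rule finite_subset[rotated])
  have finT: "finite T" using finite_imageD[OF _ injT] im finN by simp
  have cardT: "card T = card (nbrs x) - 1"
    using card_image[OF injT] im y finN by simp
  have cosle: "cos (s - t) \<le> \<theta> / (1 + \<theta>)"
    if "?P s \<in> nbrs x" "?P t \<in> nbrs x" "?P s \<noteq> ?P t" for s t
  proof -
    have "?P s \<bullet> ?P t \<le> \<theta>" using that neighbours_subset by (intro separated) auto
    hence "(1 - \<theta>) * ((1 + \<theta>) * cos (s - t)) \<le> (1 - \<theta>) * \<theta>"
      unfolding PP by (simp add: power2_eq_square algebra_simps)
    hence "(1 + \<theta>) * cos (s - t) \<le> \<theta>" using theta by (simp only: mult_le_cancel_left_pos)
    thus ?thesis using theta by (simp add: pos_le_divide_eq mult.commute)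
  qed
  have half: "\<theta> / (1 + \<theta>) < 1 / 2" using theta by (simp add: field_simps)
  have low: "- 1 \<le> \<theta> / (1 + \<theta>)"
  proof -
    have "card T \<noteq> 0" using cardT two by simp
    then obtain t where t: "t \<in> T" by force
    have "cos (t - 0) \<le> \<theta> / (1 + \<theta>)" using t y P0 by (intro cosle) (auto simp: T_def)
    thus ?thesis using cos_ge_minus_one[of "t - 0"] by linarith
  qed
  have up: "\<theta> / (1 + \<theta>) \<le> 1" using order.strict_trans[OF half, of 1] by simp
  define \<alpha> where "\<alpha> = arccos (\<theta> / (1 + \<theta>))"
  have cos\<alpha>: "cos \<alpha> = \<theta> / (1 + \<theta>)" unfolding \<alpha>_def using low up by (rule cos_arccos)
  have \<alpha>: "0 \<le> \<alpha>" "\<alpha> \<le> pi" unfolding \<alpha>_def using low up by (auto intro: arccos_lbound arccos_ubound)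
  have \<alpha>3: "pi / 3 < \<alpha>"
  proof (rule ccontr)
    assume "\<not> pi / 3 < \<alpha>"
    hence "cos (pi / 3) \<le> cos \<alpha>" using \<alpha> by (intro cos_monotone_0_pi_le) auto
    thus False using cos\<alpha> half by (simp add: cos_60)
  qed
  have gap: "\<alpha> \<le> \<bar>t\<bar> \<and> \<bar>t\<bar> \<le> 2 * pi - \<alpha>" if "\<bar>t\<bar> < 2 * pi" "cos t \<le> \<theta> / (1 + \<theta>)" for t
  proof (rule ccontr)
    assume "\<not> ?thesis"
    then consider "\<bar>t\<bar> < \<alpha>" | "2 * pi - \<bar>t\<bar> < \<alpha>" by linarith
    thus False
    proof cases
      case 1
      hence "cos \<alpha> < cos \<bar>t\<bar>" using \<alpha> by (intro cos_monotone_0_pi) auto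
      thus False using that cos\<alpha> by simp
    next
      case 2
      hence "cos \<alpha> < cos (2 * pi - \<bar>t\<bar>)" using \<alpha> that by (intro cos_monotone_0_pi) auto
      thus False using that cos\<alpha> by simp
    qed
  qed
  show ?thesis
  proof (rule that[of T \<alpha>, OF finT cardT cos\<alpha> \<alpha>3 \<alpha>(2)])
    fix t assume t: "t \<in> T"
    have "cos (t - 0) \<le> \<theta> / (1 + \<theta>)" using t y P0 by (intro cosle) (auto simp: T_def)
    thus "\<alpha> \<le> t \<and> t \<le> 2 * pi - \<alpha> \<and> ?P t \<in> nbrs x"
      using gap[of t] t by (auto simp: T_def)
  next
    fix s t assume st: "s \<in> T" "t \<in> T" "s \<noteq> t"
    hence "?P s \<noteq> ?P t" using injT by (auto dest: inj_onD)
    hence "cos (s - t) \<le> \<theta> / (1 + \<theta>)" using st by (intro cosle) (auto simp: T_def)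
    thus "\<alpha> \<le> \<bar>s - t\<bar>" using gap[of "s - t"] st by (auto simp: T_def)
  qed
qed

lemma neighbour_angle_bound:
  assumes x: "x \<in> X" and two: "2 \<le> card (nbrs x)"
  obtains \<alpha> where "cos \<alpha> = \<theta> / (1 + \<theta>)" "pi / 3 < \<alpha>" "real (card (nbrs x)) * \<alpha> \<le> 2 * pi"
proof -
  obtain y where y: "y \<in> nbrs x" using two by (cases "nbrs x = {}") auto
  obtain T \<alpha> where T: "finite T" "card T = card (nbrs x) - 1" "cos \<alpha> = \<theta> / (1 + \<theta>)"
    "pi / 3 < \<alpha>" "\<And>t. t \<in> T \<Longrightarrow> \<alpha> \<le> t \<and> t \<le> 2 * pi - \<alpha> \<and> polar \<theta> x y (cos t) (sin t) \<in> nbrs x"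
    "\<And>s t. s \<in> T \<Longrightarrow> t \<in> T \<Longrightarrow> s \<noteq> t \<Longrightarrow> \<alpha> \<le> \<bar>s - t\<bar>"
    using neighbour_angles[OF x y two] by metis
  define n where "n = card (nbrs x) - 2"
  have n: "card T = Suc n" "card (nbrs x) = n + 2" using T(2) two by (auto simp: n_def)
  have ne: "T \<noteq> {}" using n by auto
  have "real n * \<alpha> \<le> Max T - Min T" by (rule spaced_points_spread[OF T(1) n(1) T(6)])
  moreover have "Max T \<le> 2 * pi - \<alpha>" "\<alpha> \<le> Min T" using T(5)[OF Max_in[OF T(1) ne]] T(5)[OF Min_in[OF T(1) ne]] by auto
  ultimately have "real (card (nbrs x)) * \<alpha> \<le> 2 * pi" using n by (simp add: algebra_simps)
  thus ?thesis by (rule that[OF T(3,4)])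
qed

lemma card_neighbours_le_5:
  assumes "x \<in> X"
  shows "card (nbrs x) \<le> 5"
proof (rule ccontr)
  assume n: "\<not> ?thesis"
  hence two: "2 \<le> card (nbrs x)" by simp
  obtain \<alpha> where a: "pi / 3 < \<alpha>" "real (card (nbrs x)) * \<alpha> \<le> 2 * pi"
    by (rule neighbour_angle_bound[OF assms two])
  have "6 * \<alpha> \<le> real (card (nbrs x)) * \<alpha>" using n pi_gt_zero a(1) by (intro mult_right_mono) (simp, linarith)
  thus False using a by linarith
qed

text \<open>On each side of the edge from \<open>x\<close> to \<open>y\<close> there is a further edge at \<open>x\<close>; the condition on \<open>a\<close> and \<open>a'\<close>
says that the angles which these make with the given edge add up to at most a straight angle.\<close>

definition two_sided :: "real^3 \<Rightarrow> real^3 \<Rightarrow> bool" where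
  "two_sided x y \<longleftrightarrow> (\<exists>a b a' b'. polar \<theta> x y a b \<in> nbrs x \<and> polar \<theta> x y a' b' \<in> nbrs x \<and>
     a\<^sup>2 + b\<^sup>2 = 1 \<and> a'\<^sup>2 + b'\<^sup>2 = 1 \<and> b > 0 \<and> b' < 0 \<and> a + a' \<ge> 0)"

text \<open>The four other neighbours leave three gaps of more than 60 degrees between them.  So the first and
the last of them, the two neighbours next to \<open>y\<close>, are more than 180 degrees apart on the side away
from \<open>y\<close>.\<close>

lemma two_sided_if_five:
  assumes x: "x \<in> X" and y: "y \<in> nbrs x" and five: "card (nbrs x) = 5"
  shows "two_sided x y"
proof -
  have two: "2 \<le> card (nbrs x)" using five by simp
  obtain T \<alpha> where T1: "finite T" "card T = 5 - 1" "cos \<alpha> = \<theta> / (1 + \<theta>)" and T2: "pi / 3 < \<alpha>" "\<alpha> \<le> pi"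
    "\<And>t. t \<in> T \<Longrightarrow> \<alpha> \<le> t \<and> t \<le> 2 * pi - \<alpha> \<and> polar \<theta> x y (cos t) (sin t) \<in> nbrs x"
    "\<And>s t. s \<in> T \<Longrightarrow> t \<in> T \<Longrightarrow> s \<noteq> t \<Longrightarrow> \<alpha> \<le> \<bar>s - t\<bar>"
    by (rule neighbour_angles[OF x y two, unfolded five]) blast
  note T = T1(1,2) T2
  have ne: "T \<noteq> {}" using T by auto
  define A where "A = Min T"
  define B where "B = Max T"
  have AB: "A \<in> T" "B \<in> T" using Max_in[OF T(1) ne] Min_in[OF T(1) ne] by (simp_all add: A_def B_def)
  have "real 3 * \<alpha> \<le> Max T - Min T" by (rule spaced_points_spread[OF T(1)]) (use T in auto)
  hence sp: "3 * \<alpha> \<le> B - A" by (simp add: A_def B_def)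
  have A: "\<alpha> \<le> A" and B: "B \<le> 2 * pi - \<alpha>" using T(5) AB by auto
  have pi0: "pi > 0" by simp
  have "sin A > 0" by (rule sin_gt_zero) (use A B sp T(3) pi0 in linarith)+
  moreover have "sin B < 0" by (rule sin_lt_zero) (use A B sp T(3) pi0 in linarith)+
  moreover have "cos A + cos B \<ge> 0"
  proof -
    have neg: "cos t < 0" if "pi / 2 < t" "t < 3 * pi / 2" for t
    proof -
      have "0 < cos (t - pi)" by (rule cos_gt_zero_pi) (use that in linarith)+
      thus ?thesis by (simp add: cos_diff)
    qed
    have "pi < A + B" "A + B < 3 * pi" "pi < B - A" "B - A < 3 * pi"
      using A B sp T(3) pi0 by linarith+
    hence "cos ((A + B) / 2) < 0" "cos ((B - A) / 2) < 0" by (auto intro!: neg)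
    hence "cos ((A + B) / 2) * cos ((B - A) / 2) > 0" by (rule mult_neg_neg)
    moreover have "cos A + cos B = 2 * cos ((A + B) / 2) * cos ((A - B) / 2)" by (rule cos_plus_cos)
    moreover have "cos ((A - B) / 2) = cos ((B - A) / 2)" by (metis cos_minus minus_diff_eq minus_divide_left)
    ultimately show ?thesis by (simp add: mult.commute)
  qed
  ultimately show ?thesis
    unfolding two_sided_def using T(5)[OF AB(1)] T(5)[OF AB(2)]
    by (intro exI[of _ "cos A"] exI[of _ "sin A"] exI[of _ "cos B"] exI[of _ "sin B"]) simp
qed

text \<open>The key local estimate: a quadrilateral with three sides \<open>arccos \<theta>\<close> whose two angles at the middle
one of them add up to at most a straight angle has a shorter fourth side.  On one of the two
sides of the edge the angles do so.  As no distance in \<open>X\<close> is shorter, the quadrilateral is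
degenerate and the edge lies in a triangle.\<close>

lemma common_neighbour_if_two_sided:
  assumes x: "x \<in> X" and y: "y \<in> nbrs x" and xy: "two_sided x y" and yx: "two_sided y x"
  obtains z where "z \<in> nbrs x" "z \<in> nbrs y"
proof -
  have *: "polar \<theta> x y a b = polar \<theta> y x c d"
    if "polar \<theta> x y a b \<in> nbrs x" "polar \<theta> y x c d \<in> nbrs y"
      "a\<^sup>2 + b\<^sup>2 = 1" "c\<^sup>2 + d\<^sup>2 = 1" "b * d < 0" "0 \<le> a + c" for a b c d
  proof (rule ccontr)
    assume ne: "polar \<theta> x y a b \<noteq> polar \<theta> y x c d"
    have "polar \<theta> x y a b \<bullet> polar \<theta> y x c d \<le> \<theta>"
      using that(1,2) neighbours_subset ne by (intro separated) auto
    hence "(1 - \<theta>\<^sup>2) * (- (b * d) - \<theta> * (1 - a) * (1 - c)) \<le> (1 - \<theta>\<^sup>2) * 0"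
      using polar_inner_swap[OF neighbour_inner(1-3)[OF x y], of a b c d] by simp
    hence le: "- (b * d) \<le> \<theta> * ((1 - a) * (1 - c))"
      using theta_square by (subst (asm) mult_le_cancel_left_pos) (simp_all add: mult.assoc)
    have b0: "b \<noteq> 0" "d \<noteq> 0" using that(5) by auto
    have a1: "a\<^sup>2 < 1" "c\<^sup>2 < 1" using that(3,4) b0 by (smt (verit) zero_less_power2)+
    have lt: "a < 1" "- 1 < a" "c < 1" "- 1 < c" using a1 by (auto simp: abs_square_less_1 abs_less_iff)
    have pos: "0 < (1 - a) * (1 - c)" using lt by simp
    have "((1 - a) * (1 - c))\<^sup>2 \<le> (b * d)\<^sup>2"
    proof -
      have "b\<^sup>2 = 1 - a\<^sup>2" "d\<^sup>2 = 1 - c\<^sup>2" using that(3,4) by simp_all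
      hence "(b * d)\<^sup>2 = (1 - a\<^sup>2) * (1 - c\<^sup>2)" by (simp add: power_mult_distrib)
      moreover have "(1 - a\<^sup>2) * (1 - c\<^sup>2) - ((1 - a) * (1 - c))\<^sup>2 = (1 - a) * (1 - c) * (2 * (a + c))"
        by (simp add: power2_eq_square algebra_simps)
      moreover have "\<dots> \<ge> 0" using pos that(6) by simp
      ultimately show ?thesis by linarith
    qed
    hence "(1 - a) * (1 - c) \<le> \<bar>b * d\<bar>" using pos by (metis abs_le_square_iff abs_of_pos)
    hence "(1 - a) * (1 - c) \<le> \<theta> * ((1 - a) * (1 - c))" using le that(5) by linarith
    moreover have "\<theta> * ((1 - a) * (1 - c)) < 1 * ((1 - a) * (1 - c))"
      using pos theta by (intro mult_strict_right_mono) auto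
    ultimately show False by linarith
  qed
  obtain a b a' b' where p: "polar \<theta> x y a b \<in> nbrs x" "polar \<theta> x y a' b' \<in> nbrs x"
     "a\<^sup>2 + b\<^sup>2 = 1" "a'\<^sup>2 + b'\<^sup>2 = 1" "b > 0" "b' < 0" "a + a' \<ge> 0"
    using xy unfolding two_sided_def by blast
  obtain c d c' d' where r: "polar \<theta> y x c d \<in> nbrs y" "polar \<theta> y x c' d' \<in> nbrs y"
     "c\<^sup>2 + d\<^sup>2 = 1" "c'\<^sup>2 + d'\<^sup>2 = 1" "d > 0" "d' < 0" "c + c' \<ge> 0"
    using yx unfolding two_sided_def by blast
  have s: "b * d' < 0" "b' * d < 0" using p r by (simp_all add: mult_pos_neg mult_neg_pos)
  show ?thesis
  proof (cases "0 \<le> a + c'")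
    case True
    hence "polar \<theta> x y a b = polar \<theta> y x c' d'" using * p r s by blast
    thus ?thesis using that p(1) r(2) by metis
  next
    case False
    hence "0 \<le> a' + c" using p r by linarith
    hence "polar \<theta> x y a' b' = polar \<theta> y x c d" using * p r s by blast
    thus ?thesis using that p(2) r(1) by metis
  qed
qed

lemma cross3_neighbour_nonzero:
  assumes "x \<in> X" "y \<in> nbrs x"
  shows "cross3 x y \<noteq> 0"
proof
  assume "cross3 x y = 0"
  hence "1 - \<theta>\<^sup>2 = 0" using cross3_inner_self[of x y] neighbour_inner[OF assms] by simp
  thus False using theta_square by simp
qed

lemma at_most_two_with_inner_products:
  assumes x: "x \<in> X" and y: "y \<in> nbrs x"
    and z: "norm z = 1" "norm z1 = 1" "norm z2 = 1" "z1 \<noteq> z2"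
    and "z \<bullet> x = \<theta>" "z1 \<bullet> x = \<theta>" "z2 \<bullet> x = \<theta>" "z \<bullet> y = c" "z1 \<bullet> y = c" "z2 \<bullet> y = c"
  shows "z = z1 \<or> z = z2"
  using line_meets_sphere_at_most_twice[OF cross3_neighbour_nonzero[OF x y] z(4), of z] assms
  by (simp add: norm_eq_1)

end

section \<open>Faces as closed walks\<close>

lemma cos_inscribed_polygon_sizes:
  "cos (2 * pi / real 3) = - 1 / 2" "cos (2 * pi / real 4) = 0" "cos (2 * pi / real 5) = (golden - 1) / 2"
proof -
  have "cos (2 * (pi / 3)) = - 1 / 2" unfolding cos_double_cos cos_60 by (simp add: power2_eq_square)
  moreover have "2 * (pi / 3) = 2 * pi / real 3" by simp
  ultimately show "cos (2 * pi / real 3) = - 1 / 2" by metis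
  have "cos (pi / 2) = 0" by simp
  thus "cos (2 * pi / real 4) = 0" by simp
  show "cos (2 * pi / real 5) = (golden - 1) / 2" using cos_72 by simp
qed

lemma inscribed_polygon_size:
  assumes "p \<in> {3, 4, 5}" "q \<in> {3, 4, 5}" "cos (2 * pi / real p) = cos (2 * pi / real q)"
  shows "p = q"
  using assms cos_inscribed_polygon_sizes golden_bounds by auto

context separated_points
begin

text \<open>The angle \<open>\<phi>\<close> with cosine \<open>c\<close> is the central angle of the circle through \<open>p0\<close>, \<open>p1\<close>, \<open>p2\<close>, and \<open>closed\<close> states that
the walk continuing these three points along the circle with constant steps stays in \<open>X\<close>.  Then
\<open>separated_multiples\<close> applies to \<open>\<phi>\<close>.  The hypothesis \<open>far\<close> amounts to the circumradius being less than
the side.\<close>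

lemma closed_walk_polygon:
  fixes p0 p1 p2 :: "real^3"
  assumes p: "p0 \<in> X" "p1 \<in> X" "p2 \<in> X" "p0 \<bullet> p1 = \<theta>" "p1 \<bullet> p2 = \<theta>" "p0 \<bullet> p2 = \<gamma>"
    and c: "c * (2 - 2 * \<theta>) = 2 * \<theta> - 1 - \<gamma>" "- 1 / 2 \<le> c" "c < 1 / 2" "c < \<theta>"
    and far: "c * (1 + \<theta>) < \<theta> \<or> \<theta> < 0"
    and closed: "\<And>u :: nat \<Rightarrow> real^3. u 0 = p0 \<Longrightarrow> u 1 = p1 \<Longrightarrow> u 2 = p2 \<Longrightarrow>
      (\<And>k. u (Suc (Suc (Suc k))) = u k + (1 + 2 * c) *\<^sub>R (u (Suc (Suc k)) - u (Suc k))) \<Longrightarrow>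
      (\<And>k. u k \<bullet> u k = 1) \<Longrightarrow> (\<And>k. u k \<bullet> u (Suc k) = \<theta>) \<Longrightarrow> (\<And>k. u k \<bullet> u (Suc (Suc k)) = \<gamma>) \<Longrightarrow>
      (\<And>k. u k \<in> X)"
  obtains p a G where "inscribed_polygon \<theta> p a G" "p \<in> {3, 4, 5}" "cos (2 * pi / real p) = c"
    "G \<subseteq> X" "{p0, p1, p2} \<subseteq> G"
proof -
  define \<phi> where "\<phi> = arccos c"
  have cphi: "cos \<phi> = c" unfolding \<phi>_def using c by (intro cos_arccos) auto
  have \<phi>3: "pi / 3 < \<phi>"
  proof (rule ccontr)
    assume "\<not> ?thesis"
    hence "cos (pi / 3) \<le> cos \<phi>" unfolding \<phi>_def using c by (intro cos_monotone_0_pi_le) (auto intro: arccos_lbound)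
    thus False using cphi c by (simp add: cos_60)
  qed
  have \<phi>2: "\<phi> \<le> 2 * pi / 3"
  proof (rule ccontr)
    assume "\<not> ?thesis"
    hence "cos \<phi> < cos (2 * pi / 3)" unfolding \<phi>_def using c by (intro cos_monotone_0_pi) (auto intro: arccos_ubound)
    thus False using cphi c cos_inscribed_polygon_sizes(1) by simp
  qed
  have sin0: "sin \<phi> \<noteq> 0"
  proof -
    have "sin \<phi> > 0" by (rule sin_gt_zero) (use \<phi>2 \<phi>3 pi_gt_zero in linarith)+
    thus ?thesis by simp
  qed
  define \<kappa> where "\<kappa> = (\<theta> - c) / (1 - c)"
  have \<kappa>: "\<kappa> * (1 - c) = \<theta> - c" using c by (simp add: \<kappa>_def)
  have k0: "0 < \<kappa>" using c by (simp add: \<kappa>_def)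
  have k1: "\<kappa> < 1" using c theta by (simp add: \<kappa>_def)
  \<comment> \<open>The centre, solved from the recurrence for the points of a circle.\<close>
  define a where "a = (1 / (2 - 2 * c)) *\<^sub>R (p0 + p2 - (2 * c) *\<^sub>R p1)"
  have pp: "p0 \<bullet> p0 = 1" "p1 \<bullet> p1 = 1" "p2 \<bullet> p2 = 1" "p1 \<bullet> p0 = \<theta>" "p2 \<bullet> p1 = \<theta>" "p2 \<bullet> p0 = \<gamma>"
    using p unit_inner by (simp_all add: inner_commute)
  have cc: "2 - 2 * c \<noteq> 0" using c by simp
  have g: "\<gamma> = 2 * \<theta> - 1 - c * (2 - 2 * \<theta>)" using c by simp
  have ka: "\<kappa> = (2 * \<theta> - 2 * c) / (2 - 2 * c)"
  proof -
    have "(2 * \<theta> - 2 * c) / (2 - 2 * c) = (2 * (\<theta> - c)) / (2 * (1 - c))" by simp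
    also have "\<dots> = \<kappa>" by (simp only: mult_divide_mult_cancel_left_if) (simp add: \<kappa>_def)
    finally show ?thesis by simp
  qed
  have ap: "a \<bullet> p0 = \<kappa>" "a \<bullet> p1 = \<kappa>" "a \<bullet> p2 = \<kappa>"
  proof -
    let ?b = "p0 + p2 - (2 * c) *\<^sub>R p1"
    have "?b \<bullet> p0 = 2 * \<theta> - 2 * c" "?b \<bullet> p1 = 2 * \<theta> - 2 * c" "?b \<bullet> p2 = 2 * \<theta> - 2 * c"
      by (simp_all add: inner_add_left inner_diff_left pp p g algebra_simps)
    thus "a \<bullet> p0 = \<kappa>" "a \<bullet> p1 = \<kappa>" "a \<bullet> p2 = \<kappa>" by (simp_all add: a_def ka)
  qed
  have aa: "a \<bullet> a = \<kappa>"
  proof -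
    have "a \<bullet> a = (1 / (2 - 2 * c)) * (a \<bullet> p0 + a \<bullet> p2 - 2 * c * (a \<bullet> p1))"
      by (subst (2) a_def) (simp add: inner_add_right inner_diff_right)
    also have "\<dots> = (1 / (2 - 2 * c)) * ((2 - 2 * c) * \<kappa>)" unfolding ap by (simp add: algebra_simps)
    finally show ?thesis using cc by simp
  qed
  have th: "\<kappa> + (1 - \<kappa>) * c = \<theta>" using \<kappa> by (simp add: algebra_simps)
  obtain e1 e2 where e: "a \<bullet> e1 = 0" "a \<bullet> e2 = 0" "e1 \<bullet> e2 = 0" "e1 \<bullet> e1 = 1 - \<kappa>" "e2 \<bullet> e2 = 1 - \<kappa>"
    and u01: "circle_point a e1 e2 \<phi> 0 = p0" "circle_point a e1 e2 \<phi> 1 = p1"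
    by (rule circle_through_two_points[OF sin0, of a p0 p1 "1 - \<kappa>"])
      (use ap aa pp p th cphi in auto)
  define u where "u = circle_point a e1 e2 \<phi>"
  have uu: "u i \<bullet> u j = \<kappa> + (1 - \<kappa>) * cos ((real i - real j) * \<phi>)" for i j
    unfolding u_def circle_point_inner[OF e] aa ..
  have "u (Suc (Suc 0)) = (2 * c) *\<^sub>R p1 - p0 + (2 - 2 * c) *\<^sub>R a"
    unfolding u_def circle_point_step using u01 cphi by simp
  also have "\<dots> = p2" using cc by (simp add: a_def)
  finally have u2: "u 2 = p2" by (simp add: numeral_2_eq_2)
  have uX: "u k \<in> X" for k
  proof (rule closed)
    show "u 0 = p0" "u 1 = p1" "u 2 = p2" using u01 u2 by (simp_all add: u_def)
    show "u (Suc (Suc (Suc k))) = u k + (1 + 2 * c) *\<^sub>R (u (Suc (Suc k)) - u (Suc k))" for k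
      unfolding u_def using circle_point_walk[of a e1 e2 \<phi> k] cphi by simp
    show "u k \<bullet> u k = 1" for k by (simp add: uu)
    show "u k \<bullet> u (Suc k) = \<theta>" for k by (simp add: uu cphi th)
    show "u k \<bullet> u (Suc (Suc k)) = \<gamma>" for k
    proof -
      have "u k \<bullet> u (Suc (Suc k)) = u 0 \<bullet> u 2" by (simp add: uu)
      thus ?thesis using p u01 u2 by (simp add: u_def)
    qed
  qed
  have sep: "cos (real k * \<phi>) \<le> cos \<phi> \<or> cos (real k * \<phi>) = 1" for k
  proof (cases "u k = u 0")
    case True
    hence "u k \<bullet> u 0 = 1" using unit_inner[OF uX[of 0]] by simp
    hence "(1 - \<kappa>) * (1 - cos (real k * \<phi>)) = 0" by (simp add: uu algebra_simps)
    thus ?thesis using k1 by simp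
  next
    case False
    hence "u k \<bullet> u 0 \<le> \<theta>" using uX by (intro separated) auto
    hence "(1 - \<kappa>) * cos (real k * \<phi>) \<le> (1 - \<kappa>) * c" using th by (simp add: uu)
    hence "cos (real k * \<phi>) \<le> c" using k1 by simp
    thus ?thesis using cphi by simp
  qed
  obtain n :: nat where n: "n \<in> {3, 4, 5}" "\<phi> = 2 * pi / real n"
    using separated_multiples[OF \<phi>3 \<phi>2 sep] that[of 3] that[of 4] that[of 5]
    by (metis insertI1 insertI2 of_nat_numeral)
  have n0: "n > 0" using n by auto
  have far': "\<theta> < norm a"
  proof (cases "\<theta> < 0")
    case False
    have "\<theta>\<^sup>2 < \<kappa>"
    proof -
      have "(\<kappa> - \<theta>\<^sup>2) * (1 - c) = (1 - \<theta>) * (\<theta> - c * (1 + \<theta>))"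
        using \<kappa> by (simp add: power2_eq_square algebra_simps)
      moreover have "\<dots> > 0" using far False theta by simp
      ultimately have "0 < (\<kappa> - \<theta>\<^sup>2) * (1 - c)" by simp
      thus ?thesis using c by (simp add: zero_less_mult_iff)
    qed
    hence "\<theta>\<^sup>2 < (norm a)\<^sup>2" using aa by (simp add: power2_norm_eq_inner)
    thus ?thesis by (rule power2_less_imp_less) simp
  qed (metis norm_ge_zero less_le_trans)
  have a0: "a \<noteq> 0" using aa k0 by auto
  show ?thesis
  proof (rule that)
    show "inscribed_polygon \<theta> n a (range u)"
      unfolding inscribed_polygon_def aa
      by (intro conjI exI[of _ e1] exI[of _ e2])
        (use n far' a0 k1 e th cphi in \<open>simp_all add: u_def circle_point_range[OF n0]\<close>)
    show "n \<in> {3, 4, 5}" "cos (2 * pi / real n) = c" using n cphi by auto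
    show "range u \<subseteq> X" using uX by auto
    have "p0 = u 0" "p1 = u 1" "p2 = u 2" using u01 u2 by (simp_all add: u_def)
    thus "{p0, p1, p2} \<subseteq> range u" by blast
  qed
qed

lemma triangle_polygon:
  assumes p: "p0 \<in> X" "p1 \<in> X" "p2 \<in> X" "p0 \<bullet> p1 = \<theta>" "p1 \<bullet> p2 = \<theta>" "p0 \<bullet> p2 = \<theta>"
    and th: "- 1 / 2 < \<theta>"
  obtains a G where "inscribed_polygon \<theta> 3 a G" "G \<subseteq> X" "{p0, p1, p2} \<subseteq> G"
proof -
  obtain p a G where g: "inscribed_polygon \<theta> p a G" "p \<in> {3, 4, 5}" "cos (2 * pi / real p) = - 1 / 2"
    "G \<subseteq> X" "{p0, p1, p2} \<subseteq> G"
  proof (rule closed_walk_polygon[OF p, of "- 1 / 2"])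
    show "- 1 / 2 * (1 + \<theta>) < \<theta> \<or> \<theta> < 0" by (cases "\<theta> < 0") (auto simp: field_simps)
    show "- 1 / 2 * (2 - 2 * \<theta>) = 2 * \<theta> - 1 - \<theta>" by (simp add: field_simps)
  next
    fix u :: "nat \<Rightarrow> real^3" and k
    assume u: "u 0 = p0" "u 1 = p1" "u 2 = p2"
      and step: "\<And>k. u (Suc (Suc (Suc k))) = u k + (1 + 2 * (- 1 / 2)) *\<^sub>R (u (Suc (Suc k)) - u (Suc k))"
    have "u k \<in> X \<and> u (Suc k) \<in> X \<and> u (Suc (Suc k)) \<in> X"
      by (induction k) (use u p step in \<open>simp_all add: numeral_2_eq_2\<close>)
    thus "u k \<in> X" by simp
  qed (use th in auto)
  have "p = 3" by (rule inscribed_polygon_size) (use g cos_inscribed_polygon_sizes in auto)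
  thus ?thesis using g that by blast
qed

lemma neighbour_basis:
  assumes x: "x \<in> X" and y: "y \<in> nbrs x" and z: "z \<in> nbrs x"
    and ne: "z \<noteq> y" "z \<noteq> (2 * \<theta>) *\<^sub>R x - y"
  obtains l m k where "w = l *\<^sub>R y + m *\<^sub>R z + k *\<^sub>R x"
proof -
  note xy = neighbour_inner[OF x y]
  obtain a b where ab: "z = polar \<theta> x y a b" "a\<^sup>2 + b\<^sup>2 = 1" using neighbour_polar[OF x y z] by metis
  have b: "b \<noteq> 0"
  proof
    assume "b = 0"
    hence "a = 1 \<or> a = - 1" using ab(2) by (simp add: power2_eq_1_iff)
    thus False using ne ab(1) \<open>b = 0\<close> by (auto simp: polar_def scaleR_2[symmetric] algebra_simps)
  qed
  let ?u = "y - \<theta> *\<^sub>R x" and ?n = "cross3 x y"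
  define s where "s = 1 - \<theta>\<^sup>2"
  have s: "s > 0" using theta_square by (simp add: s_def)
  have n: "?n \<bullet> ?n = s" by (simp add: cross3_inner_self xy s_def)
  have uu: "?u \<bullet> ?u = s" by (simp add: inner_diff_left inner_diff_right xy s_def power2_eq_square algebra_simps)
  have o: "x \<bullet> ?u = 0" "x \<bullet> ?n = 0" "?u \<bullet> ?n = 0" "?u \<bullet> x = 0" "?n \<bullet> x = 0" "?n \<bullet> ?u = 0"
    by (simp_all add: inner_diff_left inner_diff_right dot_cross_self3 xy)
  define d where "d = w - ((w \<bullet> x) *\<^sub>R x + ((w \<bullet> ?u) / s) *\<^sub>R ?u + ((w \<bullet> ?n) / s) *\<^sub>R ?n)"
  have "d = 0"
  proof (rule orthogonal_to_basis_zero[OF o(1,2,3)])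
    show "x \<noteq> 0" "?u \<noteq> 0" "?n \<noteq> 0" using xy uu n s by auto
    show "d \<bullet> x = 0" "d \<bullet> ?u = 0" "d \<bullet> ?n = 0"
      unfolding d_def inner_diff_left[of w] inner_add_left inner_scaleR_left o uu n using s xy by simp_all
  qed
  hence w: "w = (w \<bullet> x) *\<^sub>R x + ((w \<bullet> ?u) / s) *\<^sub>R ?u + ((w \<bullet> ?n) / s) *\<^sub>R ?n" by (simp add: d_def)
  have nz: "?n = (1 / b) *\<^sub>R (z - \<theta> *\<^sub>R x - a *\<^sub>R ?u)" using b by (simp add: ab(1) polar_def)
  define B where "B = (w \<bullet> ?u) / s"
  define C where "C = (w \<bullet> ?n) / s / b"
  have "w = (w \<bullet> x) *\<^sub>R x + B *\<^sub>R ?u + C *\<^sub>R (z - \<theta> *\<^sub>R x - a *\<^sub>R ?u)"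
    using w unfolding B_def C_def by (subst (asm) (2) nz) simp
  hence "w = (B - C * a) *\<^sub>R y + C *\<^sub>R z + ((w \<bullet> x) - B * \<theta> - C * \<theta> + C * a * \<theta>) *\<^sub>R x"
    by (simp add: algebra_simps)
  thus ?thesis by (rule that)
qed

lemma vertex_figureI:
  assumes "3 \<le> q" "inj_on y {..<q}" "y ` {..<q} = nbrs v"
    and face: "\<And>i. i < q \<Longrightarrow> \<exists>a G. inscribed_polygon \<theta> (p i) a G \<and> G \<subseteq> X \<and> {v, y i, y (Suc i mod q)} \<subseteq> G"
    and sector: "\<And>w. \<exists>i<q. \<exists>l m k. 0 \<le> l \<and> 0 \<le> m \<and>
        w = l *\<^sub>R y i + m *\<^sub>R y (Suc i mod q) + k *\<^sub>R v"
  shows "\<exists>y a G. vertex_figure X \<theta> v q y p a G"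
proof -
  have "\<forall>i. \<exists>a G. i < q \<longrightarrow> inscribed_polygon \<theta> (p i) a G \<and> G \<subseteq> X \<and> {v, y i, y (Suc i mod q)} \<subseteq> G"
    using face by blast
  then obtain a G where "\<forall>i. i < q \<longrightarrow> inscribed_polygon \<theta> (p i) (a i) (G i) \<and> G i \<subseteq> X \<and>
      {v, y i, y (Suc i mod q)} \<subseteq> G i"
    by metis
  thus ?thesis unfolding vertex_figure_def using assms(1-3) sector
    by (intro exI[of _ y] exI[of _ a] exI[of _ G]) simp
qed

end

section \<open>The three local structures\<close>

locale edge_regular = neighbour_balanced +
  fixes r :: nat
  assumes card_common_neighbours:
    "x \<in> X \<Longrightarrow> y \<in> nbrs x \<Longrightarrow> card (nbrs x \<inter> nbrs y) = r"
begin

lemma finite_neighbours: "finite (nbrs x)"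
  using finite neighbours_subset by (rule finite_subset[rotated])

end

subsection \<open>Three neighbours\<close>

locale three_neighbours = neighbour_balanced X \<theta> 3 for X \<theta>
begin

text \<open>Three unit vectors in a plane with sum zero make angles of 120 degrees.\<close>

lemma neighbours_three:
  assumes x: "x \<in> X" and yz: "y \<in> nbrs x" "z \<in> nbrs x" "y \<noteq> z"
  shows "nbrs x = {y, z, (3 * \<theta>) *\<^sub>R x - y - z}" "(3 * \<theta>) *\<^sub>R x - y - z \<notin> {y, z}"
    and "y \<bullet> z = (3 * \<theta>\<^sup>2 - 1) / 2"
proof -
  have "card (nbrs x - {y, z}) = 1"
    using card_neighbours[OF x] yz by (subst card_Diff_subset) auto
  then obtain w where w: "nbrs x - {y, z} = {w}" by (auto simp: card_1_singleton_iff)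
  hence N: "nbrs x = {y, z, w}" and wn: "w \<noteq> y" "w \<noteq> z" using yz by auto
  have s: "y + z + w = (3 * \<theta>) *\<^sub>R x" using sum_neighbours[OF x] wn yz by (simp add: N add.assoc)
  hence weq: "w = (3 * \<theta>) *\<^sub>R x - y - z" by (simp add: algebra_simps)
  show "nbrs x = {y, z, (3 * \<theta>) *\<^sub>R x - y - z}" "(3 * \<theta>) *\<^sub>R x - y - z \<notin> {y, z}"
    using N wn weq by auto
  have wN: "w \<in> nbrs x" using N by simp
  note ix = neighbour_inner[OF x]
  have "(y + z + w) \<bullet> y = (3 * \<theta>) * \<theta>" "(y + z + w) \<bullet> z = (3 * \<theta>) * \<theta>" "(y + z + w) \<bullet> w = (3 * \<theta>) * \<theta>"
    unfolding s using ix[OF yz(1)] ix[OF yz(2)] ix[OF wN] by simp_all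
  hence "1 + y \<bullet> z + y \<bullet> w = 3 * \<theta>\<^sup>2" "1 + y \<bullet> z + z \<bullet> w = 3 * \<theta>\<^sup>2" "1 + y \<bullet> w + z \<bullet> w = 3 * \<theta>\<^sup>2"
    using ix(2)[OF yz(1)] ix(2)[OF yz(2)] ix(2)[OF wN]
    by (simp_all add: inner_add_left inner_commute[of z y] inner_commute[of w y] inner_commute[of w z] power2_eq_square)
  thus "y \<bullet> z = (3 * \<theta>\<^sup>2 - 1) / 2" by simp
qed

lemma obtain_neighbours_three:
  assumes x: "x \<in> X" and y: "y \<in> nbrs x"
  obtains z where "z \<in> nbrs x" "y \<noteq> z"
proof -
  have "card (nbrs x - {y}) = 2" using card_neighbours[OF x] y by (subst card_Diff_subset) auto
  hence "nbrs x - {y} \<noteq> {}" by force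
  thus ?thesis using that by blast
qed

lemma theta_ge: "- 1 / 3 \<le> \<theta>"
proof -
  obtain x where x: "x \<in> X" using nonempty by auto
  obtain y where y: "y \<in> nbrs x" using obtain_neighbour[OF x] .
  obtain z where z: "z \<in> nbrs x" "y \<noteq> z" using obtain_neighbours_three[OF x y] .
  have "y \<bullet> z \<le> \<theta>" using y z neighbours_subset by (intro separated) auto
  hence "3 * \<theta>\<^sup>2 - 1 \<le> 2 * \<theta>" using neighbours_three(3)[OF x y z] by simp
  hence "0 \<le> (1 - \<theta>) * (3 * \<theta> + 1)" by (simp add: power2_eq_square algebra_simps)
  thus ?thesis using theta by (simp add: zero_le_mult_iff)
qed

text \<open>The two neighbours of \<open>x\<close> other than \<open>y\<close> are unit vectors with these inner products, and there is no
third such vector.  This makes it possible to recognise points of \<open>X\<close> by inner products alone.\<close>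

lemma second_neighbour_rule:
  assumes x: "x \<in> X" and y: "y \<in> nbrs x"
    and u: "norm u = 1" "u \<bullet> x = \<theta>" "u \<bullet> y = (3 * \<theta>\<^sup>2 - 1) / 2"
  shows "u \<in> X"
proof -
  obtain z where z: "z \<in> nbrs x" "y \<noteq> z" using obtain_neighbours_three[OF x y] .
  define w where "w = (3 * \<theta>) *\<^sub>R x - y - z"
  have w: "w \<in> nbrs x" "w \<noteq> y" "w \<noteq> z" using neighbours_three[OF x y z] by (auto simp: w_def)
  have "u = z \<or> u = w"
  proof (rule at_most_two_with_inner_products[OF x y u(1)])
    show "norm z = 1" "norm w = 1" using z w neighbours_subset unit by auto
    show "z \<bullet> x = \<theta>" "w \<bullet> x = \<theta>" using neighbour_inner(4)[OF x] z w by auto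
    show "z \<bullet> y = (3 * \<theta>\<^sup>2 - 1) / 2" "w \<bullet> y = (3 * \<theta>\<^sup>2 - 1) / 2"
      using neighbours_three(3)[OF x y z] neighbours_three(3)[OF x y w(1)] w(2) by (auto simp: inner_commute)
  qed (use u w in auto)
  thus ?thesis using z w neighbours_subset by auto
qed

lemma basis_three:
  assumes x: "x \<in> X" and yz: "y \<in> nbrs x" "z \<in> nbrs x" "y \<noteq> z"
  obtains l m k where "w = l *\<^sub>R y + m *\<^sub>R z + k *\<^sub>R x"
proof -
  have "z \<noteq> (2 * \<theta>) *\<^sub>R x - y"
  proof
    assume "z = (2 * \<theta>) *\<^sub>R x - y"
    hence "y \<bullet> z = 2 * \<theta>\<^sup>2 - 1" using neighbour_inner[OF x yz(1)] by (simp add: inner_diff_right power2_eq_square)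
    hence "\<theta>\<^sup>2 = 1" using neighbours_three(3)[OF x yz] by (simp add: field_simps)
    thus False using theta_square by simp
  qed
  thus ?thesis using neighbour_basis[OF x yz(1,2)] yz(3) that by metis
qed

text \<open>Three consecutive points of the walk have the inner products of a point and two of its
neighbours, so the next point is found by \<open>second_neighbour_rule\<close>.\<close>

lemma face_three:
  assumes x: "x \<in> X" and yz: "y \<in> nbrs x" "z \<in> nbrs x" "y \<noteq> z"
  obtains p a G where "inscribed_polygon \<theta> p a G" "p \<in> {3, 4, 5}" "cos (2 * pi / real p) = (3 * \<theta> - 1) / 4"
    "G \<subseteq> X" "{y, x, z} \<subseteq> G"
proof (rule closed_walk_polygon)
  show "y \<in> X" "x \<in> X" "z \<in> X" using x yz neighbours_subset by auto
  show "y \<bullet> x = \<theta>" "x \<bullet> z = \<theta>" using neighbour_inner[OF x] yz by auto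
  show "y \<bullet> z = (3 * \<theta>\<^sup>2 - 1) / 2" using neighbours_three[OF x yz] by simp
  show "(3 * \<theta> - 1) / 4 * (2 - 2 * \<theta>) = 2 * \<theta> - 1 - (3 * \<theta>\<^sup>2 - 1) / 2"
    by (simp add: power2_eq_square field_simps)
  show "- 1 / 2 \<le> (3 * \<theta> - 1) / 4" "(3 * \<theta> - 1) / 4 < 1 / 2" "(3 * \<theta> - 1) / 4 < \<theta>"
    using theta_ge theta by simp_all
  show "(3 * \<theta> - 1) / 4 * (1 + \<theta>) < \<theta> \<or> \<theta> < 0"
  proof (cases "\<theta> < 0")
    case False
    hence "0 < (1 - \<theta>) * (3 * \<theta> + 1)" using theta by simp
    thus ?thesis by (simp add: power2_eq_square algebra_simps)
  qed simp
next
  fix u :: "nat \<Rightarrow> real^3" and k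
  assume u: "u 0 = y" "u 1 = x" "u 2 = z"
    and uu: "\<And>k. u k \<bullet> u k = 1" "\<And>k. u k \<bullet> u (Suc k) = \<theta>" "\<And>k. u k \<bullet> u (Suc (Suc k)) = (3 * \<theta>\<^sup>2 - 1) / 2"
  have "u k \<in> X \<and> u (Suc k) \<in> X \<and> u (Suc (Suc k)) \<in> X"
  proof (induction k)
    case 0
    thus ?case using u x yz neighbours_subset by (auto simp: numeral_2_eq_2)
  next
    case (Suc k)
    have "u (Suc (Suc (Suc k))) \<in> X"
      by (rule second_neighbour_rule[of "u (Suc (Suc k))" "u (Suc k)"])
        (use Suc uu[of "Suc k"] uu[of "Suc (Suc k)"] uu(1)[of "Suc (Suc (Suc k))"]
          in \<open>auto simp: neighbours_def norm_eq_1 inner_commute\<close>)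
    thus ?case using Suc by simp
  qed
  thus "u k \<in> X" by simp
qed

lemma vertex_figure_three:
  assumes x: "x \<in> X" and p: "p \<in> {3, 4, 5}" "cos (2 * pi / real p) = (3 * \<theta> - 1) / 4"
  shows "\<exists>y a G. vertex_figure X \<theta> x 3 y (\<lambda>_. p) a G"
proof -
  obtain y where y: "y \<in> nbrs x" using obtain_neighbour[OF x] .
  obtain z where z: "z \<in> nbrs x" "y \<noteq> z" using obtain_neighbours_three[OF x y] .
  define w where "w = (3 * \<theta>) *\<^sub>R x - y - z"
  have N: "nbrs x = {y, z, w}" "w \<noteq> y" "w \<noteq> z" using neighbours_three[OF x y z] by (auto simp: w_def)
  define Y where "Y = (\<lambda>i. [y, z, w] ! i)"
  have Y: "Y 0 = y" "Y 1 = z" "Y 2 = w" "Y (Suc 0) = z" by (simp_all add: Y_def)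
  have three: "{..<3::nat} = {0, 1, 2}" by auto
  show ?thesis
  proof (rule vertex_figureI[where y = Y and p = "\<lambda>_. p" and v = x])
    show "inj_on Y {..<3}" using N z by (auto simp: three Y)
    show "Y ` {..<3} = nbrs x" by (simp add: three Y N)
  next
    fix i :: nat assume "i < 3"
    hence i: "i = 0 \<or> i = 1 \<or> i = 2" by auto
    have ne: "Y i \<noteq> Y (Suc i mod 3)" "Y i \<in> nbrs x" "Y (Suc i mod 3) \<in> nbrs x"
      using i z(2) N(2,3) by (elim disjE; simp add: Y_def N(1))+
    obtain n a G where g: "inscribed_polygon \<theta> n a G" "n \<in> {3, 4, 5}" "cos (2 * pi / real n) = (3 * \<theta> - 1) / 4"
      "G \<subseteq> X" "{Y i, x, Y (Suc i mod 3)} \<subseteq> G"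
      using face_three[OF x ne(2,3,1)] .
    have "n = p" by (rule inscribed_polygon_size) (use g p in simp_all)
    thus "\<exists>a G. inscribed_polygon \<theta> p a G \<and> G \<subseteq> X \<and> {x, Y i, Y (Suc i mod 3)} \<subseteq> G" using g by blast
  next
    fix v :: "real^3"
    obtain l m k where v: "v = l *\<^sub>R y + m *\<^sub>R z + k *\<^sub>R x" using basis_three[OF x y z] .
    consider "0 \<le> l" "0 \<le> m" | "l \<le> m" "l \<le> 0" | "m \<le> l" "m \<le> 0" by linarith
    thus "\<exists>i<3. \<exists>l m k. 0 \<le> l \<and> 0 \<le> m \<and> v = l *\<^sub>R Y i + m *\<^sub>R Y (Suc i mod 3) + k *\<^sub>R x"
    proof cases
      case 1
      thus ?thesis using v by (intro exI[of _ 0]) (auto simp: Y)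
    next
      case 2
      have "v = (m - l) *\<^sub>R z + (- l) *\<^sub>R w + (k + 3 * \<theta> * l) *\<^sub>R x"
        by (simp add: v w_def algebra_simps)
      moreover have "Y (Suc 1 mod 3) = w" by (simp add: Y_def)
      ultimately show ?thesis using 2 by (intro exI[of _ 1] conjI exI[of _ "m - l"] exI[of _ "- l"] exI[of _ "k + 3 * \<theta> * l"]) (simp_all add: Y)
    next
      case 3
      have "v = (- m) *\<^sub>R w + (l - m) *\<^sub>R y + (k + 3 * \<theta> * m) *\<^sub>R x"
        by (simp add: v w_def algebra_simps)
      moreover have "Y (Suc 2 mod 3) = y" by (simp add: Y_def)
      ultimately show ?thesis using 3 by (intro exI[of _ 2] conjI exI[of _ "- m"] exI[of _ "l - m"] exI[of _ "k + 3 * \<theta> * m"]) (simp_all add: Y)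
    qed
  qed simp
qed

lemma face_size_three: "\<exists>p\<in>{3, 4, 5}. cos (2 * pi / real p) = (3 * \<theta> - 1) / 4"
proof -
  obtain x where x: "x \<in> X" using nonempty by auto
  obtain y where y: "y \<in> nbrs x" using obtain_neighbour[OF x] .
  obtain z where z: "z \<in> nbrs x" "y \<noteq> z" using obtain_neighbours_three[OF x y] .
  show ?thesis using face_three[OF x y z] by metis
qed

end

subsection \<open>Four neighbours\<close>

locale four_neighbours = neighbour_balanced X \<theta> 4 for X \<theta>
begin

text \<open>Four unit vectors in a plane with sum zero form two opposite pairs, because two unit vectors
  with a given nonzero sum are determined by it.\<close>

lemma opposite_rule:
  assumes x: "x \<in> X" and y: "y \<in> nbrs x"
  shows "(2 * \<theta>) *\<^sub>R x - y \<in> nbrs x"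
proof -
  have "card (nbrs x - {y}) = 3" using card_neighbours[OF x] y by (subst card_Diff_subset) auto
  then obtain a b c where abc: "nbrs x - {y} = {a, b, c}" "a \<noteq> b" "b \<noteq> c" "a \<noteq> c"
    by (auto simp: card_3_iff)
  hence N: "nbrs x = {y, a, b, c}" and ny: "y \<noteq> a" "y \<noteq> b" "y \<noteq> c" using y by auto
  have s: "y + a + b + c = (4 * \<theta>) *\<^sub>R x" using sum_neighbours[OF x] abc ny by (simp add: N add.assoc)
  show ?thesis
  proof (cases "(2 * \<theta>) *\<^sub>R x - y = a")
    case True
    thus ?thesis using N by simp
  next
    case False
    let ?s = "y + a - (2 * \<theta>) *\<^sub>R x" and ?b = "(2 * \<theta>) *\<^sub>R x - b"
    have sbc: "?s = (2 * \<theta>) *\<^sub>R x - b - c"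
    proof -
      have "(4 * \<theta>) *\<^sub>R x = (2 * \<theta>) *\<^sub>R x + (2 * \<theta>) *\<^sub>R x" by (simp add: scaleR_add_left[symmetric])
      thus ?thesis using s by (simp add: algebra_simps)
    qed
    have s0: "?s \<noteq> 0" using False by (simp add: algebra_simps)
    note ix = neighbour_inner[OF x]
    have mem: "a \<in> nbrs x" "b \<in> nbrs x" "c \<in> nbrs x" using N by auto
    note i = ix[OF y] ix[OF mem(1)] ix[OF mem(2)] ix[OF mem(3)]
    have xs: "x \<bullet> ?s = 0" by (simp add: inner_diff_right inner_add_right i)
    have ss1: "?s \<bullet> ?s = 2 * (y \<bullet> ?s)"
      by (simp add: inner_diff_right inner_add_right inner_diff_left inner_add_left i inner_commute[of a y] algebra_simps)
    have ss2: "?s \<bullet> ?s = 2 * (a \<bullet> ?s)"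
      by (simp add: inner_diff_right inner_add_right inner_diff_left inner_add_left i inner_commute[of a y] algebra_simps)
    have ss3: "?s \<bullet> ?s = 2 * (?b \<bullet> ?s)"
      unfolding sbc by (simp add: inner_diff_right inner_add_right inner_diff_left inner_add_left i inner_commute[of c b] algebra_simps)
    have "?b = y \<or> ?b = a"
    proof (rule line_meets_sphere_at_most_twice[of x ?s])
      show "cross3 x ?s \<noteq> 0"
      proof
        assume "cross3 x ?s = 0"
        hence "?s \<bullet> ?s = 0" using cross3_inner_self[of x ?s] xs i by simp
        thus False using s0 by simp
      qed
      show "?b \<bullet> ?b = y \<bullet> y" by (simp add: inner_diff_left inner_diff_right i)
      show "?b \<bullet> ?s = y \<bullet> ?s" "a \<bullet> ?s = y \<bullet> ?s" using ss1 ss2 ss3 by linarith+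
    qed (use ny i in \<open>simp_all add: inner_diff_left\<close>)
    thus ?thesis
    proof
      assume "?b = y"
      hence "(2 * \<theta>) *\<^sub>R x - y = b" by (simp add: algebra_simps)
      thus ?thesis using N by simp
    next
      assume b: "?b = a"
      have "?s = (2 * \<theta>) *\<^sub>R x - b - c" by (rule sbc)
      hence "(2 * \<theta>) *\<^sub>R x - y = c" unfolding b[symmetric] by (simp add: algebra_simps)
      thus ?thesis using N by simp
    qed
  qed
qed

lemma opposite_neq:
  assumes x: "x \<in> X" and y: "y \<in> nbrs x"
  shows "(2 * \<theta>) *\<^sub>R x - y \<noteq> y"
proof
  assume *: "(2 * \<theta>) *\<^sub>R x - y = y"
  have "((2 * \<theta>) *\<^sub>R x - y) \<bullet> y = 2 * \<theta>\<^sup>2 - 1" using neighbour_inner[OF x y] by (simp add: inner_diff_left power2_eq_square)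
  hence "\<theta>\<^sup>2 = 1" using neighbour_inner[OF x y] * by simp
  thus False using theta_square by simp
qed

lemma neighbours_four:
  assumes x: "x \<in> X" and y: "y \<in> nbrs x" and z: "z \<in> nbrs x" "z \<noteq> y" "z \<noteq> (2 * \<theta>) *\<^sub>R x - y"
  shows "nbrs x = {y, z, (2 * \<theta>) *\<^sub>R x - y, (2 * \<theta>) *\<^sub>R x - z}"
    and "distinct [y, z, (2 * \<theta>) *\<^sub>R x - y, (2 * \<theta>) *\<^sub>R x - z]"
proof -
  let ?l = "[y, z, (2 * \<theta>) *\<^sub>R x - y, (2 * \<theta>) *\<^sub>R x - z]"
  show d: "distinct ?l"
    using opposite_neq[OF x y] opposite_neq[OF x z(1)] z by (auto simp: algebra_simps)
  have "set ?l = nbrs x"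
  proof (rule card_subset_eq)
    show "finite (nbrs x)" using finite neighbours_subset by (rule finite_subset[rotated])
    show "set ?l \<subseteq> nbrs x" using y z opposite_rule[OF x y] opposite_rule[OF x z(1)] by simp
    show "card (set ?l) = card (nbrs x)" unfolding distinct_card[OF d] card_neighbours[OF x] by simp
  qed
  thus "nbrs x = {y, z, (2 * \<theta>) *\<^sub>R x - y, (2 * \<theta>) *\<^sub>R x - z}" by simp
qed

text \<open>The next edges on the two sides are opposite to each other, so the two angles add up to exactly a
straight angle.\<close>

lemma two_sided_if_four:
  assumes x: "x \<in> X" and y: "y \<in> nbrs x"
  shows "two_sided x y"
proof -
  have "card (nbrs x - {y, (2 * \<theta>) *\<^sub>R x - y}) = 2"
    using card_neighbours[OF x] y opposite_rule[OF x y] opposite_neq[OF x y] by (subst card_Diff_subset) auto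
  then obtain z where z: "z \<in> nbrs x" "z \<noteq> y" "z \<noteq> (2 * \<theta>) *\<^sub>R x - y"
    by (auto simp: card_2_iff)
  obtain a b where ab: "z = polar \<theta> x y a b" "a\<^sup>2 + b\<^sup>2 = 1" using neighbour_polar[OF x y z(1)] by metis
  have b0: "b \<noteq> 0"
  proof
    assume "b = 0"
    hence "a = 1 \<or> a = - 1" using ab(2) by (simp add: power2_eq_1_iff)
    thus False using z ab(1) \<open>b = 0\<close> by (auto simp: polar_def scaleR_2[symmetric] algebra_simps)
  qed
  have "(2 * \<theta>) *\<^sub>R x = \<theta> *\<^sub>R x + \<theta> *\<^sub>R x" by (simp add: scaleR_add_left[symmetric])
  hence "(2 * \<theta>) *\<^sub>R x - z = polar \<theta> x y (- a) (- b)"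
    by (simp add: ab(1) polar_def)
  hence o: "polar \<theta> x y (- a) (- b) \<in> nbrs x" using opposite_rule[OF x z(1)] by simp
  show ?thesis
  proof (cases "b > 0")
    case True
    thus ?thesis unfolding two_sided_def using z ab o
      by (intro exI[of _ a] exI[of _ b] exI[of _ "- a"] exI[of _ "- b"]) simp
  next
    case False
    thus ?thesis unfolding two_sided_def using z ab o b0
      by (intro exI[of _ "- a"] exI[of _ "- b"] exI[of _ a] exI[of _ b]) simp
  qed
qed

lemma triangle_four:
  assumes x: "x \<in> X" and y: "y \<in> nbrs x"
  obtains z where "z \<in> nbrs x" "z \<in> nbrs y"
  using common_neighbour_if_two_sided[OF x y two_sided_if_four[OF x y]
      two_sided_if_four[OF _ neighbours_sym[OF x y]]] neighbour_inner(5)[OF x y] by metis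

text \<open>Of two opposite neighbours, one is at an angle of at most 90 degrees from a third neighbour \<open>z\<close>,
and for negative \<open>\<theta>\<close> neighbours of a point are separated by more than that.\<close>

lemma theta_nonneg: "0 \<le> \<theta>"
proof -
  obtain x where x: "x \<in> X" using nonempty by auto
  obtain y where y: "y \<in> nbrs x" using obtain_neighbour[OF x] .
  have "card (nbrs x - {y, (2 * \<theta>) *\<^sub>R x - y}) = 2"
    using card_neighbours[OF x] y opposite_rule[OF x y] opposite_neq[OF x y] by (subst card_Diff_subset) auto
  then obtain z where z: "z \<in> nbrs x" "z \<noteq> y" "z \<noteq> (2 * \<theta>) *\<^sub>R x - y"
    by (auto simp: card_2_iff)
  have "y \<bullet> z \<le> \<theta>" using y z neighbours_subset by (intro separated) auto
  moreover have "((2 * \<theta>) *\<^sub>R x - y) \<bullet> z \<le> \<theta>" using opposite_rule[OF x y] z neighbours_subset by (intro separated) auto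
  ultimately have "2 * \<theta>\<^sup>2 \<le> 2 * \<theta>"
    using neighbour_inner[OF x z(1)] by (simp add: inner_diff_left power2_eq_square)
  hence "\<theta> * (1 - \<theta>) \<ge> 0" by (simp add: power2_eq_square algebra_simps)
  thus ?thesis using theta by (simp add: zero_le_mult_iff)
qed

lemma triangle_neq_opposite:
  assumes x: "x \<in> X" and y: "y \<in> nbrs x" and z: "z \<in> nbrs y" "z \<in> nbrs x"
  shows "z \<noteq> y" "z \<noteq> (2 * \<theta>) *\<^sub>R x - y"
proof -
  show "z \<noteq> y" using neighbour_neq[OF neighbour_inner(5)[OF x y] z(1)] .
  show "z \<noteq> (2 * \<theta>) *\<^sub>R x - y"
  proof
    assume "z = (2 * \<theta>) *\<^sub>R x - y"
    hence "y \<bullet> z = 2 * \<theta>\<^sup>2 - 1" using neighbour_inner[OF x y] by (simp add: inner_diff_right power2_eq_square)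
    moreover have "y \<bullet> z = \<theta>" using z by (simp add: neighbours_def)
    ultimately have "(1 - \<theta>) * (2 * \<theta> + 1) = 0" by (simp add: power2_eq_square algebra_simps)
    thus False using theta theta_nonneg by auto
  qed
qed

text \<open>If the edge from \<open>x\<close> to \<open>y\<close> lies in the triangle with \<open>z\<close>, then \<open>z\<close> and the point opposite to \<open>y\<close> are
consecutive neighbours of \<open>x\<close> on a face that need not be a triangle.  The walk around it stays in
\<open>X\<close> because of opposite points only: the point \<open>w\<close> in the proof, opposite to \<open>u k\<close> at \<open>u (Suc k)\<close>, is the
third vertex of the triangle outside the next edge of the face, and the next vertex is opposite
to \<open>w\<close>.\<close>

lemma face_four:
  assumes x: "x \<in> X" and y: "y \<in> nbrs x" and z: "z \<in> nbrs x" "z \<in> nbrs y"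
  obtains p a G where "inscribed_polygon \<theta> p a G" "p \<in> {3, 4, 5}" "cos (2 * pi / real p) = \<theta> - 1 / 2"
    "G \<subseteq> X" "{z, x, (2 * \<theta>) *\<^sub>R x - y} \<subseteq> G"
proof (rule closed_walk_polygon)
  note i = neighbour_inner[OF x y] neighbour_inner[OF x z(1)]
  have yz: "y \<bullet> z = \<theta>" "z \<bullet> y = \<theta>" using z by (simp_all add: neighbours_def inner_commute)
  show start: "z \<in> X" "x \<in> X" "(2 * \<theta>) *\<^sub>R x - y \<in> X"
    using x z opposite_rule[OF x y] neighbours_subset by auto
  show "z \<bullet> x = \<theta>" "x \<bullet> ((2 * \<theta>) *\<^sub>R x - y) = \<theta>" "z \<bullet> ((2 * \<theta>) *\<^sub>R x - y) = 2 * \<theta>\<^sup>2 - \<theta>"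
    using i yz by (simp_all add: inner_diff_right power2_eq_square)
  show "(\<theta> - 1 / 2) * (2 - 2 * \<theta>) = 2 * \<theta> - 1 - (2 * \<theta>\<^sup>2 - \<theta>)"
    by (simp add: power2_eq_square field_simps)
  show "- 1 / 2 \<le> \<theta> - 1 / 2" "\<theta> - 1 / 2 < 1 / 2" "\<theta> - 1 / 2 < \<theta>"
    using theta_nonneg theta by simp_all
  have "0 < (1 - \<theta>) * (2 * \<theta> + 1)" using theta theta_nonneg by simp
  thus "(\<theta> - 1 / 2) * (1 + \<theta>) < \<theta> \<or> \<theta> < 0" by (simp add: power2_eq_square algebra_simps)
next
  fix u :: "nat \<Rightarrow> real^3" and k
  assume u: "u 0 = z" "u 1 = x" "u 2 = (2 * \<theta>) *\<^sub>R x - y"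
    and step: "\<And>k. u (Suc (Suc (Suc k))) = u k + (1 + 2 * (\<theta> - 1 / 2)) *\<^sub>R (u (Suc (Suc k)) - u (Suc k))"
    and uu: "\<And>k. u k \<bullet> u (Suc k) = \<theta>" "\<And>k. u k \<bullet> u (Suc (Suc k)) = 2 * \<theta>\<^sup>2 - \<theta>"
  have "u k \<in> X \<and> u (Suc k) \<in> X \<and> u (Suc (Suc k)) \<in> X"
  proof (induction k)
    case 0
    thus ?case using u x z opposite_rule[OF x y] neighbours_subset by (auto simp: numeral_2_eq_2)
  next
    case (Suc k)
    define w where "w = (2 * \<theta>) *\<^sub>R u (Suc k) - u k"
    have "u k \<in> nbrs (u (Suc k))" using Suc uu(1)[of k] by (simp add: neighbours_def inner_commute)
    hence "w \<in> nbrs (u (Suc k))" using opposite_rule Suc by (simp add: w_def)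
    hence "w \<in> X" using neighbours_subset by auto
    moreover have "u (Suc (Suc k)) \<bullet> w = \<theta>"
      using uu(1)[of "Suc k"] uu(2)[of k] by (simp add: w_def inner_diff_right inner_commute power2_eq_square)
    ultimately have "(2 * \<theta>) *\<^sub>R u (Suc (Suc k)) - w \<in> nbrs (u (Suc (Suc k)))"
      using Suc by (intro opposite_rule) (simp_all add: neighbours_def)
    moreover have "(2 * \<theta>) *\<^sub>R u (Suc (Suc k)) - w = u (Suc (Suc (Suc k)))"
      by (simp add: step w_def algebra_simps)
    ultimately show ?case using Suc neighbours_subset by auto
  qed
  thus "u k \<in> X" by simp
qed

lemma vertex_figure_four:
  assumes x: "x \<in> X" and p: "p \<in> {3, 4, 5}" "cos (2 * pi / real p) = \<theta> - 1 / 2"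
  shows "\<exists>y a G. vertex_figure X \<theta> x 4 y (\<lambda>i. [3, p, 3, p] ! i) a G"
proof -
  obtain y where y: "y \<in> nbrs x" using obtain_neighbour[OF x] .
  obtain z where z: "z \<in> nbrs x" "z \<in> nbrs y" using triangle_four[OF x y] .
  note nz = triangle_neq_opposite[OF x y z(2,1)]
  define y' where "y' = (2 * \<theta>) *\<^sub>R x - y"
  define z' where "z' = (2 * \<theta>) *\<^sub>R x - z"
  have N: "nbrs x = {y, z, y', z'}" and d: "distinct [y, z, y', z']"
    using neighbours_four[OF x y z(1) nz] by (auto simp: y'_def z'_def)
  define Y where "Y = (\<lambda>i. [y, z, y', z'] ! i)"
  have Y: "Y 0 = y" "Y 1 = z" "Y 2 = y'" "Y 3 = z'" by (simp_all add: Y_def)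
  have four: "{..<4::nat} = {0, 1, 2, 3}" by auto
  have th: "- 1 / 2 < \<theta>" using theta_nonneg by simp
  note i = neighbour_inner[OF x y] neighbour_inner[OF x z(1)]
  have yz: "y \<bullet> z = \<theta>" "z \<bullet> y = \<theta>" using z by (simp_all add: neighbours_def inner_commute)
  have mem: "y' \<in> nbrs x" "z' \<in> nbrs x" using N by auto
  note i' = neighbour_inner[OF x mem(1)] neighbour_inner[OF x mem(2)]
  have y'z': "y' \<bullet> z' = \<theta>" "z' \<bullet> y' = \<theta>"
    by (simp_all add: y'_def z'_def inner_diff_left inner_diff_right i yz)
  have big: "\<exists>a G. inscribed_polygon \<theta> p a G \<and> G \<subseteq> X \<and> {x, v, (2 * \<theta>) *\<^sub>R x - u} \<subseteq> G"
    if uv: "u \<in> nbrs x" "v \<in> nbrs x" "v \<in> nbrs u" for u v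
  proof -
    obtain n a G where g: "inscribed_polygon \<theta> n a G" "n \<in> {3, 4, 5}" "cos (2 * pi / real n) = \<theta> - 1 / 2"
      "G \<subseteq> X" "{v, x, (2 * \<theta>) *\<^sub>R x - u} \<subseteq> G"
      using face_four[OF x uv] .
    have "n = p" by (rule inscribed_polygon_size) (use g p in simp_all)
    thus ?thesis using g by blast
  qed
  have F0: "\<exists>a G. inscribed_polygon \<theta> 3 a G \<and> G \<subseteq> X \<and> {x, y, z} \<subseteq> G"
    using triangle_polygon[of x y z] x i yz th by metis
  have F2: "\<exists>a G. inscribed_polygon \<theta> 3 a G \<and> G \<subseteq> X \<and> {x, y', z'} \<subseteq> G"
    using triangle_polygon[of x y' z'] x i' y'z' th by metis
  have F1: "\<exists>a G. inscribed_polygon \<theta> p a G \<and> G \<subseteq> X \<and> {x, z, y'} \<subseteq> G"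
    using big[OF y z] by (simp add: y'_def)
  have yz': "y' \<in> nbrs z'" using i' y'z' by (simp add: neighbours_def)
  have "z' \<in> nbrs y'" using i' y'z' by (simp add: neighbours_def)
  hence F3: "\<exists>a G. inscribed_polygon \<theta> p a G \<and> G \<subseteq> X \<and> {x, z', y} \<subseteq> G"
    using big[OF mem(1,2)] by (simp add: y'_def)
  show ?thesis
  proof (rule vertex_figureI[where y = Y and p = "\<lambda>i. [3, p, 3, p] ! i" and v = x])
    show "inj_on Y {..<4}" using d by (auto simp: four Y_def)
    show "Y ` {..<4} = nbrs x" by (simp add: four Y_def N)
  next
    fix i :: nat assume "i < 4"
    then consider "i = 0" | "i = 1" | "i = 2" | "i = 3" by linarith
    thus "\<exists>a G. inscribed_polygon \<theta> ([3, p, 3, p] ! i) a G \<and> G \<subseteq> X \<and> {x, Y i, Y (Suc i mod 4)} \<subseteq> G"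
    proof cases
      case 1 thus ?thesis using F0 by (simp add: Y_def)
    next
      case 2 thus ?thesis using F1 by (simp add: Y_def)
    next
      case 3 thus ?thesis using F2 by (simp add: Y_def)
    next
      case 4 thus ?thesis using F3 by (simp add: Y_def)
    qed
  next
    fix v :: "real^3"
    obtain l m k where v: "v = l *\<^sub>R y + m *\<^sub>R z + k *\<^sub>R x" using neighbour_basis[OF x y z(1) nz] .
    consider "0 \<le> l" "0 \<le> m" | "l \<le> 0" "0 \<le> m" | "l \<le> 0" "m \<le> 0" | "0 \<le> l" "m \<le> 0" by linarith
    thus "\<exists>i<4. \<exists>l m k. 0 \<le> l \<and> 0 \<le> m \<and> v = l *\<^sub>R Y i + m *\<^sub>R Y (Suc i mod 4) + k *\<^sub>R x"
    proof cases
      case 1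
      thus ?thesis using v by (intro exI[of _ 0]) (auto simp: Y_def)
    next
      case 2
      have "v = m *\<^sub>R z + (- l) *\<^sub>R y' + (k + 2 * \<theta> * l) *\<^sub>R x" by (simp add: v y'_def algebra_simps)
      thus ?thesis using 2 by (intro exI[of _ 1] conjI exI[of _ m] exI[of _ "- l"] exI[of _ "k + 2 * \<theta> * l"]) (simp_all add: Y_def)
    next
      case 3
      have "v = (- l) *\<^sub>R y' + (- m) *\<^sub>R z' + (k + 2 * \<theta> * l + 2 * \<theta> * m) *\<^sub>R x"
        by (simp add: v y'_def z'_def algebra_simps)
      thus ?thesis using 3 by (intro exI[of _ 2] conjI exI[of _ "- l"] exI[of _ "- m"]
            exI[of _ "k + 2 * \<theta> * l + 2 * \<theta> * m"]) (simp_all add: Y_def)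
    next
      case 4
      have "v = (- m) *\<^sub>R z' + l *\<^sub>R y + (k + 2 * \<theta> * m) *\<^sub>R x" by (simp add: v z'_def algebra_simps)
      thus ?thesis using 4 by (intro exI[of _ 3] conjI exI[of _ "- m"] exI[of _ l] exI[of _ "k + 2 * \<theta> * m"])
          (simp_all add: Y_def)
    qed
  qed simp
qed

lemma face_size_four: "\<exists>p\<in>{3, 4, 5}. cos (2 * pi / real p) = \<theta> - 1 / 2"
proof -
  obtain x where x: "x \<in> X" using nonempty by auto
  obtain y where y: "y \<in> nbrs x" using obtain_neighbour[OF x] .
  obtain z where z: "z \<in> nbrs x" "z \<in> nbrs y" using triangle_four[OF x y] .
  show ?thesis using face_four[OF x y z] by metis
qed

end

subsection \<open>Five neighbours\<close>

locale five_neighbours = edge_regular X \<theta> 5 r for X \<theta> r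
begin

lemma triangle_five:
  assumes x: "x \<in> X" and y: "y \<in> nbrs x"
  obtains z where "z \<in> nbrs x" "z \<in> nbrs y"
proof -
  have yX: "y \<in> X" using neighbour_inner(5)[OF x y] .
  have x': "x \<in> nbrs y" using neighbours_sym[OF x y] .
  have "two_sided x y" by (rule two_sided_if_five[OF x y]) (simp add: card_neighbours x)
  moreover have "two_sided y x" by (rule two_sided_if_five[OF yX x']) (simp add: card_neighbours yX)
  ultimately show ?thesis using common_neighbour_if_two_sided[OF x y] that by metis
qed

lemma common_neighbours_le_2:
  assumes x: "x \<in> X" and y: "y \<in> nbrs x"
  shows "card (nbrs x \<inter> nbrs y) \<le> 2"
proof (rule ccontr)
  let ?C = "nbrs x \<inter> nbrs y"
  assume "\<not> ?thesis"
  hence "3 \<le> card ?C" by simp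
  then obtain T where T: "T \<subseteq> ?C" "card T = 3" by (rule obtain_subset_with_card_n)
  then obtain u v w where uvw: "T = {u, v, w}" "u \<noteq> v" "v \<noteq> w" "u \<noteq> w" by (auto simp: card_3_iff)
  have i: "norm t = 1" "t \<bullet> x = \<theta>" "t \<bullet> y = \<theta>" if "t \<in> T" for t
    using that T(1) unit by (auto simp: neighbours_def inner_commute)
  have "w = u \<or> w = v"
    by (rule at_most_two_with_inner_products[OF x y]) (use i uvw in auto)
  thus False using uvw by auto
qed

text \<open>With exactly one common neighbour on every edge, the neighbours of a point would fall into
  adjacent pairs; five points cannot.\<close>

lemma common_neighbours_two: "r = 2"
proof -
  obtain x where x: "x \<in> X" using nonempty by auto
  define N where "N = nbrs x"
  have finN: "finite N" unfolding N_def by (rule finite_neighbours)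
  have cN: "card N = 5" unfolding N_def by (rule card_neighbours[OF x])
  have c: "card (N \<inter> nbrs y) = r" if "y \<in> N" for y
    using card_common_neighbours[OF x] that by (simp add: N_def)
  obtain y where y: "y \<in> N" using cN by (cases "N = {}") auto
  have "r \<le> 2" using common_neighbours_le_2[OF x, of y] c[OF y] y by (simp add: N_def)
  moreover have "r \<noteq> 0"
  proof
    assume "r = 0"
    hence "N \<inter> nbrs y = {}" using c[OF y] finN by simp
    thus False using triangle_five[OF x] y unfolding N_def by blast
  qed
  moreover have "r \<noteq> 1"
  proof
    assume r: "r = 1"
    have uniq: "\<exists>z. N \<inter> nbrs y = {z}" if "y \<in> N" for y
      using c[OF that] r by (auto simp: card_1_singleton_iff)
    then obtain f where f: "\<And>y. y \<in> N \<Longrightarrow> N \<inter> nbrs y = {f y}" by metis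
    have "even (card N)"
    proof (rule even_card_involution[OF finN])
      fix y assume y: "y \<in> N"
      have fy: "f y \<in> N" "f y \<in> nbrs y" using f[OF y] by auto
      have yX: "y \<in> X" using y neighbours_subset by (auto simp: N_def)
      have "y \<in> N \<inter> nbrs (f y)" using neighbours_sym[OF yX fy(2)] y by simp
      thus "f (f y) = y" using f[OF fy(1)] by simp
      show "f y \<in> N" by (rule fy)
      show "f y \<noteq> y" by (rule neighbour_neq[OF yX fy(2)])
    qed
    thus False using cN by simp
  qed
  ultimately show ?thesis by linarith
qed

text \<open>The new point is the mirror image of \<open>z\<close> in the plane of \<open>x\<close> and \<open>y\<close>.  It is the only other unit vector
with the same inner products with \<open>x\<close> and \<open>y\<close>, hence equal to the second common neighbour.\<close>

lemma reflected_triangle: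
  assumes x: "x \<in> X" and y: "y \<in> nbrs x" and z: "z \<in> nbrs x" "z \<in> nbrs y"
    and th: "\<theta> \<noteq> - 1 / 2"
  shows "(2 * \<theta> / (1 + \<theta>)) *\<^sub>R (x + y) - z \<in> nbrs x"
    and "(2 * \<theta> / (1 + \<theta>)) *\<^sub>R (x + y) - z \<in> nbrs y"
    and "(2 * \<theta> / (1 + \<theta>)) *\<^sub>R (x + y) - z \<noteq> z"
proof -
  let ?C = "nbrs x \<inter> nbrs y"
  define \<kappa> where "\<kappa> = 2 * \<theta> / (1 + \<theta>)"
  have \<kappa>: "\<kappa> * (1 + \<theta>) = 2 * \<theta>" using theta by (simp add: \<kappa>_def)
  have "card ?C = 2" using card_common_neighbours[OF x y] common_neighbours_two by simp
  then obtain a b where C: "?C = {a, b}" "a \<noteq> b" by (auto simp: card_2_iff)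
  obtain z2 where z2: "?C = {z, z2}" "z2 \<noteq> z"
  proof (cases "a = z")
    case True thus ?thesis using that[of b] C by auto
  next
    case False
    hence "b = z" using C z by auto
    thus ?thesis using that[of a] C by (auto simp: doubleton_eq_iff)
  qed
  let ?w = "\<kappa> *\<^sub>R (x + y) - z"
  note i = neighbour_inner[OF x y]
  have yX: "y \<in> X" using i by simp
  note iz = neighbour_inner[OF x z(1)] neighbour_inner[OF yX z(2)]
  have wx: "?w \<bullet> x = \<theta>"
    using \<kappa> by (simp add: inner_diff_left inner_add_left i iz algebra_simps)
  have wy: "?w \<bullet> y = \<theta>"
    using \<kappa> by (simp add: inner_diff_left inner_add_left i iz algebra_simps)
  have wz: "?w \<bullet> z = 2 * \<theta> * \<kappa> - 1"
    by (simp add: inner_diff_left inner_add_left i iz algebra_simps)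
  have ww: "?w \<bullet> ?w = 1"
  proof -
    have "?w \<bullet> ?w = \<kappa> * (?w \<bullet> x + ?w \<bullet> y) - ?w \<bullet> z"
      by (simp add: inner_diff_right inner_add_right algebra_simps)
    thus ?thesis using wx wy wz by simp
  qed
  have nz: "?w \<noteq> z"
  proof
    assume "?w = z"
    hence "2 * \<theta> * \<kappa> = 2" using wz iz by simp
    hence "2 * \<theta> * (2 * \<theta>) = 2 * (1 + \<theta>)" using \<kappa> by (metis mult.assoc)
    hence "(1 - \<theta>) * (2 * \<theta> + 1) = 0" by (simp add: power2_eq_square algebra_simps)
    thus False using theta th by auto
  qed
  have z2': "z2 \<in> nbrs x" "z2 \<in> nbrs y" using z2 by auto
  have "?w = z \<or> ?w = z2"
  proof (rule at_most_two_with_inner_products[OF x y])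
    show "norm ?w = 1" using ww by (simp add: norm_eq_1)
    show "norm z = 1" "norm z2 = 1" using z z2' neighbours_subset unit by auto
    show "z2 \<bullet> x = \<theta>" "z2 \<bullet> y = \<theta>" using z2' by (simp_all add: neighbours_def inner_commute)
  qed (use z2 wx wy iz in auto)
  hence "?w = z2" using nz by simp
  thus "(2 * \<theta> / (1 + \<theta>)) *\<^sub>R (x + y) - z \<in> nbrs x"
     "(2 * \<theta> / (1 + \<theta>)) *\<^sub>R (x + y) - z \<in> nbrs y"
     "(2 * \<theta> / (1 + \<theta>)) *\<^sub>R (x + y) - z \<noteq> z" using z2' z2(2) unfolding \<kappa>_def by auto
qed

lemma angle_five:
  obtains \<alpha> where "cos \<alpha> = \<theta> / (1 + \<theta>)" "pi / 3 < \<alpha>" "\<alpha> \<le> 2 * pi / 5"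
proof -
  obtain x where x: "x \<in> X" using nonempty by auto
  have five: "card (nbrs x) = 5" by (rule card_neighbours[OF x])
  have two: "2 \<le> card (nbrs x)" using five by simp
  obtain \<alpha> where a: "cos \<alpha> = \<theta> / (1 + \<theta>)" "pi / 3 < \<alpha>" "real (card (nbrs x)) * \<alpha> \<le> 2 * pi"
    by (rule neighbour_angle_bound[OF x two])
  show ?thesis by (rule that[OF a(1,2)]) (use a(3) five in simp)
qed

lemma theta_pos: "0 < \<theta>"
proof -
  obtain \<alpha> where a: "cos \<alpha> = \<theta> / (1 + \<theta>)" "pi / 3 < \<alpha>" "\<alpha> \<le> 2 * pi / 5" by (rule angle_five)
  have "0 < cos \<alpha>" by (rule cos_gt_zero) (use a pi_gt_zero in linarith)+
  thus ?thesis using a theta by (simp add: zero_less_divide_iff)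
qed

text \<open>Reflecting triangles around a point turns its neighbours by the triangle's angle.  So that
  angle divides the full turn, and it is a fifth of it.\<close>

lemma pentagon_of_neighbours:
  assumes x: "x \<in> X" and y: "y \<in> nbrs x" and z: "z \<in> nbrs x" "z \<in> nbrs y"
  obtains Y where "Y 0 = y" "Y 1 = z" "Y ` {..<5} = nbrs x" "inj_on Y {..<(5::nat)}"
    "\<And>n. Y (n mod 5) = Y n" "\<And>n. Y n \<in> nbrs x" "\<And>n. Y n \<bullet> Y (Suc n) = \<theta>"
    "\<And>n. Y (Suc (Suc n)) = (golden - 1) *\<^sub>R (x + Y (Suc n)) - Y n"
proof -
  obtain \<alpha> where a: "cos \<alpha> = \<theta> / (1 + \<theta>)" "pi / 3 < \<alpha>" "\<alpha> \<le> 2 * pi / 5" by (rule angle_five)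
  note i = neighbour_inner[OF x y]
  have yX: "y \<in> X" using i by simp
  note iz = neighbour_inner[OF x z(1)] neighbour_inner[OF yX z(2)]
  have sin0: "sin \<alpha> \<noteq> 0"
  proof -
    have "sin \<alpha> > 0" by (rule sin_gt_zero) (use a pi_gt_zero in linarith)+
    thus ?thesis by simp
  qed
  have co: "\<theta>\<^sup>2 + (1 - \<theta>\<^sup>2) * cos \<alpha> = \<theta>"
  proof -
    have "(1 - \<theta>\<^sup>2) * (\<theta> / (1 + \<theta>)) = (1 - \<theta>) * ((1 + \<theta>) * (\<theta> / (1 + \<theta>)))"
      by (simp add: power2_eq_square algebra_simps)
    also have "(1 + \<theta>) * (\<theta> / (1 + \<theta>)) = \<theta>" using theta by simp
    finally show ?thesis unfolding a(1) by (simp add: power2_eq_square algebra_simps)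
  qed
  let ?a = "\<theta> *\<^sub>R x"
  have aa: "?a \<bullet> ?a = \<theta>\<^sup>2" using i by (simp add: power2_eq_square)
  obtain e1 e2 where e: "?a \<bullet> e1 = 0" "?a \<bullet> e2 = 0" "e1 \<bullet> e2 = 0" "e1 \<bullet> e1 = 1 - \<theta>\<^sup>2" "e2 \<bullet> e2 = 1 - \<theta>\<^sup>2"
    and u01: "circle_point ?a e1 e2 \<alpha> 0 = y" "circle_point ?a e1 e2 \<alpha> 1 = z"
  proof (rule circle_through_two_points[OF sin0, of ?a y z "1 - \<theta>\<^sup>2"])
    show "?a \<bullet> y = ?a \<bullet> ?a" "?a \<bullet> z = ?a \<bullet> ?a" using i iz by simp_all
    show "y \<bullet> y = ?a \<bullet> ?a + (1 - \<theta>\<^sup>2)" "z \<bullet> z = ?a \<bullet> ?a + (1 - \<theta>\<^sup>2)"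
      "y \<bullet> z = ?a \<bullet> ?a + (1 - \<theta>\<^sup>2) * cos \<alpha>" unfolding aa using i iz co by simp_all
  qed blast
  define u where "u = circle_point ?a e1 e2 \<alpha>"
  have uu: "u k \<bullet> u l = \<theta>\<^sup>2 + (1 - \<theta>\<^sup>2) * cos ((real k - real l) * \<alpha>)" for k l
    unfolding u_def circle_point_inner[OF e] aa ..
  have adj: "u k \<bullet> u (Suc k) = \<theta>" for k using co by (simp add: uu)
  define \<kappa> where "\<kappa> = 2 * \<theta> / (1 + \<theta>)"
  have k: "2 * cos \<alpha> = \<kappa>" by (simp add: a \<kappa>_def)
  have k2: "(2 - \<kappa>) * \<theta> = \<kappa>" using theta by (simp add: \<kappa>_def field_simps)
  have step: "u (Suc (Suc n)) = \<kappa> *\<^sub>R (x + u (Suc n)) - u n" for n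
  proof -
    have "u (Suc (Suc n)) = \<kappa> *\<^sub>R u (Suc n) - u n + (2 - \<kappa>) *\<^sub>R ?a"
      unfolding u_def circle_point_step k by simp
    thus ?thesis using k2 by (simp add: algebra_simps flip: scaleR_diff_left)
  qed
  have th: "\<theta> \<noteq> - 1 / 2" using theta_pos by simp
  have uN: "u n \<in> nbrs x \<and> u (Suc n) \<in> nbrs x" for n
  proof (induction n)
    case 0
    thus ?case using u01 y z by (simp add: u_def)
  next
    case (Suc n)
    have "u n \<in> nbrs (u (Suc n))"
      using Suc adj[of n] neighbours_subset by (auto simp: neighbours_def inner_commute)
    hence "\<kappa> *\<^sub>R (x + u (Suc n)) - u n \<in> nbrs x"
      unfolding \<kappa>_def using Suc by (intro reflected_triangle(1)[OF x _ _ _ th]) auto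
    thus ?case using Suc step by simp
  qed
  have uX: "u n \<in> X" for n using uN neighbours_subset by blast
  have sq: "0 < 1 - \<theta>\<^sup>2" using theta_square by simp
  have sep: "cos (real n * \<alpha>) \<le> cos \<alpha> \<or> cos (real n * \<alpha>) = 1" for n
  proof (cases "u n = u 0")
    case True
    hence "u n \<bullet> u 0 = 1" using unit_inner[OF uX[of 0]] by simp
    hence "(1 - \<theta>\<^sup>2) * (1 - cos (real n * \<alpha>)) = 0" by (simp add: uu algebra_simps)
    thus ?thesis using sq by simp
  next
    case False
    hence "u n \<bullet> u 0 \<le> \<theta>" using uX by (intro separated) auto
    hence "(1 - \<theta>\<^sup>2) * cos (real n * \<alpha>) \<le> (1 - \<theta>\<^sup>2) * cos \<alpha>" using co by (simp add: uu)
    hence "cos (real n * \<alpha>) \<le> cos \<alpha>" using sq by simp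
    thus ?thesis by simp
  qed
  have "\<alpha> = 2 * pi / 3 \<or> \<alpha> = 2 * pi / 4 \<or> \<alpha> = 2 * pi / 5"
    by (rule separated_multiples[OF a(2) _ sep]) (use a(3) pi_gt_zero in linarith)
  hence \<alpha>5: "\<alpha> = 2 * pi / real 5" using a(3) pi_gt_zero by auto
  have \<kappa>g: "\<kappa> = golden - 1"
    using k \<alpha>5 cos_inscribed_polygon_sizes(3) by simp
  have inj: "inj_on u {..<5}"
  proof (rule linorder_inj_onI')
    fix k l :: nat assume kl: "k \<in> {..<5}" "l \<in> {..<5}" "k < l"
    show "u k \<noteq> u l"
    proof
      assume "u k = u l"
      hence "u l \<bullet> u k = 1" using unit_inner[OF uX[of l]] by simp
      hence "(1 - \<theta>\<^sup>2) * (1 - cos ((real l - real k) * \<alpha>)) = 0" by (simp add: uu algebra_simps)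
      hence "cos (real (l - k) * \<alpha>) = 1" using sq kl by (simp add: of_nat_diff)
      moreover have "l - k = 1 \<or> l - k = 2 \<or> l - k = 3 \<or> l - k = 4" using kl by auto
      moreover have "cos (real n * \<alpha>) \<noteq> 1" if "n = 1 \<or> n = 2 \<or> n = 3 \<or> n = 4" for n :: nat
      proof
        assume "cos (real n * \<alpha>) = 1"
        then obtain m :: int where "real n * \<alpha> = of_int m * 2 * pi" by (auto simp: cos_one_2pi_int)
        hence "real n = of_int (5 * m)" using \<alpha>5 by (simp add: field_simps)
        hence "int n = 5 * m" by linarith
        thus False using that by presburger
      qed
      ultimately show False by blast
    qed
  qed
  show ?thesis
  proof (rule that[of u])
    show "u 0 = y" "u 1 = z" using u01 by (simp_all add: u_def)
    show "u ` {..<5} = nbrs x"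
      by (rule card_subset_eq) (use uN finite_neighbours card_neighbours[OF x] card_image[OF inj] in auto)
    show "inj_on u {..<5}" by (rule inj)
    show "u (n mod 5) = u n" for n unfolding u_def \<alpha>5 by (rule circle_point_mod) simp
    show "u n \<in> nbrs x" for n using uN by simp
    show "u n \<bullet> u (Suc n) = \<theta>" for n by (rule adj)
    show "u (Suc (Suc n)) = (golden - 1) *\<^sub>R (x + u (Suc n)) - u n" for n
      using step unfolding \<kappa>g .
  qed
qed

lemma triangle_neq_opposite:
  assumes x: "x \<in> X" and y: "y \<in> nbrs x" and z: "z \<in> nbrs x" "z \<in> nbrs y"
  shows "z \<noteq> y" "z \<noteq> (2 * \<theta>) *\<^sub>R x - y"
proof -
  show "z \<noteq> y" using neighbour_neq[OF _ z(2)] y neighbours_subset by auto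
  show "z \<noteq> (2 * \<theta>) *\<^sub>R x - y"
  proof
    assume "z = (2 * \<theta>) *\<^sub>R x - y"
    hence "y \<bullet> z = 2 * \<theta>\<^sup>2 - 1" using neighbour_inner[OF x y] by (simp add: inner_diff_right power2_eq_square)
    moreover have "y \<bullet> z = \<theta>" using z by (simp add: neighbours_def)
    ultimately have "(1 - \<theta>) * (2 * \<theta> + 1) = 0" by (simp add: power2_eq_square algebra_simps)
    thus False using theta theta_pos by auto
  qed
qed

text \<open>In coordinates with respect to \<open>y\<close> and \<open>z\<close>, modulo \<open>x\<close>, the five neighbours are \<open>(1, 0)\<close>, \<open>(0, 1)\<close>, \<open>(- 1, \<kappa>)\<close>,
\<open>(- \<kappa>, - \<kappa>)\<close> and \<open>(\<kappa>, - 1)\<close>, which gives the inequalities for the five sectors.\<close>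

lemma vertex_figure_five:
  assumes x: "x \<in> X"
  shows "\<exists>y a G. vertex_figure X \<theta> x 5 y (\<lambda>_. 3) a G"
proof -
  obtain y where y: "y \<in> nbrs x" using obtain_neighbour[OF x] .
  obtain z where z: "z \<in> nbrs x" "z \<in> nbrs y" using triangle_five[OF x y] .
  define \<kappa> where "\<kappa> = golden - 1"
  obtain Y where Y01: "Y 0 = y" "Y 1 = z" and Yim: "Y ` {..<5} = nbrs x" and inj: "inj_on Y {..<(5::nat)}"
    and Ymod: "\<And>n. Y (n mod 5) = Y n" and YN: "\<And>n. Y n \<in> nbrs x"
    and adj: "\<And>n. Y n \<bullet> Y (Suc n) = \<theta>"
    and step: "\<And>n. Y (Suc (Suc n)) = \<kappa> *\<^sub>R (x + Y (Suc n)) - Y n"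
    unfolding \<kappa>_def by (rule pentagon_of_neighbours[OF x y z]) blast
  have k2: "\<kappa> * \<kappa> = 1 - \<kappa>" using golden_square by (simp add: \<kappa>_def algebra_simps)
  have kpos: "0 < \<kappa>" using golden_bounds by (simp add: \<kappa>_def)
  have Y2: "Y 2 = \<kappa> *\<^sub>R (x + z) - y" using step[of 0] Y01 by (simp add: numeral_2_eq_2)
  have Y3: "Y 3 = \<kappa> *\<^sub>R (x + Y 2) - z" using step[of 1] Y01 by (simp add: numeral_2_eq_2 numeral_3_eq_3)
  have Y4: "Y 4 = \<kappa> *\<^sub>R (x + Y 3) - Y 2" using step[of 2] by (simp add: numeral_2_eq_2 numeral_3_eq_3 eval_nat_numeral)
  have kk: "\<kappa> * (\<kappa> * t) = t - \<kappa> * t" for t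
    using k2 by (metis left_diff_distrib mult.assoc mult_1)
  have Y3': "Y 3 = (- \<kappa>) *\<^sub>R y + (- \<kappa>) *\<^sub>R z + x"
    unfolding Y3 Y2 by (simp add: scaleR_right_distrib scaleR_right_diff_distrib k2 scaleR_left_diff_distrib)
  have Y4': "Y 4 = \<kappa> *\<^sub>R y - z + \<kappa> *\<^sub>R x"
    unfolding Y4 Y3' Y2 by (simp add: scaleR_right_distrib scaleR_right_diff_distrib k2 scaleR_left_diff_distrib)
  show ?thesis
  proof (rule vertex_figureI[where y = Y and p = "\<lambda>_. 3" and v = x])
    show "inj_on Y {..<5}" by (rule inj)
    show "Y ` {..<5} = nbrs x" by (rule Yim)
  next
    fix i :: nat assume "i < 5"
    have "x \<in> X" "Y i \<in> X" "Y (Suc i) \<in> X" using x YN neighbours_subset by auto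
    moreover have "x \<bullet> Y i = \<theta>" "Y i \<bullet> Y (Suc i) = \<theta>" "x \<bullet> Y (Suc i) = \<theta>"
      using YN adj by (auto simp: neighbours_def)
    moreover have "- 1 / 2 < \<theta>" using theta_pos by simp
    ultimately obtain a G where "inscribed_polygon \<theta> 3 a G" "G \<subseteq> X" "{x, Y i, Y (Suc i)} \<subseteq> G"
      by (rule triangle_polygon)
    thus "\<exists>a G. inscribed_polygon \<theta> 3 a G \<and> G \<subseteq> X \<and> {x, Y i, Y (Suc i mod 5)} \<subseteq> G"
      unfolding Ymod by blast
  next
    fix v :: "real^3"
    obtain l m k where v: "v = l *\<^sub>R y + m *\<^sub>R z + k *\<^sub>R x"
      using neighbour_basis[OF x y z(1) triangle_neq_opposite[OF x y z]] .
    have sec: "\<exists>i<5. \<exists>l m k. 0 \<le> l \<and> 0 \<le> m \<and> v = l *\<^sub>R Y i + m *\<^sub>R Y (Suc i mod 5) + k *\<^sub>R x"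
      if "i < 5" "0 \<le> l" "0 \<le> m" "v = l *\<^sub>R Y i + m *\<^sub>R Y (Suc i mod 5) + k *\<^sub>R x" for i l m k
      using that by blast
    consider "0 \<le> l" "0 \<le> m" | "l \<le> 0" "0 \<le> m + \<kappa> * l" | "l \<le> m" "\<kappa> * l + m \<le> 0"
      | "m \<le> l" "\<kappa> * m + l \<le> 0" | "m \<le> 0" "0 \<le> l + \<kappa> * m"
    proof -
      have *: "\<kappa> * t \<le> 0" if "t \<le> 0" for t using kpos that by (simp add: mult_le_0_iff)
      show ?thesis using that *[of m] *[of l] by linarith
    qed
    thus "\<exists>i<5. \<exists>l m k. 0 \<le> l \<and> 0 \<le> m \<and> v = l *\<^sub>R Y i + m *\<^sub>R Y (Suc i mod 5) + k *\<^sub>R x"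
    proof cases
      case 1
      show ?thesis by (rule sec[of 0 l m k]) (use 1 in \<open>simp_all add: v Y01[unfolded One_nat_def]\<close>)
    next
      case 2
      show ?thesis
        by (rule sec[of 1 "m + \<kappa> * l" "- l" "k + l * \<kappa>"]) (use 2 in \<open>simp_all add: v Y01[unfolded One_nat_def] Y2[unfolded numeral_2_eq_2] algebra_simps\<close>)
    next
      case 3
      have "v = (\<kappa> * (m - l)) *\<^sub>R Y 2 + (- (\<kappa> * l + m)) *\<^sub>R Y 3
          + (k - \<kappa> * (m - l) * \<kappa> + (\<kappa> * l + m)) *\<^sub>R x"
      proof -
        have l: "l = - (\<kappa> * (m - l)) + (\<kappa> * l + m) * \<kappa>" and m: "m = \<kappa> * (m - l) * \<kappa> + (\<kappa> * l + m) * \<kappa>"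
          using k2 by (simp_all add: algebra_simps kk)
        have "(\<kappa> * (m - l)) *\<^sub>R Y 2 + (- (\<kappa> * l + m)) *\<^sub>R Y 3
          + (k - \<kappa> * (m - l) * \<kappa> + (\<kappa> * l + m)) *\<^sub>R x
          = (- (\<kappa> * (m - l)) + (\<kappa> * l + m) * \<kappa>) *\<^sub>R y + (\<kappa> * (m - l) * \<kappa> + (\<kappa> * l + m) * \<kappa>) *\<^sub>R z + k *\<^sub>R x"
          unfolding Y3' Y2 by (simp add: algebra_simps)
        thus ?thesis unfolding l[symmetric] m[symmetric] v by simp
      qed
      hence sector: "v = (\<kappa> * (m - l)) *\<^sub>R Y 2 + (- (\<kappa> * l + m)) *\<^sub>R Y (Suc 2 mod 5)
          + (k - \<kappa> * (m - l) * \<kappa> + (\<kappa> * l + m)) *\<^sub>R x" by simp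
      show ?thesis by (rule sec[OF _ _ _ sector]) (use 3 kpos in simp_all)
    next
      case 4
      have "v = (- (\<kappa> * m + l)) *\<^sub>R Y 3 + (\<kappa> * (l - m)) *\<^sub>R Y 4
          + (k + (\<kappa> * m + l) - \<kappa> * (l - m) * \<kappa>) *\<^sub>R x"
      proof -
        have l: "l = (\<kappa> * m + l) * \<kappa> + \<kappa> * (l - m) * \<kappa>" and m: "m = (\<kappa> * m + l) * \<kappa> - \<kappa> * (l - m)"
          using k2 by (simp_all add: algebra_simps kk)
        have "(- (\<kappa> * m + l)) *\<^sub>R Y 3 + (\<kappa> * (l - m)) *\<^sub>R Y 4
          + (k + (\<kappa> * m + l) - \<kappa> * (l - m) * \<kappa>) *\<^sub>R x
          = ((\<kappa> * m + l) * \<kappa> + \<kappa> * (l - m) * \<kappa>) *\<^sub>R y + ((\<kappa> * m + l) * \<kappa> - \<kappa> * (l - m)) *\<^sub>R z + k *\<^sub>R x"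
          unfolding Y4' Y3' by (simp add: algebra_simps)
        thus ?thesis unfolding l[symmetric] m[symmetric] v by simp
      qed
      hence sector: "v = (- (\<kappa> * m + l)) *\<^sub>R Y 3 + (\<kappa> * (l - m)) *\<^sub>R Y (Suc 3 mod 5)
          + (k + (\<kappa> * m + l) - \<kappa> * (l - m) * \<kappa>) *\<^sub>R x" by simp
      show ?thesis by (rule sec[OF _ _ _ sector]) (use 4 kpos in simp_all)
    next
      case 5
      show ?thesis
        by (rule sec[of 4 "- m" "l + \<kappa> * m" "k + m * \<kappa>"]) (use 5 in \<open>simp_all add: v Y01[unfolded One_nat_def] Y4' algebra_simps\<close>)
    qed
  qed simp
qed

end

section \<open>Symmetries in the case of four neighbours\<close>

lemma orthogonal_reflection:
  fixes d :: "'a::real_inner"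
  assumes "d \<noteq> 0"
  shows "orthogonal_transformation (\<lambda>v. v - (2 * (v \<bullet> d) / (d \<bullet> d)) *\<^sub>R d)"
  unfolding orthogonal_transformation_def
proof (intro conjI allI)
  show "linear (\<lambda>v. v - (2 * (v \<bullet> d) / (d \<bullet> d)) *\<^sub>R d)"
  proof (rule linearI)
    fix u v :: 'a and r :: real
    have "2 * ((u + v) \<bullet> d) / (d \<bullet> d) = 2 * (u \<bullet> d) / (d \<bullet> d) + 2 * (v \<bullet> d) / (d \<bullet> d)"
      unfolding inner_add_left distrib_left add_divide_distrib ..
    thus "u + v - (2 * ((u + v) \<bullet> d) / (d \<bullet> d)) *\<^sub>R d
        = u - (2 * (u \<bullet> d) / (d \<bullet> d)) *\<^sub>R d + (v - (2 * (v \<bullet> d) / (d \<bullet> d)) *\<^sub>R d)"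
      by (simp only: scaleR_left_distrib) simp
    have "2 * ((r *\<^sub>R u) \<bullet> d) / (d \<bullet> d) = r * (2 * (u \<bullet> d) / (d \<bullet> d))" by simp
    thus "r *\<^sub>R u - (2 * ((r *\<^sub>R u) \<bullet> d) / (d \<bullet> d)) *\<^sub>R d = r *\<^sub>R (u - (2 * (u \<bullet> d) / (d \<bullet> d)) *\<^sub>R d)"
      by (simp only: scaleR_right_diff_distrib scaleR_scaleR)
  qed
  fix v w
  show "(v - (2 * (v \<bullet> d) / (d \<bullet> d)) *\<^sub>R d) \<bullet> (w - (2 * (w \<bullet> d) / (d \<bullet> d)) *\<^sub>R d) = v \<bullet> w"
    using assms by (simp add: inner_diff_left inner_diff_right inner_commute[of d v] inner_commute[of d w])
qed

context four_neighbours
begin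

lemma connected_four:
  assumes "S \<subseteq> X" "S \<noteq> {}" "\<And>x. x \<in> S \<Longrightarrow> nbrs x \<subseteq> S"
  shows "S = X"
proof (rule neighbour_closed_eq[OF _ assms])
  fix v assume "v \<in> X"
  thus "\<exists>y p a G. vertex_figure X \<theta> v 4 y p a G"
    using face_size_four vertex_figure_four by meson
qed

text \<open>The neighbours of a neighbour of \<open>v\<close> are determined by \<open>v\<close> and the neighbours of \<open>v\<close>, so an
  isometry that fits the set around one point fits it everywhere.\<close>

lemma local_symmetry_extends:
  assumes g: "orthogonal_transformation g" and x: "x \<in> X" "g x \<in> X" "g ` nbrs x \<subseteq> X"
  shows "g ` X = X"
proof -
  have lin: "linear g" using g by (rule orthogonal_transformation_linear)
  have inn: "g u \<bullet> g v = u \<bullet> v" for u v using g by (simp add: orthogonal_transformation_def)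
  define S where "S = {v \<in> X. g v \<in> X \<and> g ` nbrs v \<subseteq> X}"
  have "S = X"
  proof (rule connected_four)
    show "S \<subseteq> X" "S \<noteq> {}" using x by (auto simp: S_def)
    fix v assume "v \<in> S"
    hence v: "v \<in> X" "g v \<in> X" "g ` nbrs v \<subseteq> X" by (auto simp: S_def)
    show "nbrs v \<subseteq> S"
    proof
      fix y assume y: "y \<in> nbrs v"
      have yX: "y \<in> X" and gy: "g y \<in> X" using y v neighbours_subset by auto
      have vy: "v \<in> nbrs y" by (rule neighbours_sym[OF v(1) y])
      obtain z where z: "z \<in> nbrs v" "z \<in> nbrs y" using triangle_four[OF v(1) y] .
      have N: "nbrs y = {v, z, (2 * \<theta>) *\<^sub>R y - v, (2 * \<theta>) *\<^sub>R y - z}"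
        by (rule neighbours_four(1)[OF yX vy z(2) triangle_neq_opposite[OF yX vy z(1,2)]])
      have gz: "g z \<in> X" using z v by auto
      have opp: "g ((2 * \<theta>) *\<^sub>R y - w) \<in> X" if "g w \<in> X" "y \<bullet> w = \<theta>" for w
      proof -
        have "g w \<in> nbrs (g y)" using that inn by (simp add: neighbours_def)
        hence "(2 * \<theta>) *\<^sub>R g y - g w \<in> nbrs (g y)" by (rule opposite_rule[OF gy])
        thus ?thesis using neighbours_subset by (auto simp: linear_diff[OF lin] linear_scale[OF lin])
      qed
      have "y \<bullet> v = \<theta>" "y \<bullet> z = \<theta>" using vy z by (simp_all add: neighbours_def)
      hence "g ` nbrs y \<subseteq> X" unfolding N using v(2) gz opp by simp
      thus "y \<in> S" using yX gy by (simp add: S_def)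
    qed
  qed
  hence "g ` X \<subseteq> X" by (auto simp: S_def)
  moreover have "card (g ` X) = card X"
    using orthogonal_transformation_inj[OF g] by (intro card_image) (auto intro: inj_on_subset)
  ultimately show ?thesis using finite by (intro card_subset_eq) auto
qed

text \<open>The reflection in the bisector plane of \<open>x\<close> and \<open>y\<close> fixes a common neighbour of the two, so it carries
the neighbours of \<open>x\<close> to those of \<open>y\<close>.\<close>

lemma symmetry_of_edge:
  assumes x: "x \<in> X" and y: "y \<in> nbrs x"
  shows "\<exists>g. orthogonal_transformation g \<and> g ` X = X \<and> g x = y"
proof -
  have yX: "y \<in> X" using y neighbours_subset by auto
  define d where "d = x - y"
  note i = neighbour_inner[OF x y]
  have d0: "d \<noteq> 0" using neighbour_neq[OF x y] by (simp add: d_def)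
  define g where "g = (\<lambda>v. v - (2 * (v \<bullet> d) / (d \<bullet> d)) *\<^sub>R d)"
  have g: "orthogonal_transformation g" unfolding g_def by (rule orthogonal_reflection[OF d0])
  have lin: "linear g" using g by (rule orthogonal_transformation_linear)
  have dd: "d \<bullet> d = 2 * (1 - \<theta>)" "x \<bullet> d = 1 - \<theta>" "y \<bullet> d = - (1 - \<theta>)"
    by (simp_all add: d_def inner_diff_left inner_diff_right i)
  have gx: "g x = y" using theta unfolding g_def dd by (simp add: d_def)
  have "2 * (- (1 - \<theta>)) / (2 * (1 - \<theta>)) = - 1" using theta by (simp add: field_simps)
  hence gy: "g y = x" unfolding g_def dd by (simp add: d_def)
  obtain z where z: "z \<in> nbrs x" "z \<in> nbrs y" using triangle_four[OF x y] .
  have "z \<bullet> d = 0" using z by (simp add: d_def neighbours_def inner_diff_right inner_commute)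
  hence gz: "g z = z" by (simp add: g_def)
  have N: "nbrs x = {y, z, (2 * \<theta>) *\<^sub>R x - y, (2 * \<theta>) *\<^sub>R x - z}"
    by (rule neighbours_four(1)[OF x y z(1) triangle_neq_opposite[OF x y z(2,1)]])
  have "(2 * \<theta>) *\<^sub>R y - x \<in> X" "(2 * \<theta>) *\<^sub>R y - z \<in> X"
    using opposite_rule[OF yX neighbours_sym[OF x y]] opposite_rule[OF yX z(2)] neighbours_subset by auto
  hence "g ` nbrs x \<subseteq> X"
    unfolding N using gx gy gz x z neighbours_subset by (auto simp: linear_diff[OF lin] linear_scale[OF lin])
  hence "g ` X = X" using local_symmetry_extends[OF g x] gx yX by simp
  thus ?thesis using g gx by blast
qed

lemma symmetries_transitive:
  assumes v: "v \<in> X" and w: "w \<in> X"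
  shows "\<exists>g. orthogonal_transformation g \<and> g ` X = X \<and> g v = w"
proof -
  define S where "S = {w \<in> X. \<exists>g. orthogonal_transformation g \<and> g ` X = X \<and> g v = w}"
  have "S = X"
  proof (rule connected_four)
    show "S \<subseteq> X" by (auto simp: S_def)
    have "orthogonal_transformation (\<lambda>u::real^3. u)" by simp
    hence "v \<in> S" using v unfolding S_def by (auto intro!: exI[of _ "\<lambda>u. u"])
    thus "S \<noteq> {}" by auto
    fix x assume "x \<in> S"
    then obtain g where x: "x \<in> X" and g: "orthogonal_transformation g" "g ` X = X" "g v = x" by (auto simp: S_def)
    show "nbrs x \<subseteq> S"
    proof
      fix y assume y: "y \<in> nbrs x"
      obtain h where h: "orthogonal_transformation h" "h ` X = X" "h x = y" using symmetry_of_edge[OF x y] by blast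
      have "orthogonal_transformation (h \<circ> g)" using g h by (intro orthogonal_transformation_compose)
      moreover have "(h \<circ> g) ` X = X" using g h by (metis image_comp)
      moreover have "(h \<circ> g) v = y" using g h by simp
      ultimately have "\<exists>k. orthogonal_transformation k \<and> k ` X = X \<and> k v = y" by blast
      thus "y \<in> S" using y neighbours_subset by (auto simp: S_def)
    qed
  qed
  thus ?thesis using w by (auto simp: S_def)
qed

end

section \<open>Counting the points\<close>

subsection \<open>Coordinates in the ring generated by the golden ratio\<close>

text \<open>The pair \<open>(a, b)\<close> stands for \<open>a + b * golden\<close>.\<close>

type_synonym golden_int = "int \<times> int"
type_synonym golden_vec = "golden_int \<times> golden_int \<times> golden_int"

definition gval :: "golden_int \<Rightarrow> real" where
  "gval a = of_int (fst a) + of_int (snd a) * golden"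

definition gmul :: "golden_int \<Rightarrow> golden_int \<Rightarrow> golden_int" where
  "gmul a b = (fst a * fst b + snd a * snd b, fst a * snd b + snd a * fst b + snd a * snd b)"

definition gvec :: "real^3 \<Rightarrow> real^3 \<Rightarrow> real^3 \<Rightarrow> golden_vec \<Rightarrow> real^3" where
  "gvec b0 b1 b2 v = gval (fst v) *\<^sub>R b0 + gval (fst (snd v)) *\<^sub>R b1 + gval (snd (snd v)) *\<^sub>R b2"

definition gsum :: "golden_vec \<Rightarrow> golden_vec \<Rightarrow> golden_vec" where
  "gsum u v = ((fst (fst u) + fst (fst v), snd (fst u) + snd (fst v)),
     (fst (fst (snd u)) + fst (fst (snd v)), snd (fst (snd u)) + snd (fst (snd v))),
     (fst (snd (snd u)) + fst (snd (snd v)), snd (snd (snd u)) + snd (snd (snd v))))"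

definition gscale :: "golden_int \<Rightarrow> golden_vec \<Rightarrow> golden_vec" where
  "gscale k v = (gmul k (fst v), gmul k (fst (snd v)), gmul k (snd (snd v)))"

definition gdiff :: "golden_vec \<Rightarrow> golden_vec \<Rightarrow> golden_vec" where
  "gdiff u v = gsum u (gscale (- 1, 0) v)"

lemma gval_gmul: "gval (gmul a b) = gval a * gval b"
proof -
  have "gval a * gval b = of_int (fst a * fst b) + of_int (fst a * snd b + snd a * fst b) * golden
      + of_int (snd a * snd b) * (golden * golden)"
    by (simp add: gval_def algebra_simps)
  thus ?thesis by (simp add: golden_square gval_def gmul_def algebra_simps)
qed

lemma gvec_simps:
  "gvec b0 b1 b2 (gsum u v) = gvec b0 b1 b2 u + gvec b0 b1 b2 v"
  "gvec b0 b1 b2 (gscale k v) = gval k *\<^sub>R gvec b0 b1 b2 v"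
  "gvec b0 b1 b2 (gdiff u v) = gvec b0 b1 b2 u - gvec b0 b1 b2 v"
proof -
  show s: "gvec b0 b1 b2 (gsum u v) = gvec b0 b1 b2 u + gvec b0 b1 b2 v" for u v
    by (simp add: gvec_def gsum_def gval_def algebra_simps)
  show k: "gvec b0 b1 b2 (gscale k v) = gval k *\<^sub>R gvec b0 b1 b2 v" for k v
    by (simp add: gvec_def gscale_def gval_gmul algebra_simps)
  show "gvec b0 b1 b2 (gdiff u v) = gvec b0 b1 b2 u - gvec b0 b1 b2 v"
    by (simp add: gdiff_def s k) (simp add: gval_def)
qed

text \<open>The golden ratio is irrational, because the norm form of its ring is odd unless both arguments are
even.\<close>

lemma golden_norm_form_zero:
  fixes a b :: int
  assumes "a * a + a * b = b * b"
  shows "a = 0 \<and> b = 0"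
  using assms
proof (induction "nat (\<bar>a\<bar> + \<bar>b\<bar>)" arbitrary: a b rule: less_induct)
  case less
  have "even (a * a + a * b - b * b)" using less.prems by simp
  hence e: "even a \<and> even b" by auto
  then obtain c d where cd: "a = 2 * c" "b = 2 * d" by (auto elim!: evenE)
  show ?case
  proof (rule ccontr)
    assume n: "\<not> ?case"
    have "c = 0 \<and> d = 0"
      by (rule less.hyps) (use n cd less.prems in \<open>auto simp: algebra_simps\<close>)
    thus False using n cd by simp
  qed
qed

lemma gval_eq_0: "gval a = 0 \<Longrightarrow> a = (0, 0)"
proof -
  assume z: "gval a = 0"
  let ?x = "of_int (fst a) :: real" and ?y = "of_int (snd a) :: real"
  have x: "?x = - (?y * golden)" using z by (simp add: gval_def)
  have "?x * ?x = ?y * ?y * (golden * golden)" unfolding x by (simp add: algebra_simps)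
  also have "\<dots> = ?y * ?y - ?x * ?y" unfolding golden_square x by (simp add: algebra_simps)
  finally have "?x * ?x + ?x * ?y = ?y * ?y" by simp
  hence "fst a * fst a + fst a * snd a = snd a * snd a" by (metis of_int_add of_int_eq_iff of_int_mult)
  thus "a = (0, 0)" using golden_norm_form_zero by (cases a) auto
qed

lemma gvec_inj:
  assumes span: "\<And>w. \<exists>l m k. w = l *\<^sub>R b1 + m *\<^sub>R b2 + k *\<^sub>R b0"
  shows "inj (gvec b0 b1 b2)"
proof -
  have "w \<in> span {b0, b1, b2}" for w
  proof -
    obtain l m k where "w = l *\<^sub>R b1 + m *\<^sub>R b2 + k *\<^sub>R b0" using span by blast
    thus ?thesis by (auto intro!: span_add span_scale intro: span_base)
  qed
  hence sp: "span {b0, b1, b2} = UNIV" by auto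
  have "card {b0, b1, b2} \<ge> 3"
  proof -
    have "dim (UNIV :: (real^3) set) \<le> card {b0, b1, b2}"
      by (rule dim_le_card) (use sp in auto)
    thus ?thesis by simp
  qed
  hence ne: "b0 \<noteq> b1" "b0 \<noteq> b2" "b1 \<noteq> b2" by (auto simp: card_insert_if split: if_splits)
  have ind: "independent {b0, b1, b2}"
    by (rule card_le_dim_spanning[of _ UNIV]) (use sp ne in auto)
  have zero: "k0 = 0 \<and> k1 = 0 \<and> k2 = 0" if "k0 *\<^sub>R b0 + k1 *\<^sub>R b1 + k2 *\<^sub>R b2 = 0" for k0 k1 k2
  proof -
    define f where "f = (\<lambda>v. if v = b0 then k0 else if v = b1 then k1 else k2)"
    have "(\<Sum>v\<in>{b0, b1, b2}. f v *\<^sub>R v) = 0" using that ne by (simp add: f_def add.assoc)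
    hence "f v = 0" if "v \<in> {b0, b1, b2}" for v using independentD[OF ind _ _ _ that] by blast
    hence "f b0 = 0" "f b1 = 0" "f b2 = 0" by auto
    thus ?thesis using ne by (simp add: f_def)
  qed
  show ?thesis
  proof (rule injI)
    fix u v assume "gvec b0 b1 b2 u = gvec b0 b1 b2 v"
    hence "gvec b0 b1 b2 (gdiff u v) = 0" by (simp add: gvec_simps)
    hence "gval (fst (gdiff u v)) = 0 \<and> gval (fst (snd (gdiff u v))) = 0 \<and> gval (snd (snd (gdiff u v))) = 0"
      unfolding gvec_def by (rule zero)
    hence "fst (gdiff u v) = (0, 0)" "fst (snd (gdiff u v)) = (0, 0)" "snd (snd (gdiff u v)) = (0, 0)"
      using gval_eq_0 by auto
    thus "u = v" by (cases u; cases v) (auto simp: gdiff_def gsum_def gscale_def gmul_def)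
  qed
qed

subsection \<open>Exploring the neighbour graph\<close>

type_synonym 'a flag = "'a \<times> 'a \<times> 'a"

text \<open>A search with a queue \<open>todo\<close>; \<open>D\<close> lists one flag at every neighbour of the first point of a flag, and
the natural number bounds the number of steps.  An empty queue in the result shows that the bound
was large enough.\<close>

fun explore :: "('a flag \<Rightarrow> 'a flag list) \<Rightarrow> nat \<Rightarrow> 'a flag list \<Rightarrow> 'a flag list \<Rightarrow> 'a flag list \<times> 'a flag list" where
  "explore D 0 todo seen = (todo, seen)"
| "explore D (Suc n) [] seen = ([], seen)"
| "explore D (Suc n) (f # todo) seen =
     (if fst f \<in> set (map fst seen) then explore D n todo seen
      else explore D n (todo @ D f) (f # seen))"

lemma explore_invariant:
  assumes "\<forall>f\<in>set todo \<union> set seen. V f" "distinct (map fst seen)"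
    and "\<And>f f'. V f \<Longrightarrow> f' \<in> set (D f) \<Longrightarrow> V f'"
    and "\<forall>f\<in>set seen. fst ` set (D f) \<subseteq> fst ` set seen \<union> fst ` set todo"
    and "explore D n todo seen = ([], L)"
  shows "(\<forall>f\<in>set L. V f) \<and> distinct (map fst L) \<and>
    (\<forall>f\<in>set L. fst ` set (D f) \<subseteq> fst ` set L) \<and> fst ` set seen \<union> fst ` set todo \<subseteq> fst ` set L"
  using assms(1,2,4,5)
proof (induction n arbitrary: todo seen)
  case 0
  thus ?case by auto
next
  case (Suc n)
  show ?case
  proof (cases todo)
    case Nil
    thus ?thesis using Suc.prems by auto
  next
    case (Cons f todo')
    show ?thesis
    proof (cases "fst f \<in> fst ` set seen")
      case True
      have eq: "fst ` set seen \<union> fst ` set todo = fst ` set seen \<union> fst ` set todo'" using True Cons by auto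
      show ?thesis unfolding eq
      proof (rule Suc.IH)
        show "\<forall>f\<in>set todo' \<union> set seen. V f" using Suc.prems(1) Cons by simp
        show "distinct (map fst seen)" by (rule Suc.prems(2))
        show "\<forall>f\<in>set seen. fst ` set (D f) \<subseteq> fst ` set seen \<union> fst ` set todo'"
          using Suc.prems(3) unfolding eq .
        show "explore D n todo' seen = ([], L)" using Suc.prems(4) Cons True by simp
      qed
    next
      case False
      have "(\<forall>f\<in>set L. V f) \<and> distinct (map fst L) \<and>
        (\<forall>f\<in>set L. fst ` set (D f) \<subseteq> fst ` set L) \<and>
        fst ` set (f # seen) \<union> fst ` set (todo' @ D f) \<subseteq> fst ` set L"
      proof (rule Suc.IH)
        show "\<forall>g\<in>set (todo' @ D f) \<union> set (f # seen). V g"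
          using Suc.prems(1) Cons assms(3)[of f] by auto
        show "distinct (map fst (f # seen))" using Suc.prems(2) False by simp
        show "\<forall>g\<in>set (f # seen). fst ` set (D g) \<subseteq> fst ` set (f # seen) \<union> fst ` set (todo' @ D f)"
        proof
          fix g assume "g \<in> set (f # seen)"
          hence "g = f \<or> fst ` set (D g) \<subseteq> fst ` set seen \<union> fst ` set todo" using Suc.prems(3) by auto
          thus "fst ` set (D g) \<subseteq> fst ` set (f # seen) \<union> fst ` set (todo' @ D f)"
            unfolding Cons by auto
        qed
        show "explore D n (todo' @ D f) (f # seen) = ([], L)" using Suc.prems(4) Cons False by simp
      qed
      thus ?thesis unfolding Cons by auto
    qed
  qed
qed

text \<open>The points found contain the neighbours of each of them, so they are all points.\<close>

lemma card_by_exploration: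
  fixes J :: "'a \<Rightarrow> 'b"
  assumes inj: "inj J"
    and conn: "\<And>S. S \<subseteq> X \<Longrightarrow> S \<noteq> {} \<Longrightarrow> (\<And>x. x \<in> S \<Longrightarrow> N x \<subseteq> S) \<Longrightarrow> S = X"
    and start: "V f0"
    and VX: "\<And>f. V f \<Longrightarrow> J (fst f) \<in> X"
    and VD: "\<And>f f'. V f \<Longrightarrow> f' \<in> set (D f) \<Longrightarrow> V f'"
    and VN: "\<And>f. V f \<Longrightarrow> N (J (fst f)) \<subseteq> J ` fst ` set (D f)"
    and run: "explore D n [f0] [] = ([], L)"
  shows "card X = length L"
proof -
  have inv: "(\<forall>f\<in>set L. V f) \<and> distinct (map fst L) \<and>
    (\<forall>f\<in>set L. fst ` set (D f) \<subseteq> fst ` set L) \<and> fst f0 \<in> fst ` set L"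
    using explore_invariant[of "[f0]" "[]" V D n L] start VD run by simp
  have "J ` fst ` set L = X"
  proof (rule conn)
    show "J ` fst ` set L \<subseteq> X"
    proof clarify
      fix f assume "f \<in> set L"
      thus "J (fst f) \<in> X" using inv by (intro VX) simp
    qed
    show "J ` fst ` set L \<noteq> {}" using inv by auto
    fix x assume "x \<in> J ` fst ` set L"
    then obtain f where f: "f \<in> set L" "x = J (fst f)" by auto
    have "N x \<subseteq> J ` fst ` set (D f)" unfolding f(2) by (rule VN) (use inv f in simp)
    also have "\<dots> \<subseteq> J ` fst ` set L" by (rule image_mono) (use inv f in simp)
    finally show "N x \<subseteq> J ` fst ` set L" .
  qed
  moreover have "card (J ` fst ` set L) = length L"
    using inv distinct_card[of "map fst L"] card_image[OF inj_on_subset[OF inj subset_UNIV], of "fst ` set L"] by simp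
  ultimately show ?thesis by simp
qed

text \<open>A flag consists of a point and two of its neighbours; in the last two cases these two are
neighbours of each other.  The new flags list all neighbours of \<open>x\<close>.  In the first case the
parameters stand for \<open>k = (3 * \<theta> + 1) / 2\<close> and \<open>l = 3 * \<theta>\<close>, and the last entry of a new flag continues a face by
\<open>circle_point_walk\<close>; in the second case \<open>k\<close> stands for \<open>2 * \<theta>\<close>, and in the
third for \<open>golden - 1\<close>, twice the cosine of 72 degrees.\<close>

definition flags_three :: "golden_int \<Rightarrow> golden_int \<Rightarrow> golden_vec flag \<Rightarrow> golden_vec flag list" where
  "flags_three k l = (\<lambda>(x, y, z). let w = gdiff (gdiff (gscale l x) y) z in
     [(y, x, gsum z (gscale k (gdiff y x))), (z, x, gsum y (gscale k (gdiff z x))),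
      (w, x, gsum y (gscale k (gdiff w x)))])"

definition flags_four :: "golden_int \<Rightarrow> golden_vec flag \<Rightarrow> golden_vec flag list" where
  "flags_four k = (\<lambda>(x, y, z). let y' = gdiff (gscale k x) y; z' = gdiff (gscale k x) z in
     [(y, x, z), (z, x, y), (y', x, z'), (z', x, y')])"

definition flags_five :: "golden_vec flag \<Rightarrow> golden_vec flag list" where
  "flags_five = (\<lambda>(x, y0, y1). let k = (- 1, 1); y2 = gdiff (gscale k (gsum x y1)) y0;
     y3 = gdiff (gscale k (gsum x y2)) y1; y4 = gdiff (gscale k (gsum x y3)) y2 in
     [(y0, x, y1), (y1, x, y0), (y2, x, y1), (y3, x, y2), (y4, x, y3)])"

definition start_flag :: "golden_vec flag" where
  "start_flag = (((1, 0), (0, 0), (0, 0)), ((0, 0), (1, 0), (0, 0)), ((0, 0), (0, 0), (1, 0)))"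

text \<open>Every step handles one queued flag, so \<open>n\<close> has to be at least the number of flags that are ever
queued.\<close>

definition explored :: "(golden_vec flag \<Rightarrow> golden_vec flag list) \<Rightarrow> nat \<Rightarrow> nat \<Rightarrow> bool" where
  "explored D n k \<longleftrightarrow> (case explore D n [start_flag] [] of (todo, L) \<Rightarrow> todo = [] \<and> length L = k)"

lemma explored_tetrahedron: "explored (flags_three (0, 0) (- 1, 0)) 20 4"
  by code_simp

lemma explored_cube: "explored (flags_three (1, 0) (1, 0)) 30 8"
  by code_simp

lemma explored_octahedron: "explored (flags_four (0, 0)) 30 6"
  by code_simp

lemma explored_cuboctahedron: "explored (flags_four (1, 0)) 60 12"
  by code_simp

lemma explored_icosahedron: "explored flags_five 70 12"
  by code_simp

lemma explored_dodecahedron: "explored (flags_three (0, 1) (- 1, 2)) 70 20"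
  by code_simp

lemma explored_icosidodecahedron: "explored (flags_four (0, 1)) 130 30"
  by code_simp

context three_neighbours
begin

lemma connected_three:
  assumes "S \<subseteq> X" "S \<noteq> {}" "\<And>x. x \<in> S \<Longrightarrow> nbrs x \<subseteq> S"
  shows "S = X"
proof (rule neighbour_closed_eq[OF _ assms])
  fix v assume "v \<in> X"
  thus "\<exists>y p a G. vertex_figure X \<theta> v 3 y p a G"
    using face_size_three vertex_figure_three by meson
qed

text \<open>The flag at \<open>y\<close> is the one at \<open>x\<close>, reflected in the bisector plane of the edge from \<open>x\<close> to \<open>y\<close>.\<close>

lemma flag_step_three:
  assumes x: "x \<in> X" and yz: "y \<in> nbrs x" "z \<in> nbrs x" "y \<noteq> z"
    and k: "k = (3 * \<theta> + 1) / 2"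
  shows "x \<in> nbrs y" "z + k *\<^sub>R (y - x) \<in> nbrs y" "x \<noteq> z + k *\<^sub>R (y - x)"
proof -
  let ?u = "z + k *\<^sub>R (y - x)"
  have yX: "y \<in> X" using yz neighbours_subset by auto
  show xy: "x \<in> nbrs y" by (rule neighbours_sym[OF x yz(1)])
  note i = neighbour_inner[OF x yz(1)] neighbour_inner[OF x yz(2)]
  have yz': "y \<bullet> z = (3 * \<theta>\<^sup>2 - 1) / 2" "z \<bullet> y = (3 * \<theta>\<^sup>2 - 1) / 2"
    using neighbours_three(3)[OF x yz] by (simp_all add: inner_commute)
  have uy: "?u \<bullet> y = \<theta>"
    by (simp add: inner_add_left inner_diff_left i yz' k power2_eq_square field_simps)
  have ux: "?u \<bullet> x = (3 * \<theta>\<^sup>2 - 1) / 2"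
    by (simp add: inner_add_left inner_diff_left i yz' k power2_eq_square field_simps)
  have uz: "?u \<bullet> z = 1 + k * ((3 * \<theta>\<^sup>2 - 1) / 2 - \<theta>)"
    by (simp add: inner_add_left inner_diff_left i yz')
  have "?u \<bullet> ?u = ?u \<bullet> z + k * (?u \<bullet> y - ?u \<bullet> x)"
    by (simp only: inner_add_right inner_diff_right inner_scaleR_right)
  hence uu: "?u \<bullet> ?u = 1" unfolding ux uy uz by (simp add: algebra_simps)
  have "?u \<in> X"
    by (rule second_neighbour_rule[OF yX xy]) (use uu ux uy in \<open>simp_all add: norm_eq_1\<close>)
  thus "?u \<in> nbrs y" using uy by (simp add: neighbours_def inner_commute)
  show "x \<noteq> ?u"
  proof
    assume "x = ?u"
    hence "(3 * \<theta>\<^sup>2 - 1) / 2 = 1" using ux i by simp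
    thus False using theta_square by simp
  qed
qed

lemma card_three:
  assumes run: "explored (flags_three a b) n N" and a: "gval a = (3 * \<theta> + 1) / 2" and b: "gval b = 3 * \<theta>"
  shows "card X = N"
proof -
  obtain x where x: "x \<in> X" using nonempty by auto
  obtain y where y: "y \<in> nbrs x" using obtain_neighbour[OF x] .
  obtain z where z: "z \<in> nbrs x" "y \<noteq> z" using obtain_neighbours_three[OF x y] .
  define J where "J = gvec x y z"
  define V where "V = (\<lambda>(u, v, w). J u \<in> X \<and> J v \<in> nbrs (J u) \<and> J w \<in> nbrs (J u) \<and> J v \<noteq> J w)"
  obtain L where L: "explore (flags_three a b) n [start_flag] [] = ([], L)" "length L = N"
    using run by (auto simp: explored_def split: prod.splits)
  have "card X = length L"
  proof (rule card_by_exploration[where V = V and J = J and N = "neighbours X \<theta>", OF _ _ _ _ _ _ L(1)])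
    show "inj J" unfolding J_def
    proof (rule gvec_inj)
      fix w :: "real^3"
      show "\<exists>l m k. w = l *\<^sub>R y + m *\<^sub>R z + k *\<^sub>R x" using basis_three[OF x y z] by metis
    qed
    show "V start_flag" using x y z by (simp add: V_def start_flag_def J_def gvec_def gval_def)
    show "J (fst f) \<in> X" if "V f" for f using that by (auto simp: V_def)
    show "S = X" if "S \<subseteq> X" "S \<noteq> {}" "\<And>x. x \<in> S \<Longrightarrow> nbrs x \<subseteq> S" for S
      using connected_three that by blast
  next
    fix f assume f: "V f"
    obtain u v w where uvw: "f = (u, v, w)" by (cases f)
    note F = f[unfolded uvw V_def prod.case]
    have N: "nbrs (J u) = {J v, J w, (3 * \<theta>) *\<^sub>R J u - J v - J w}"
        "(3 * \<theta>) *\<^sub>R J u - J v - J w \<notin> {J v, J w}"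
      using neighbours_three(1,2) F by auto
    define t where "t = gdiff (gdiff (gscale b u) v) w"
    have t: "J t = (3 * \<theta>) *\<^sub>R J u - J v - J w" by (simp add: t_def J_def gvec_simps b)
    have D: "set (flags_three a b f) = {(v, u, gsum w (gscale a (gdiff v u))), (w, u, gsum v (gscale a (gdiff w u))),
      (t, u, gsum v (gscale a (gdiff t u)))}"
      by (simp add: flags_three_def uvw t_def Let_def)
    show "nbrs (J (fst f)) \<subseteq> J ` fst ` set (flags_three a b f)"
      unfolding D using N t by (auto simp: uvw)
    have step: "V (v', u, gsum w' (gscale a (gdiff v' u)))"
      if "J v' \<in> nbrs (J u)" "J w' \<in> nbrs (J u)" "J v' \<noteq> J w'" for v' w'
    proof -
      have "J (gsum w' (gscale a (gdiff v' u))) = J w' + ((3 * \<theta> + 1) / 2) *\<^sub>R (J v' - J u)"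
        by (simp add: J_def gvec_simps a)
      moreover have "J v' \<in> X" using that neighbours_subset by auto
      ultimately show ?thesis using flag_step_three[of "J u" "J v'" "J w'", OF _ that refl] F by (auto simp: V_def)
    qed
    fix f' assume "f' \<in> set (flags_three a b f)"
    thus "V f'" unfolding D using step[of v w] step[of w v] step[of t v] F N t by auto
  qed
  thus ?thesis using L by simp
qed

end

context four_neighbours
begin

lemma card_four:
  assumes run: "explored (flags_four a) n N" and a: "gval a = 2 * \<theta>"
  shows "card X = N"
proof -
  obtain x where x: "x \<in> X" using nonempty by auto
  obtain y where y: "y \<in> nbrs x" using obtain_neighbour[OF x] .
  obtain z where z: "z \<in> nbrs x" "z \<in> nbrs y" using triangle_four[OF x y] .
  define J where "J = gvec x y z"
  define V where "V = (\<lambda>(u, v, w). J u \<in> X \<and> J v \<in> nbrs (J u) \<and> J w \<in> nbrs (J u) \<and> J w \<in> nbrs (J v))"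
  obtain L where L: "explore (flags_four a) n [start_flag] [] = ([], L)" "length L = N"
    using run by (auto simp: explored_def split: prod.splits)
  have "card X = length L"
  proof (rule card_by_exploration[where V = V and J = J and N = "neighbours X \<theta>", OF _ _ _ _ _ _ L(1)])
    show "inj J" unfolding J_def
    proof (rule gvec_inj)
      fix w :: "real^3"
      show "\<exists>l m k. w = l *\<^sub>R y + m *\<^sub>R z + k *\<^sub>R x"
        using neighbour_basis[OF x y z(1) triangle_neq_opposite[OF x y z(2,1)]] by metis
    qed
    show "V start_flag" using x y z by (simp add: V_def start_flag_def J_def gvec_def gval_def)
    show "J (fst f) \<in> X" if "V f" for f using that by (auto simp: V_def)
    show "S = X" if "S \<subseteq> X" "S \<noteq> {}" "\<And>x. x \<in> S \<Longrightarrow> nbrs x \<subseteq> S" for S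
      using connected_four that by blast
  next
    fix f assume f: "V f"
    obtain u v w where uvw: "f = (u, v, w)" by (cases f)
    have F: "J u \<in> X" "J v \<in> nbrs (J u)" "J w \<in> nbrs (J u)" "J w \<in> nbrs (J v)"
      using f by (auto simp: uvw V_def)
    have vw: "J v \<in> nbrs (J w)" using F neighbours_sym neighbours_subset by blast
    have uvX: "J v \<in> X" "J w \<in> X" "J u \<in> nbrs (J v)" "J u \<in> nbrs (J w)"
      using F neighbours_sym neighbours_subset by blast+
    define v' where "v' = gdiff (gscale a u) v"
    define w' where "w' = gdiff (gscale a u) w"
    have J': "J v' = (2 * \<theta>) *\<^sub>R J u - J v" "J w' = (2 * \<theta>) *\<^sub>R J u - J w"
      by (simp_all add: v'_def w'_def J_def gvec_simps a)
    have D: "set (flags_four a f) = {(v, u, w), (w, u, v), (v', u, w'), (w', u, v')}"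
      by (simp add: flags_four_def uvw v'_def w'_def Let_def)
    have N: "nbrs (J u) = {J v, J w, J v', J w'}"
      unfolding J' by (rule neighbours_four(1)[OF F(1,2,3) triangle_neq_opposite[OF F(1,2,4,3)]])
    show "nbrs (J (fst f)) \<subseteq> J ` fst ` set (flags_four a f)"
      unfolding D using N by (auto simp: uvw)
    have opp: "J v' \<in> nbrs (J u)" "J w' \<in> nbrs (J u)" using N by auto
    have X': "J v' \<in> X" "J w' \<in> X" "J u \<in> nbrs (J v')" "J u \<in> nbrs (J w')"
      using opp F(1) neighbours_sym neighbours_subset by blast+
    have "J v' \<bullet> J w' = \<theta>"
    proof -
      note i = neighbour_inner[OF F(1,2)] neighbour_inner[OF F(1,3)] neighbour_inner[OF uvX(1) F(4)]
      show ?thesis by (simp add: J' inner_diff_left inner_diff_right i)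
    qed
    hence v'w': "J v' \<in> nbrs (J w')" "J w' \<in> nbrs (J v')"
      using X' by (simp_all add: neighbours_def inner_commute)
    fix f' assume "f' \<in> set (flags_four a f)"
    thus "V f'" unfolding D V_def using F vw uvX opp X' v'w' by auto
  qed
  thus ?thesis using L by simp
qed

end

context five_neighbours
begin

lemma connected_five:
  assumes "S \<subseteq> X" "S \<noteq> {}" "\<And>x. x \<in> S \<Longrightarrow> nbrs x \<subseteq> S"
  shows "S = X"
proof (rule neighbour_closed_eq[OF _ assms])
  fix v assume "v \<in> X"
  thus "\<exists>y p a G. vertex_figure X \<theta> v 5 y p a G" using vertex_figure_five by meson
qed

lemma card_five: "card X = 12"
proof -
  obtain x where x: "x \<in> X" using nonempty by auto
  obtain y where y: "y \<in> nbrs x" using obtain_neighbour[OF x] .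
  obtain z where z: "z \<in> nbrs x" "z \<in> nbrs y" using triangle_five[OF x y] .
  define J where "J = gvec x y z"
  define V where "V = (\<lambda>(u, v, w). J u \<in> X \<and> J v \<in> nbrs (J u) \<and> J w \<in> nbrs (J u) \<and> J w \<in> nbrs (J v))"
  obtain L where L: "explore flags_five 70 [start_flag] [] = ([], L)" "length L = 12"
    using explored_icosahedron by (auto simp: explored_def split: prod.splits)
  have "card X = length L"
  proof (rule card_by_exploration[where V = V and J = J and N = "neighbours X \<theta>", OF _ _ _ _ _ _ L(1)])
    show "inj J" unfolding J_def
    proof (rule gvec_inj)
      fix w :: "real^3"
      show "\<exists>l m k. w = l *\<^sub>R y + m *\<^sub>R z + k *\<^sub>R x"
        using neighbour_basis[OF x y z(1) triangle_neq_opposite[OF x y z]] by metis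
    qed
    show "V start_flag" using x y z by (simp add: V_def start_flag_def J_def gvec_def gval_def)
    show "J (fst f) \<in> X" if "V f" for f using that by (auto simp: V_def)
    show "S = X" if "S \<subseteq> X" "S \<noteq> {}" "\<And>x. x \<in> S \<Longrightarrow> nbrs x \<subseteq> S" for S
      using connected_five that by blast
  next
    fix f assume f: "V f"
    obtain u v w where uvw: "f = (u, v, w)" by (cases f)
    have F: "J u \<in> X" "J v \<in> nbrs (J u)" "J w \<in> nbrs (J u)" "J w \<in> nbrs (J v)"
      using f by (auto simp: uvw V_def)
    obtain Y where Y01: "Y 0 = J v" "Y 1 = J w" and Yim: "Y ` {..<5} = nbrs (J u)"
      and YN: "\<And>n. Y n \<in> nbrs (J u)" and adj: "\<And>n. Y n \<bullet> Y (Suc n) = \<theta>"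
      and step: "\<And>n. Y (Suc (Suc n)) = (golden - 1) *\<^sub>R (J u + Y (Suc n)) - Y n"
      by (rule pentagon_of_neighbours[OF F]) blast
    define k :: golden_int where "k = (- 1, 1)"
    have k: "gval k = golden - 1" by (simp add: k_def gval_def)
    define y2 where "y2 = gdiff (gscale k (gsum u w)) v"
    define y3 where "y3 = gdiff (gscale k (gsum u y2)) w"
    define y4 where "y4 = gdiff (gscale k (gsum u y3)) y2"
    have J2: "J y2 = Y 2" using step[of 0] Y01 by (simp add: y2_def J_def gvec_simps k numeral_2_eq_2)
    have J3: "J y3 = Y 3" using step[of 1] Y01 J2[symmetric]
      by (simp add: y3_def J_def gvec_simps k numeral_3_eq_3 numeral_2_eq_2)
    have J4: "J y4 = Y 4" using step[of 2] J2 J3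
      by (simp add: y4_def J_def gvec_simps k eval_nat_numeral)
    have D: "set (flags_five f) = {(v, u, w), (w, u, v), (y2, u, w), (y3, u, y2), (y4, u, y3)}"
      by (simp add: flags_five_def uvw y2_def y3_def y4_def k_def Let_def)
    have five: "{..<5::nat} = {0, 1, 2, 3, 4}" by auto
    show "nbrs (J (fst f)) \<subseteq> J ` fst ` set (flags_five f)"
      unfolding D using Yim[symmetric] by (simp add: uvw five Y01[unfolded One_nat_def] J2 J3 J4)
    have ok: "V (s, u, t)" if "J s = Y m" "J t = Y n" "m = Suc n \<or> n = Suc m" for s t m n
    proof -
      have "Y m \<bullet> Y n = \<theta>" using that(3) adj[of m] adj[of n] by (auto simp: inner_commute)
      thus ?thesis unfolding V_def using YN[of m] YN[of n] neighbours_sym[OF F(1) YN[of m]] that(1,2) neighbours_subset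
        by (auto simp: neighbours_def inner_commute)
    qed
    fix f' assume "f' \<in> set (flags_five f)"
    moreover have "V (v, u, w)" by (rule ok[of v 0 w 1]) (use Y01 in simp_all)
    moreover have "V (w, u, v)" by (rule ok[of w 1 v 0]) (use Y01 in simp_all)
    moreover have "V (y2, u, w)" by (rule ok[of y2 2 w 1]) (use Y01 J2 in simp_all)
    moreover have "V (y3, u, y2)" by (rule ok[of y3 3 y2 2]) (use J2 J3 in simp_all)
    moreover have "V (y4, u, y3)" by (rule ok[of y4 4 y3 3]) (use J3 J4 in simp_all)
    ultimately show "V f'" unfolding D by blast
  qed
  thus ?thesis using L by simp
qed

end

section \<open>Classification of edge-regular minimal distance graphs\<close>

lemma vertex_figure_cong:
  assumes "\<And>i. i < q \<Longrightarrow> p i = p' i"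
  shows "vertex_figure X \<theta> v q y p a G = vertex_figure X \<theta> v q y p' a G"
  using assms unfolding vertex_figure_def by (auto cong: conj_cong)

theorem (in three_neighbours) classification_three:
  "regular_tetrahedron (convex hull X) \<and> card X = 4 \<or>
   cube (convex hull X) \<and> card X = 8 \<or>
   regular_dodecahedron (convex hull X) \<and> card X = 20"
proof -
  obtain p where p: "p \<in> {3, 4, 5}" "cos (2 * pi / real p) = (3 * \<theta> - 1) / 4" using face_size_three by blast
  have P: "regular_polyhedron p 3 (convex hull X)"
    by (rule regular_polyhedron_from_vertex_figures) (rule vertex_figure_three[OF _ p])
  consider "p = 3" | "p = 4" | "p = 5" using p(1) by auto
  thus ?thesis
  proof cases
    case 1
    hence "\<theta> = - 1 / 3" using p(2) cos_inscribed_polygon_sizes(1) by simp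
    hence "card X = 4" by (intro card_three[OF explored_tetrahedron]) (simp_all add: gval_def)
    thus ?thesis using P 1 by (simp add: regular_tetrahedron_def)
  next
    case 2
    hence "\<theta> = 1 / 3" using p(2) cos_inscribed_polygon_sizes(2) by simp
    hence "card X = 8" by (intro card_three[OF explored_cube]) (simp_all add: gval_def)
    thus ?thesis using P 2 by (simp add: cube_def)
  next
    case 3
    hence "3 * \<theta> = 2 * golden - 1" using p(2) cos_inscribed_polygon_sizes(3) by simp
    hence "card X = 20" by (intro card_three[OF explored_dodecahedron]) (simp_all add: gval_def)
    thus ?thesis using P 3 by (simp add: regular_dodecahedron_def)
  qed
qed

theorem (in four_neighbours) classification_four:
  "regular_octahedron (convex hull X) \<and> card X = 6 \<or>
   quasi_regular_polyhedron [3, 4, 3, 4] (convex hull X) \<and> card X = 12 \<or>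
   quasi_regular_polyhedron [3, 5, 3, 5] (convex hull X) \<and> card X = 30"
proof -
  obtain p where p: "p \<in> {3, 4, 5}" "cos (2 * pi / real p) = \<theta> - 1 / 2" using face_size_four by blast
  have Q: "quasi_regular_polyhedron [3, p, 3, p] (convex hull X)"
  proof (rule quasi_regular_polyhedron_from_vertex_figures)
    have len: "length [3, p, 3, p] = 4" by simp
    show "\<exists>y a G. vertex_figure X \<theta> v (length [3, p, 3, p]) y (\<lambda>i. [3, p, 3, p] ! i) a G" if "v \<in> X" for v
      unfolding len by (rule vertex_figure_four[OF that p])
    show "\<exists>g. orthogonal_transformation g \<and> g ` X = X \<and> g v = w" if "v \<in> X" "w \<in> X" for v w
      by (rule symmetries_transitive[OF that])
  qed simp
  consider "p = 3" | "p = 4" | "p = 5" using p(1) by auto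
  thus ?thesis
  proof cases
    case 1
    hence "\<theta> = 0" using p(2) cos_inscribed_polygon_sizes(1) by simp
    hence c: "card X = 6" by (intro card_four[OF explored_octahedron]) (simp_all add: gval_def)
    have "regular_polyhedron 3 4 (convex hull X)"
    proof (rule regular_polyhedron_from_vertex_figures)
      fix v assume v: "v \<in> X"
      have eq: "[3, p, 3, p] ! i = 3" if "i < 4" for i :: nat
      proof -
        have "i = 0 \<or> i = 1 \<or> i = 2 \<or> i = 3" using that by auto
        thus ?thesis using 1 by auto
      qed
      obtain y a G where "vertex_figure X \<theta> v 4 y (\<lambda>i. [3, p, 3, p] ! i) a G"
        using vertex_figure_four[OF v p] by blast
      hence "vertex_figure X \<theta> v 4 y (\<lambda>_. 3) a G" using vertex_figure_cong[OF eq] by simp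
      thus "\<exists>y a G. vertex_figure X \<theta> v 4 y (\<lambda>_. 3) a G" by blast
    qed
    thus ?thesis using c by (simp add: regular_octahedron_def)
  next
    case 2
    hence "\<theta> = 1 / 2" using p(2) cos_inscribed_polygon_sizes(2) by simp
    hence "card X = 12" by (intro card_four[OF explored_cuboctahedron]) (simp_all add: gval_def)
    thus ?thesis using Q 2 by simp
  next
    case 3
    hence "2 * \<theta> = golden" using p(2) cos_inscribed_polygon_sizes(3) by simp
    hence "card X = 30" by (intro card_four[OF explored_icosidodecahedron]) (simp_all add: gval_def)
    thus ?thesis using Q 3 by simp
  qed
qed

theorem (in five_neighbours) classification_five:
  "regular_icosahedron (convex hull X) \<and> card X = 12"
  unfolding regular_icosahedron_def
  using regular_polyhedron_from_vertex_figures[OF vertex_figure_five] card_five by simp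

section \<open>Great circles\<close>

context separated_points
begin

text \<open>If every point had exactly two neighbours of a given kind, in opposite directions, then these
  neighbours would trace regular polygons on great circles, with sides as short as the minimal
  distance.  Two great circles meet, and near a meeting point the two polygons come too close.\<close>

lemma no_two_valent_neighbours:
  assumes N: "\<And>x. x \<in> X \<Longrightarrow> N x \<subseteq> nbrs x" "\<And>x. x \<in> X \<Longrightarrow> card (N x) = 2"
    "\<And>x. x \<in> X \<Longrightarrow> (\<Sum>y\<in>N x. y) = (2 * \<theta>) *\<^sub>R x"
    and sym: "\<And>x y. x \<in> X \<Longrightarrow> y \<in> N x \<Longrightarrow> x \<in> N y"
  shows False
proof -
  define \<phi> where "\<phi> = arccos \<theta>"
  have cphi: "cos \<phi> = \<theta>" unfolding \<phi>_def using theta by (intro cos_arccos) auto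
  have \<phi>: "0 < \<phi>" "\<phi> < pi" unfolding \<phi>_def using arccos_lt_bounded[of \<theta>] theta by auto
  have sin0: "sin \<phi> \<noteq> 0" using sin_gt_zero[OF \<phi>] by simp
  define c' where "c' = cos (\<phi> / 2)"
  have c'0: "0 < c'" unfolding c'_def using \<phi> by (intro cos_gt_zero) auto
  have c'2: "2 * c'\<^sup>2 - 1 = \<theta>" using cos_double_cos[of "\<phi> / 2"] cphi by (simp add: c'_def)
  have c'1: "c' < 1"
  proof -
    have "cos (\<phi> / 2) < cos 0" using \<phi> by (intro cos_monotone_0_pi) auto
    thus ?thesis by (simp add: c'_def)
  qed
  have pair: "N x = {y, (2 * \<theta>) *\<^sub>R x - y}" if x: "x \<in> X" and y: "y \<in> N x" for x y
  proof -
    obtain a b where ab: "N x = {a, b}" "a \<noteq> b" using N(2)[OF x] by (auto simp: card_2_iff)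
    have s: "a + b = (2 * \<theta>) *\<^sub>R x" using N(3)[OF x] ab by simp
    have "y = a \<or> y = b" using y ab by auto
    thus ?thesis unfolding s[symmetric] ab(1) by (elim disjE) auto
  qed
  have circle: "\<exists>u. (\<forall>k. u k \<in> X \<and> u (Suc k) \<in> N (u k) \<and> u k \<bullet> cross3 x y = 0) \<and>
      (\<forall>p. norm p = 1 \<and> p \<bullet> cross3 x y = 0 \<longrightarrow> (\<exists>k. c' \<le> p \<bullet> u k)) \<and> u 0 = x"
    if x: "x \<in> X" and y: "y \<in> N x" for x y
  proof -
    have yn: "y \<in> nbrs x" using N(1)[OF x] y by auto
    note i = neighbour_inner[OF x yn]
    obtain e1 e2 where e: "(0::real^3) \<bullet> e1 = 0" "0 \<bullet> e2 = 0" "e1 \<bullet> e2 = 0" "e1 \<bullet> e1 = 1" "e2 \<bullet> e2 = 1"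
      and u01: "circle_point 0 e1 e2 \<phi> 0 = x" "circle_point 0 e1 e2 \<phi> 1 = y"
      by (rule circle_through_two_points[OF sin0, of 0 x y 1]) (use i cphi in auto)
    define u where "u = circle_point 0 e1 e2 \<phi>"
    have step: "u (Suc (Suc k)) = (2 * \<theta>) *\<^sub>R u (Suc k) - u k" for k
      unfolding u_def circle_point_step cphi by simp
    have uX: "u k \<in> X \<and> u (Suc k) \<in> N (u k)" for k
    proof (induction k)
      case 0
      thus ?case using u01 x y by (simp add: u_def)
    next
      case (Suc k)
      have S: "u (Suc k) \<in> X" using Suc N(1) neighbours_subset by blast
      have "u k \<in> N (u (Suc k))" using sym Suc by blast
      hence "N (u (Suc k)) = {u k, (2 * \<theta>) *\<^sub>R u (Suc k) - u k}" by (rule pair[OF S])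
      thus ?case using S by (simp add: step)
    qed
    let ?n = "cross3 x y"
    have e1: "e1 = x" using u01 by (simp add: circle_point_def)
    have ye: "y = \<theta> *\<^sub>R e1 + sin \<phi> *\<^sub>R e2" using u01(2) by (simp add: circle_point_def cphi)
    have n1: "e1 \<bullet> ?n = 0" by (simp add: e1 dot_cross_self3)
    have n2: "e2 \<bullet> ?n = 0"
    proof -
      have "y \<bullet> ?n = 0" by (simp add: dot_cross_self3)
      thus ?thesis using sin0 n1 by (subst (asm) (1) ye) (simp add: inner_add_left)
    qed
    have un: "u k \<bullet> ?n = 0" for k by (simp add: u_def circle_point_def inner_add_left n1 n2)
    have n0: "?n \<noteq> 0" by (rule cross3_neighbour_nonzero[OF x yn])
    have near: "\<exists>k. c' \<le> p \<bullet> u k" if p: "norm p = 1" "p \<bullet> ?n = 0" for p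
    proof -
      let ?x = "p \<bullet> e1" and ?y = "p \<bullet> e2"
      define d where "d = p - (?x *\<^sub>R e1 + ?y *\<^sub>R e2)"
      have "d = 0"
      proof (rule orthogonal_to_basis_zero[of e1 e2 ?n])
        show "d \<bullet> e1 = 0" "d \<bullet> e2 = 0" "d \<bullet> ?n = 0"
          by (simp_all add: d_def inner_diff_left inner_add_left e(3-5) inner_commute[of e2 e1] n1 n2 p)
      qed (use e n0 n1 n2 in auto)
      hence pe: "p = ?x *\<^sub>R e1 + ?y *\<^sub>R e2" by (simp add: d_def)
      have "1 = p \<bullet> p" using p by (simp add: norm_eq_1)
      also have "\<dots> = p \<bullet> (?x *\<^sub>R e1 + ?y *\<^sub>R e2)" using pe by simp
      also have "\<dots> = ?x\<^sup>2 + ?y\<^sup>2" by (simp add: inner_add_right power2_eq_square)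
      finally have "?x\<^sup>2 + ?y\<^sup>2 = 1" by simp
      then obtain \<psi> where \<psi>: "0 \<le> \<psi>" "\<psi> < 2 * pi" "?x = cos \<psi>" "?y = sin \<psi>"
        using sincos_total_2pi by metis
      obtain k :: nat where "c' \<le> cos (real k * \<phi> - \<psi>)"
        using nearest_multiple[of \<phi> \<psi>] \<psi> \<phi> unfolding c'_def by auto
      moreover have "p \<bullet> u k = cos (real k * \<phi> - \<psi>)"
        by (simp add: u_def circle_point_def inner_add_right \<psi>(3,4) cos_diff algebra_simps)
      ultimately have "c' \<le> p \<bullet> u k" by simp
      thus ?thesis by blast
    qed
    show ?thesis using uX un near u01 by (intro exI[of _ u]) (simp add: u_def)
  qed
  have ex: "\<exists>y. y \<in> N x" if "x \<in> X" for x using N(2)[OF that] by (cases "N x = {}") auto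
  obtain x where x: "x \<in> X" using nonempty by auto
  obtain y where y: "y \<in> N x" using ex[OF x] by auto
  define n where "n = cross3 x y"
  have n0: "n \<noteq> 0" unfolding n_def using cross3_neighbour_nonzero[OF x] N(1)[OF x] y by blast
  have "\<exists>z\<in>X. z \<bullet> n \<noteq> 0"
  proof (rule ccontr)
    assume "\<not> ?thesis"
    hence "orthogonal n w" if "w \<in> X" for w using that by (auto simp: orthogonal_def inner_commute)
    hence "orthogonal n n" by (rule orthogonal_to_span[rotated]) (auto simp: spanning)
    thus False using n0 by (simp add: orthogonal_def)
  qed
  then obtain z where z: "z \<in> X" "z \<bullet> n \<noteq> 0" by blast
  obtain y' where y': "y' \<in> N z" using ex[OF z(1)] by auto
  define n' where "n' = cross3 z y'"
  obtain u where u: "\<And>k. u k \<in> X" "\<And>k. u (Suc k) \<in> N (u k)" "\<And>k. u k \<bullet> n = 0"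
      "\<And>p. norm p = 1 \<Longrightarrow> p \<bullet> n = 0 \<Longrightarrow> \<exists>k. c' \<le> p \<bullet> u k"
    using circle[OF x y] unfolding n_def by metis
  obtain u' where u': "\<And>k. u' k \<in> X" "\<And>k. u' (Suc k) \<in> N (u' k)" "\<And>k. u' k \<bullet> n' = 0"
      "\<And>p. norm p = 1 \<Longrightarrow> p \<bullet> n' = 0 \<Longrightarrow> \<exists>k. c' \<le> p \<bullet> u' k"
    using circle[OF z(1) y'] unfolding n'_def by metis
  let ?m = "cross3 n n'"
  have n'0: "n' \<noteq> 0" unfolding n'_def using cross3_neighbour_nonzero[OF z(1)] N(1)[OF z(1)] y' by blast
  have m0: "?m \<noteq> 0"
  proof
    assume "?m = 0"
    hence "collinear {0, n', n}" by (simp add: cross_eq_0 insert_commute)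
    then obtain c where "n = c *\<^sub>R n'" using n'0 by (auto simp: collinear_lemma)
    hence "z \<bullet> n = c * (z \<bullet> n')" by simp
    thus False using z(2) by (simp add: n'_def dot_cross_self3)
  qed
  have par: "v = (v \<bullet> p) *\<^sub>R p" if "v \<bullet> n = 0" "v \<bullet> n' = 0" "p = (1 / norm ?m) *\<^sub>R ?m" for v p
  proof -
    have pn: "p \<bullet> n = 0" "p \<bullet> n' = 0" "n \<bullet> p = 0" "n' \<bullet> p = 0" "p \<bullet> p = 1"
      using m0 that(3) by (simp_all add: dot_cross_self3 dot_square_norm power2_eq_square)
    define t where "t = n' - ((n' \<bullet> n) / (n \<bullet> n)) *\<^sub>R n"
    have tn: "t \<bullet> n = 0" "n \<bullet> t = 0" using n0 by (simp_all add: t_def inner_diff_left inner_diff_right inner_commute)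
    have t0: "t \<noteq> 0"
    proof
      assume "t = 0"
      hence "n' = ((n' \<bullet> n) / (n \<bullet> n)) *\<^sub>R n" by (simp add: t_def)
      hence "?m = 0" by (metis cross_mult_right cross_refl scaleR_zero_right)
      thus False using m0 by simp
    qed
    define d where "d = v - (v \<bullet> p) *\<^sub>R p"
    have dn: "d \<bullet> n = 0" "d \<bullet> n' = 0" using that pn by (simp_all add: d_def inner_diff_left)
    have "d = 0"
    proof (rule orthogonal_to_basis_zero[of n t p])
      show "n \<bullet> t = 0" "n \<bullet> p = 0" "t \<bullet> p = 0" using tn pn by (simp_all add: t_def inner_diff_left)
      show "d \<bullet> n = 0" "d \<bullet> t = 0" "d \<bullet> p = 0" using dn pn by (simp_all add: t_def inner_diff_right d_def inner_diff_left)
    qed (use n0 t0 pn in auto)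
    thus ?thesis by (simp add: d_def)
  qed
  define p where "p = (1 / norm ?m) *\<^sub>R ?m"
  have np: "norm p = 1" using m0 by (simp add: p_def)
  have pp: "p \<bullet> p = 1" using np by (simp add: norm_eq_1)
  have pn: "p \<bullet> n = 0" "p \<bullet> n' = 0" by (simp_all add: p_def dot_cross_self3)
  obtain i where i: "c' \<le> p \<bullet> u i" using u(4)[OF np pn(1)] by auto
  obtain j where j: "c' \<le> p \<bullet> u' j" using u'(4)[OF np pn(2)] by auto
  let ?a = "u i" and ?b = "u' j"
  have ab1: "?a \<bullet> ?a = 1" "?b \<bullet> ?b = 1" using unit_inner u(1) u'(1) by auto
  have eq: "?a = ?b"
  proof (rule ccontr)
    assume ne: "?a \<noteq> ?b"
    have le: "?a \<bullet> ?b \<le> \<theta>" by (rule separated[OF u(1) u'(1) ne])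
    let ?s = "?a + ?b"
    define t where "t = p \<bullet> ?s"
    have t: "2 * c' \<le> t" using i j by (simp add: t_def inner_add_right)
    have ss: "?s \<bullet> ?s \<le> 4 * c'\<^sup>2"
      using le ab1 c'2 by (simp add: inner_add_left inner_add_right inner_commute)
    have "(?s - t *\<^sub>R p) \<bullet> (?s - t *\<^sub>R p) = ?s \<bullet> ?s - t\<^sup>2"
      by (simp add: inner_diff_left inner_diff_right pp t_def[symmetric] inner_commute[of ?s p] power2_eq_square)
    moreover have t2: "4 * c'\<^sup>2 \<le> t\<^sup>2"
      using power_mono[OF t, of 2] c'0 by (simp add: power_mult_distrib)
    ultimately have "(?s - t *\<^sub>R p) \<bullet> (?s - t *\<^sub>R p) \<le> 0" using ss by linarith
    hence "?s - t *\<^sub>R p = 0" by (metis inner_ge_zero inner_eq_zero_iff dual_order.antisym)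
    hence st: "?s = t *\<^sub>R p" by simp
    hence "?b = t *\<^sub>R p - ?a" by (simp add: algebra_simps)
    hence "?b \<bullet> n = 0" using pn u(3) by (simp add: inner_diff_left)
    hence b: "?b = (?b \<bullet> p) *\<^sub>R p" by (rule par) (use u'(3) p_def in auto)
    have "1 = (?b \<bullet> p) * (?b \<bullet> p)"
    proof -
      have "?b \<bullet> ?b = ((?b \<bullet> p) *\<^sub>R p) \<bullet> ((?b \<bullet> p) *\<^sub>R p)" using b by simp
      thus ?thesis using ab1 pp by simp
    qed
    hence "?b \<bullet> p = 1 \<or> ?b \<bullet> p = - 1" by (metis power2_eq_1_iff power2_eq_square)
    hence bp: "p \<bullet> ?b = 1" using j c'0 by (auto simp: inner_commute)
    have "t\<^sup>2 = ?s \<bullet> ?s" using st pp by (simp add: power2_eq_square)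
    hence "t\<^sup>2 \<le> (2 * c')\<^sup>2" using ss by (simp add: power_mult_distrib)
    hence "t \<le> 2 * c'" by (rule power2_le_imp_le) (use c'0 in simp)
    thus False using bp i c'1 by (simp add: t_def inner_add_right)
  qed
  have "N ?a = {u' (Suc j), (2 * \<theta>) *\<^sub>R ?b - u' (Suc j)}"
    unfolding eq by (rule pair[OF u'(1) u'(2)])
  hence "u (Suc i) \<bullet> n' = 0" using u(2)[of i] u'(3)[of j] u'(3)[of "Suc j"] by (auto simp: inner_diff_left)
  hence s: "u (Suc i) = (u (Suc i) \<bullet> p) *\<^sub>R p" by (intro par) (use u(3) p_def in auto)
  have a: "?a = (?a \<bullet> p) *\<^sub>R p" by (intro par) (use u(3)[of i] u'(3)[of j] eq p_def in auto)
  have sq: "(v \<bullet> p)\<^sup>2 = 1" if "v = (v \<bullet> p) *\<^sub>R p" "v \<bullet> v = 1" for v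
  proof -
    have "v \<bullet> v = ((v \<bullet> p) *\<^sub>R p) \<bullet> ((v \<bullet> p) *\<^sub>R p)" using that(1) by simp
    hence "1 = (v \<bullet> p) * (v \<bullet> p)" unfolding that(2) inner_scaleR_left inner_scaleR_right pp by simp
    thus ?thesis by (simp add: power2_eq_square)
  qed
  have "?a \<bullet> u (Suc i) = \<theta>" using N(1)[OF u(1)] u(2)[of i] by (auto simp: neighbours_def)
  moreover have "?a \<bullet> u (Suc i) = (?a \<bullet> p) * (u (Suc i) \<bullet> p)"
  proof -
    have "?a \<bullet> u (Suc i) = ((?a \<bullet> p) *\<^sub>R p) \<bullet> ((u (Suc i) \<bullet> p) *\<^sub>R p)" using a s by simp
    thus ?thesis by (simp add: pp)
  qed
  ultimately have "\<theta>\<^sup>2 = (?a \<bullet> p)\<^sup>2 * (u (Suc i) \<bullet> p)\<^sup>2" by (metis power_mult_distrib)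
  also have "\<dots> = 1" using sq[OF a] sq[OF s] ab1 unit_inner[OF u(1)] by simp
  finally show False using theta_square by simp
qed

end

section \<open>Primitive idempotents of the Bose--Mesner algebra\<close>

locale association_scheme =
  fixes d :: nat and R :: "nat \<Rightarrow> ('x::finite \<times> 'x) set"
  assumes scheme: "symmetric_association_scheme d R"
begin

abbreviation \<A> :: "(real^'x^'x) set" where "\<A> \<equiv> bose_mesner_algebra d R"
abbreviation A :: "nat \<Rightarrow> real^'x^'x" where "A i \<equiv> adjacency_matrix (R i)"

lemma R0: "R 0 = Id" and R_nonempty: "i \<le> d \<Longrightarrow> R i \<noteq> {}" and R_sym: "i \<le> d \<Longrightarrow> (x, y) \<in> R i \<Longrightarrow> (y, x) \<in> R i"
  using scheme by (auto simp: symmetric_association_scheme_def sym_def)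

lemma relation_of: "\<exists>k\<le>d. (x, y) \<in> R k"
  using scheme by (auto simp: symmetric_association_scheme_def)

lemma relation_unique: "i \<le> d \<Longrightarrow> j \<le> d \<Longrightarrow> (x, y) \<in> R i \<Longrightarrow> (x, y) \<in> R j \<Longrightarrow> i = j"
proof (rule ccontr)
  assume i: "i \<le> d" "j \<le> d" "(x, y) \<in> R i" "(x, y) \<in> R j" "i \<noteq> j"
  have "disjoint_family_on R {..d}" using scheme by (simp add: symmetric_association_scheme_def)
  hence "R i \<inter> R j = {}" by (rule disjoint_family_onD) (use i in simp_all)
  thus False using i(3,4) by blast
qed

definition intersection_number :: "nat \<Rightarrow> nat \<Rightarrow> nat \<Rightarrow> nat" where
  "intersection_number i j k =
     (SOME p. \<forall>x y. (x, y) \<in> R k \<longrightarrow> card {z. (x, z) \<in> R i \<and> (z, y) \<in> R j} = p)"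

lemma intersection_number:
  assumes i: "i \<le> d" "j \<le> d" "k \<le> d" and xy: "(x, y) \<in> R k"
  shows "card {z. (x, z) \<in> R i \<and> (z, y) \<in> R j} = intersection_number i j k"
proof -
  have *: "\<forall>i\<le>d. \<forall>j\<le>d. \<forall>k\<le>d. \<exists>p. \<forall>x y. (x, y) \<in> R k \<longrightarrow>
      card {z. (x, z) \<in> R i \<and> (z, y) \<in> R j} = p"
    using scheme by (simp add: symmetric_association_scheme_def)
  have "\<forall>x y. (x, y) \<in> R k \<longrightarrow> card {z. (x, z) \<in> R i \<and> (z, y) \<in> R j} = intersection_number i j k"
    unfolding intersection_number_def
    by (rule someI_ex) (rule *[THEN spec, THEN mp, THEN spec, THEN mp, THEN spec, THEN mp, OF i])
  thus ?thesis using xy by simp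
qed

lemma adjacency_product_entry:
  "(A i ** A j) $ x $ y = real (card {z. (x, z) \<in> R i \<and> (z, y) \<in> R j})"
proof -
  have "(A i ** A j) $ x $ y = (\<Sum>z\<in>UNIV. if (x, z) \<in> R i \<and> (z, y) \<in> R j then 1 else 0)"
    by (simp add: matrix_matrix_mult_def adjacency_matrix_def if_distrib cong: if_cong)
       (rule sum.cong, auto)
  also have "\<dots> = real (card {z. (x, z) \<in> R i \<and> (z, y) \<in> R j})"
    by (simp add: sum.If_cases)
  finally show ?thesis .
qed

lemma adjacency_in: "i \<le> d \<Longrightarrow> A i \<in> \<A>"
  unfolding bose_mesner_algebra_def by (intro span_base) auto

lemma subspace_algebra: "subspace \<A>"
  unfolding bose_mesner_algebra_def by (rule subspace_span)

lemma adjacency_product: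
  assumes i: "i \<le> d" and j: "j \<le> d"
  shows "A i ** A j \<in> \<A>" "A i ** A j = A j ** A i"
proof -
  let ?p = intersection_number
  note p = intersection_number
  have "A i ** A j = (\<Sum>k\<le>d. real (?p i j k) *\<^sub>R A k)"
  proof (simp only: vec_eq_iff, intro allI)
    fix x y
    obtain k where k: "k \<le> d" "(x, y) \<in> R k" using relation_of by blast
    have "(\<Sum>l\<le>d. real (?p i j l) *\<^sub>R A l) $ x $ y = (\<Sum>l\<le>d. if l = k then real (?p i j k) else 0)"
      unfolding sum_component
      by (rule sum.cong) (use k relation_unique in \<open>auto simp: adjacency_matrix_def\<close>)
    also have "\<dots> = real (?p i j k)" using k by simp
    finally show "(A i ** A j) $ x $ y = (\<Sum>l\<le>d. real (?p i j l) *\<^sub>R A l) $ x $ y"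
      unfolding adjacency_product_entry using p[OF i j k] by simp
  qed
  thus "A i ** A j \<in> \<A>"
    using adjacency_in by (auto intro!: subspace_sum[OF subspace_algebra] subspace_scale[OF subspace_algebra])
  show "A i ** A j = A j ** A i"
  proof (simp only: vec_eq_iff, intro allI)
    fix x y
    obtain k where k: "k \<le> d" "(x, y) \<in> R k" using relation_of by blast
    have "{z. (x, z) \<in> R j \<and> (z, y) \<in> R i} = {z. (y, z) \<in> R i \<and> (z, x) \<in> R j}"
      using R_sym i j by blast
    hence "card {z. (x, z) \<in> R j \<and> (z, y) \<in> R i} = ?p i j k"
      using p[OF i j k(1) R_sym[OF k]] by simp
    thus "(A i ** A j) $ x $ y = (A j ** A i) $ x $ y"
      unfolding adjacency_product_entry using p[OF i j k] by simp
  qed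
qed

lemma algebra_induct [consumes 1, case_names zero adjacency add scale]:
  assumes "M \<in> \<A>" "P 0" "\<And>i. i \<le> d \<Longrightarrow> P (A i)" "\<And>M N. P M \<Longrightarrow> P N \<Longrightarrow> P (M + N)"
    "\<And>c M. P M \<Longrightarrow> P (c *\<^sub>R M)"
  shows "P M"
  using assms(1) unfolding bose_mesner_algebra_def
proof (rule span_induct)
  show "subspace {M. P M}" using assms unfolding subspace_def by blast
  show "P x" if "x \<in> A ` {..d}" for x using that assms(3) by auto
qed

lemma matrix_mult_scale: "(c *\<^sub>R M) ** N = c *\<^sub>R (M ** N)" "M ** (c *\<^sub>R N) = c *\<^sub>R (M ** N)"
  for M N :: "real^'x^'x"
  by (simp_all add: vec_eq_iff matrix_matrix_mult_def sum_distrib_left mult_ac)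

lemma matrix_mult_add: "(L + M) ** N = L ** N + M ** N" "N ** (L + M) = N ** L + N ** M"
  for L M N :: "real^'x^'x"
  by (simp_all add: vec_eq_iff matrix_matrix_mult_def sum.distrib algebra_simps)

lemma matrix_mult_zero: "0 ** N = 0" "N ** 0 = (0 :: real^'x^'x)" for N :: "real^'x^'x"
  by (simp_all add: vec_eq_iff matrix_matrix_mult_def)

lemma matrix_mult_diff: "(L - M) ** N = L ** N - M ** N" "N ** (L - M) = N ** L - N ** M"
  for L M N :: "real^'x^'x"
  by (simp_all add: vec_eq_iff matrix_matrix_mult_def sum_subtractf algebra_simps)

lemma algebra_mult_commute:
  assumes "M \<in> \<A>" "N \<in> \<A>"
  shows "M ** N \<in> \<A> \<and> M ** N = N ** M"
  using assms(1)
proof (induction rule: algebra_induct)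
  case (adjacency i)
  show ?case using assms(2)
  proof (induction rule: algebra_induct)
    case (adjacency j)
    thus ?case using adjacency_product \<open>i \<le> d\<close> by blast
  qed (auto simp: matrix_mult_zero matrix_mult_add matrix_mult_scale subspace_0[OF subspace_algebra]
      intro: subspace_add[OF subspace_algebra] subspace_scale[OF subspace_algebra])
qed (auto simp: matrix_mult_zero matrix_mult_add matrix_mult_scale subspace_0[OF subspace_algebra]
      intro: subspace_add[OF subspace_algebra] subspace_scale[OF subspace_algebra])

lemmas algebra_mult = algebra_mult_commute [THEN conjunct1]
  and algebra_commute = algebra_mult_commute [THEN conjunct2]

lemma algebra_symmetric: "M \<in> \<A> \<Longrightarrow> transpose M = M"
proof (induction rule: algebra_induct)
  case (adjacency i)
  thus ?case using R_sym by (auto simp: vec_eq_iff transpose_def adjacency_matrix_def)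
qed (auto simp: vec_eq_iff transpose_def)

lemma algebra_entries:
  "M \<in> \<A> \<Longrightarrow> \<exists>c. \<forall>k\<le>d. \<forall>x y. (x, y) \<in> R k \<longrightarrow> M $ x $ y = c k"
proof (induction rule: algebra_induct)
  case (adjacency i)
  show ?case
    by (rule exI[of _ "\<lambda>k. if k = i then 1 else 0"])
      (use adjacency relation_unique in \<open>auto simp: adjacency_matrix_def\<close>)
next
  case (add M N)
  then obtain c c' where "\<forall>k\<le>d. \<forall>x y. (x, y) \<in> R k \<longrightarrow> M $ x $ y = c k" "\<forall>k\<le>d. \<forall>x y. (x, y) \<in> R k \<longrightarrow> N $ x $ y = c' k"
    by blast
  thus ?case by (intro exI[of _ "\<lambda>k. c k + c' k"]) simp
next
  case (scale a M)
  then obtain c where "\<forall>k\<le>d. \<forall>x y. (x, y) \<in> R k \<longrightarrow> M $ x $ y = c k" by blast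
  thus ?case by (intro exI[of _ "\<lambda>k. a * c k"]) simp
qed auto

lemma identity_in: "mat 1 \<in> \<A>"
proof -
  have "A 0 = mat 1" by (auto simp: vec_eq_iff adjacency_matrix_def R0 mat_def)
  thus ?thesis using adjacency_in[of 0] by simp
qed

lemma symmetric_square_zero:
  assumes "M \<in> \<A>" "M ** M = 0"
  shows "M = 0"
proof -
  have "M $ x $ y = 0" for x y
  proof -
    have s: "M $ z $ x = M $ x $ z" for z
      using arg_cong[OF algebra_symmetric[OF assms(1)], of "\<lambda>N. N $ x $ z"] by (simp add: transpose_def)
    have "(\<Sum>z\<in>UNIV. (M $ x $ z)\<^sup>2) = (M ** M) $ x $ x"
      by (simp add: matrix_matrix_mult_def s power2_eq_square)
    hence "(\<Sum>z\<in>UNIV. (M $ x $ z)\<^sup>2) = 0" using assms(2) by simp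
    thus ?thesis by (subst (asm) sum_nonneg_eq_0_iff) auto
  qed
  thus ?thesis by (simp add: vec_eq_iff)
qed

text \<open>The algebra has no nilpotents, so multiplication by \<open>N\<close> is injective, hence surjective, on the ideal
generated by \<open>N\<close>.  The element that it maps to \<open>N\<close> is an identity of the ideal.\<close>

lemma ideal_has_identity:
  assumes N: "N \<in> \<A>"
  obtains B where "B \<in> \<A>" "(N ** B) ** (N ** B) = N ** B" "N ** (N ** B) = N"
proof -
  define V where "V = (\<lambda>B. N ** B) ` \<A>"
  have lin: "linear (\<lambda>B :: real^'x^'x. N ** B)"
    by (rule linearI) (simp_all add: matrix_mult_add matrix_mult_scale)
  have sub: "subspace V" unfolding V_def by (rule linear_subspace_image[OF lin subspace_algebra])
  have VA: "V \<subseteq> \<A>" using algebra_mult[OF N] by (auto simp: V_def)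
  have square: "M ** M = (N ** M) ** B" if "M \<in> V" "B \<in> \<A>" "M = N ** B" for M B
  proof -
    have BM: "B ** M = M ** B" by (rule algebra_commute[OF that(2)]) (use that VA in blast)
    have "M ** M = N ** (B ** M)" by (simp only: that(3) matrix_mul_assoc)
    thus ?thesis unfolding BM by (simp only: matrix_mul_assoc)
  qed
  have "(\<lambda>B. N ** B) ` V = V"
  proof (rule subspace_dim_equal)
    show "subspace ((\<lambda>B. N ** B) ` V)" by (rule linear_subspace_image[OF lin sub])
    show "subspace V" by (rule sub)
    show "(\<lambda>B. N ** B) ` V \<subseteq> V" using VA by (auto simp: V_def)
    have "inj_on (\<lambda>B. N ** B) V"
    proof (subst linear_inj_on_iff_eq_0[OF lin sub], intro ballI impI)
      fix M assume M: "M \<in> V" "N ** M = 0"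
      then obtain B where B: "B \<in> \<A>" "M = N ** B" by (auto simp: V_def)
      have "M ** M = (N ** M) ** B" by (rule square[OF M(1) B])
      hence "M ** M = 0" using M by (simp add: matrix_mult_zero)
      thus "M = 0" using symmetric_square_zero VA M by blast
    qed
    hence "dim ((\<lambda>B. N ** B) ` V) = dim V"
      by (intro dim_image_eq[OF lin]) (simp add: span_eq_iff[THEN iffD2, OF sub])
    thus "dim V \<le> dim ((\<lambda>B. N ** B) ` V)" by simp
  qed
  moreover have "N \<in> V" unfolding V_def using identity_in by (metis image_eqI matrix_mul_rid)
  ultimately obtain M where M: "M \<in> V" "N = N ** M" by auto
  then obtain B where B: "B \<in> \<A>" "M = N ** B" by (auto simp: V_def)
  have "M ** M = M"
  proof -
    have "M ** M = (N ** M) ** B" by (rule square[OF M(1) B])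
    thus ?thesis using M B by simp
  qed
  thus ?thesis using that[of B] B M by simp
qed

lemma algebra_self_adjoint: "M \<in> \<A> \<Longrightarrow> (M *v u) \<bullet> w = u \<bullet> (M *v w)"
  using algebra_symmetric[of M] by (metis dot_lmul_matrix inner_commute transpose_matrix_vector)

text \<open>A symmetric matrix that leaves the range of \<open>E\<close> invariant has an eigenvector there: a maximum
  point of its quadratic form on the unit sphere.\<close>

lemma eigenvector_in_range:
  assumes E: "E \<in> \<A>" "E ** E = E" "E \<noteq> 0" and M: "M \<in> \<A>"
  obtains \<mu> v where "v \<noteq> 0" "E *v v = v" "M *v v = \<mu> *\<^sub>R v"
proof -
  define S where "S = {v. E *v v = v} \<inter> sphere 0 1"
  have sub: "subspace {v. E *v v = v}"
    by (auto simp: subspace_def matrix_vector_right_distrib matrix_vector_mult_scaleR)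
  have cl: "closed {v. E *v v = v}" by (rule closed_subspace[OF sub])
  have comp: "compact S" unfolding S_def using cl by (rule closed_Int_compact) (rule compact_sphere)
  have "\<exists>v. E *v v \<noteq> 0"
  proof (rule ccontr)
    assume "\<not> ?thesis"
    hence "E = 0" by (simp add: matrix_eq)
    thus False using E by simp
  qed
  then obtain w where w: "E *v w \<noteq> 0" by blast
  let ?w = "(1 / norm (E *v w)) *\<^sub>R (E *v w)"
  have "?w \<in> S" using w E(2) by (simp add: S_def matrix_vector_mult_scaleR matrix_vector_mul_assoc)
  hence ne: "S \<noteq> {}" by auto
  have cont: "continuous_on S (\<lambda>v. v \<bullet> (M *v v))"
    by (intro continuous_on_inner continuous_on_id linear_continuous_on linear_linear[THEN iffD2]
        matrix_vector_mul_linear)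
  obtain v where v: "v \<in> S" "\<And>u. u \<in> S \<Longrightarrow> u \<bullet> (M *v u) \<le> v \<bullet> (M *v v)"
    using continuous_attains_sup[OF comp ne cont] by auto
  have Ev: "E *v v = v" and nv: "norm v = 1" using v by (auto simp: S_def)
  define \<mu> where "\<mu> = v \<bullet> (M *v v)"
  have le: "u \<bullet> (M *v u) \<le> \<mu> * (u \<bullet> u)" if u: "E *v u = u" for u
  proof (cases "u = 0")
    case False
    have "(1 / norm u) *\<^sub>R u \<in> S" using False u by (simp add: S_def matrix_vector_mult_scaleR)
    hence "((1 / norm u) *\<^sub>R u) \<bullet> (M *v ((1 / norm u) *\<^sub>R u)) \<le> \<mu>" unfolding \<mu>_def by (rule v(2))
    hence "(u \<bullet> (M *v u)) / (norm u)\<^sup>2 \<le> \<mu>" by (simp add: matrix_vector_mult_scaleR power2_eq_square)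
    thus ?thesis using False by (simp add: divide_le_eq power2_norm_eq_inner)
  qed simp
  define w where "w = \<mu> *\<^sub>R v - M *v v"
  have EM: "E *v (M *v u) = M *v u" if "E *v u = u" for u
    using that algebra_commute[OF E(1) M] by (metis matrix_vector_mul_assoc)
  have Ew: "E *v w = w" using Ev EM[OF Ev] by (simp add: w_def matrix_vector_mult_diff_distrib matrix_vector_mult_scaleR)
  define b where "b = w \<bullet> w"
  define c where "c = \<mu> * (w \<bullet> w) - w \<bullet> (M *v w)"
  have c0: "0 \<le> c" using le[OF Ew] by (simp add: c_def)
  have quad: "0 \<le> 2 * t * b + t\<^sup>2 * c" for t
  proof -
    let ?u = "v + t *\<^sub>R w"
    have Eu: "E *v ?u = ?u" using Ev Ew by (simp add: matrix_vector_right_distrib matrix_vector_mult_scaleR)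
    have sym: "w \<bullet> (M *v v) = v \<bullet> (M *v w)" using algebra_self_adjoint[OF M, of w v] by (simp add: inner_commute)
    have vv: "v \<bullet> v = 1" using nv by (simp add: norm_eq_1)
    have wb: "\<mu> * (w \<bullet> v) - w \<bullet> (M *v v) = b" by (simp add: b_def w_def inner_diff_right)
    have "\<mu> * (?u \<bullet> ?u) - ?u \<bullet> (M *v ?u) = 2 * t * (\<mu> * (w \<bullet> v) - w \<bullet> (M *v v)) + t\<^sup>2 * c"
      by (simp add: inner_add_left inner_add_right matrix_vector_right_distrib matrix_vector_mult_scaleR
          vv \<mu>_def[symmetric] sym c_def inner_commute[of v w] power2_eq_square algebra_simps)
    thus ?thesis using le[OF Eu] wb by simp
  qed
  have "b = 0"
  proof (rule ccontr)
    assume "b \<noteq> 0"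
    have "0 \<le> 2 * (- (b / (c + 1))) * b + (- (b / (c + 1)))\<^sup>2 * c" by (rule quad)
    also have "\<dots> = - (b\<^sup>2 * (c + 2)) / (c + 1)\<^sup>2"
      using c0 by (simp add: power2_eq_square divide_simps) (simp add: algebra_simps)
    also have "\<dots> < 0" using c0 \<open>b \<noteq> 0\<close> by (intro divide_neg_pos) auto
    finally show False by simp
  qed
  hence "M *v v = \<mu> *\<^sub>R v" by (simp add: b_def w_def)
  moreover have "v \<noteq> 0" using nv by auto
  ultimately show ?thesis using that Ev by blast
qed

text \<open>Let \<open>\<mu>\<close> be an eigenvalue of \<open>M\<close> on the range of \<open>E\<close>.  If \<open>N = \<mu> *\<^sub>R E - M ** E\<close> were not zero, the identity of the
ideal generated by \<open>N\<close> would be a nonzero idempotent below \<open>E\<close>, different from \<open>E\<close> because it kills an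
eigenvector, and \<open>E\<close> would not be primitive.\<close>

lemma primitive_eigenspace:
  assumes P: "primitive_idempotent_of E \<A>" and M: "M \<in> \<A>"
  shows "\<exists>\<mu>. M ** E = \<mu> *\<^sub>R E"
proof -
  have E: "E \<in> \<A>" "E ** E = E" "E \<noteq> 0" using P by (auto simp: primitive_idempotent_of_def)
  obtain \<mu> v where v: "v \<noteq> 0" "E *v v = v" "M *v v = \<mu> *\<^sub>R v" using eigenvector_in_range[OF E M] .
  define N where "N = \<mu> *\<^sub>R E - M ** E"
  have ME: "M ** E \<in> \<A>" by (rule algebra_mult[OF M E(1)])
  have N: "N \<in> \<A>" unfolding N_def
    by (intro subspace_diff[OF subspace_algebra] subspace_scale[OF subspace_algebra] E ME)
  have NE: "N ** E = N" using E(2) by (simp add: N_def matrix_mult_diff matrix_mult_scale flip: matrix_mul_assoc)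
  have Nv: "N *v v = 0"
    using v by (simp add: N_def matrix_vector_mult_diff_rdistrib scaleR_matrix_vector_assoc[symmetric] flip: matrix_vector_mul_assoc)
  obtain B where B: "B \<in> \<A>" "(N ** B) ** (N ** B) = N ** B" "N ** (N ** B) = N"
    using ideal_has_identity[OF N] .
  define F where "F = N ** B"
  have FA: "F \<in> \<A>" unfolding F_def by (rule algebra_mult[OF N B(1)])
  have EF: "E ** F = F" unfolding F_def
    using NE algebra_commute[OF N E(1)] by (metis matrix_mul_assoc)
  have FE: "F ** E = F" using EF algebra_commute[OF FA E(1)] by simp
  have FF: "F ** F = F" using B by (simp add: F_def)
  have "F *v v = 0"
  proof -
    have "F = B ** N" unfolding F_def by (rule algebra_commute[OF N B(1)])
    thus ?thesis using Nv by (simp flip: matrix_vector_mul_assoc)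
  qed
  hence "(E - F) *v v = v" using v by (simp add: matrix_vector_mult_diff_rdistrib)
  hence G0: "E - F \<noteq> 0" using v(1) by auto
  have GA: "E - F \<in> \<A>" by (rule subspace_diff[OF subspace_algebra E(1) FA])
  have "F = 0"
  proof (rule ccontr)
    assume "F \<noteq> 0"
    moreover have "(E - F) ** (E - F) = E - F" "F ** (E - F) = 0" "(E - F) ** F = 0" "E = F + (E - F)"
      by (simp_all add: matrix_mult_diff E(2) EF FE FF)
    ultimately show False using P FA GA G0 FF unfolding primitive_idempotent_of_def by metis
  qed
  hence "N = 0" using B(3) by (simp add: F_def[symmetric] matrix_mult_zero)
  thus ?thesis by (intro exI[of _ \<mu>]) (simp add: N_def)
qed

end

section \<open>The embedded point set\<close>

locale spherical_scheme = association_scheme d R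
  for d :: nat and R :: "nat \<Rightarrow> ('x::finite \<times> 'x) set" +
  fixes E :: "real^'x^'x" and \<iota> :: "real^'x \<Rightarrow> real^3"
  assumes primitive: "primitive_idempotent_of E (bose_mesner_algebra d R)"
    and rank3: "rank E = 3"
    and identification: "column_space_identification E \<iota>"
    and faithful: "faithful_embedding (spherical_embedding E \<iota>)"
begin

definition f :: "'x \<Rightarrow> real^3" where "f = spherical_embedding E \<iota>"

definition scale :: real where "scale = sqrt (real CARD('x) / 3)"

lemma E_in: "E \<in> \<A>" and E_idem: "E ** E = E"
  using primitive by (auto simp: primitive_idempotent_of_def)

lemma scale_square: "scale\<^sup>2 = real CARD('x) / 3" and scale_pos: "scale > 0"
  by (simp_all add: scale_def)

lemma f_eq: "f x = \<iota> (scale *\<^sub>R (E *v axis x 1))"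
  by (simp add: f_def spherical_embedding_def rank3 scale_def)

lemma column_in_span: "E *v axis x 1 \<in> span (columns E)"
  by (rule span_base) (auto simp: columns_def matrix_vector_mult_basis)

lemma fixed_on_columns:
  assumes "v \<in> span (columns E)"
  shows "E *v v = v"
proof -
  have "subspace {v. E *v v = v}"
    by (auto simp: subspace_def matrix_vector_right_distrib matrix_vector_mult_scaleR)
  moreover have "E *v w = w" if w: "w \<in> columns E" for w
  proof -
    obtain x where "w = E *v axis x 1" using w by (auto simp: columns_def matrix_vector_mult_basis)
    thus ?thesis using E_idem by (simp add: matrix_vector_mul_assoc)
  qed
  ultimately show ?thesis using assms by (intro span_induct[of v "columns E" "\<lambda>v. E *v v = v"]) auto
qed

lemma identification_inner:
  assumes "u \<in> span (columns E)" "v \<in> span (columns E)"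
  shows "\<iota> u \<bullet> \<iota> v = u \<bullet> v"
proof -
  have lin: "linear \<iota>" and nm: "\<And>w. w \<in> span (columns E) \<Longrightarrow> norm (\<iota> w) = norm w"
    using identification by (auto simp: column_space_identification_def)
  have sq: "\<iota> w \<bullet> \<iota> w = w \<bullet> w" if "w \<in> span (columns E)" for w
    using nm[OF that] by (simp add: norm_eq)
  have "\<iota> (u + v) \<bullet> \<iota> (u + v) = (u + v) \<bullet> (u + v)" by (rule sq) (intro span_add assms)
  thus ?thesis using sq[OF assms(1)] sq[OF assms(2)]
    by (simp add: linear_add[OF lin] inner_add_left inner_add_right inner_commute[of "\<iota> v" "\<iota> u"] inner_commute[of v u])
qed

text \<open>Inner products with a fixed vector of the three-dimensional space are, up to the scale, the
coordinates of the corresponding vector in the column space.\<close>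

lemma f_inner_identification:
  assumes "v \<in> span (columns E)"
  shows "f x \<bullet> \<iota> v = scale * v $ x"
proof -
  have "f x \<bullet> \<iota> v = (scale *\<^sub>R (E *v axis x 1)) \<bullet> v"
    unfolding f_eq by (rule identification_inner) (intro span_scale column_in_span assms)+
  also have "\<dots> = scale * (axis x 1 \<bullet> (E *v v))"
    by (simp add: algebra_self_adjoint[OF E_in])
  finally show ?thesis using fixed_on_columns[OF assms] by (simp add: inner_axis')
qed

lemma f_inner: "f x \<bullet> f y = scale\<^sup>2 * E $ x $ y"
proof -
  have "f x \<bullet> f y = scale * (scale *\<^sub>R (E *v axis y 1)) $ x"
    unfolding f_eq[of y] by (rule f_inner_identification) (intro span_scale column_in_span)
  thus ?thesis by (simp add: matrix_vector_mult_basis column_def power2_eq_square)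
qed

lemma f_inner': "f y \<bullet> f x = scale\<^sup>2 * E $ x $ y"
  using f_inner[of x y] by (simp add: inner_commute)

lemma tight_frame: "(\<Sum>x\<in>UNIV. (f x \<bullet> w)\<^sup>2) = scale\<^sup>2 * (w \<bullet> w)"
proof -
  obtain v where v: "v \<in> span (columns E)" "\<iota> v = w"
    using identification by (auto simp: column_space_identification_def) (metis UNIV_I imageE)
  have "(\<Sum>x\<in>UNIV. (f x \<bullet> w)\<^sup>2) = scale\<^sup>2 * (\<Sum>x\<in>UNIV. v $ x * v $ x)"
    using f_inner_identification[OF v(1)] v(2)
    by (simp add: sum_distrib_left power2_eq_square mult_ac)
  also have "(\<Sum>x\<in>UNIV. v $ x * v $ x) = w \<bullet> w"
    using identification_inner[OF v(1) v(1)] v(2) by (simp add: inner_vec_def)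
  finally show ?thesis .
qed

lemma orthogonal_to_all_zero:
  assumes "\<And>x. f x \<bullet> w = 0"
  shows "w = 0"
  using tight_frame[of w] scale_pos assms by simp

lemma span_f: "span (range f) = UNIV"
proof (rule ccontr)
  assume "\<not> ?thesis"
  then obtain a where a: "a \<noteq> 0" "\<And>x. x \<in> span (range f) \<Longrightarrow> orthogonal a x"
    using orthogonal_to_subspace_exists_gen[of "range f" UNIV] by (auto simp: psubset_eq)
  have "f x \<bullet> a = 0" for x using a(2)[of "f x"] by (simp add: orthogonal_def inner_commute span_base)
  thus False using orthogonal_to_all_zero a(1) by blast
qed

lemma inner_by_relation: "\<exists>c. \<forall>k\<le>d. \<forall>x y. (x, y) \<in> R k \<longrightarrow> f x \<bullet> f y = c k"
proof -
  obtain c where "\<forall>k\<le>d. \<forall>x y. (x, y) \<in> R k \<longrightarrow> E $ x $ y = c k" using algebra_entries[OF E_in] by blast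
  thus ?thesis by (intro exI[of _ "\<lambda>k. scale\<^sup>2 * c k"]) (simp add: f_inner)
qed

text \<open>The points have equal norms, since the diagonal is a single relation.  Their value comes from the
trace: the tight frame identity, summed over an orthonormal basis, is where the rank enters.\<close>

lemma norm_f: "norm (f x) = 1"
proof -
  obtain c where c: "\<And>k x y. k \<le> d \<Longrightarrow> (x, y) \<in> R k \<Longrightarrow> f x \<bullet> f y = c k" using inner_by_relation by blast
  have ff: "f x \<bullet> f x = c 0" for x by (rule c) (auto simp: R0)
  have "(\<Sum>x\<in>UNIV. f x \<bullet> f x) = (\<Sum>x\<in>UNIV. \<Sum>i\<in>UNIV. (f x \<bullet> axis i 1)\<^sup>2)"
    by (simp add: inner_vec_def[of "f _" "f _"] inner_axis power2_eq_square)
  also have "\<dots> = (\<Sum>i\<in>(UNIV :: 3 set). \<Sum>x\<in>UNIV. (f x \<bullet> axis i 1)\<^sup>2)" by (rule sum.swap)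
  also have "\<dots> = 3 * scale\<^sup>2" by (simp add: tight_frame inner_axis_axis)
  finally have "real CARD('x) * c 0 = real CARD('x)" unfolding scale_square by (simp add: ff)
  thus ?thesis by (simp add: norm_eq_1 ff)
qed

lemma inj_f: "inj f"
  using faithful by (simp add: f_def faithful_embedding_def)

definition relation_set :: "nat \<Rightarrow> 'x \<Rightarrow> 'x set" where
  "relation_set i x = {z. (x, z) \<in> R i}"

text \<open>Up to the scale, the entry of \<open>A i ** E\<close> at \<open>(x, y)\<close> is the inner product of the sum with the image of \<open>y\<close>.\<close>

lemma relation_sum_proportional:
  assumes i: "i \<le> d"
  shows "\<exists>\<mu>. \<forall>x. (\<Sum>z\<in>relation_set i x. f z) = \<mu> *\<^sub>R f x"
proof -
  obtain \<mu> where \<mu>: "A i ** E = \<mu> *\<^sub>R E"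
    using primitive_eigenspace[OF primitive adjacency_in[OF i]] by blast
  have "(\<Sum>z\<in>relation_set i x. f z) = \<mu> *\<^sub>R f x" for x
  proof -
    have e: "(\<Sum>z\<in>relation_set i x. E $ z $ y) = \<mu> * E $ x $ y" for y
    proof -
      have "(\<Sum>z\<in>relation_set i x. E $ z $ y) = (\<Sum>z\<in>UNIV. if (x, z) \<in> R i then E $ z $ y else 0)"
        unfolding relation_set_def by (simp add: sum.If_cases)
      also have "\<dots> = (A i ** E) $ x $ y"
        unfolding matrix_matrix_mult_def adjacency_matrix_def by (simp add: if_distrib cong: if_cong) (rule sum.cong, auto)
      finally show ?thesis by (simp add: \<mu>)
    qed
    have "(\<Sum>z\<in>relation_set i x. f z) - \<mu> *\<^sub>R f x = 0"
    proof (rule orthogonal_to_all_zero)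
      fix y
      have "f y \<bullet> (\<Sum>z\<in>relation_set i x. f z) = (\<Sum>z\<in>relation_set i x. scale\<^sup>2 * E $ z $ y)"
        by (simp add: inner_sum_right f_inner')
      also have "\<dots> = scale\<^sup>2 * (\<mu> * E $ x $ y)" by (simp add: e flip: sum_distrib_left)
      also have "\<dots> = f y \<bullet> (\<mu> *\<^sub>R f x)" by (simp add: f_inner')
      finally show "f y \<bullet> ((\<Sum>z\<in>relation_set i x. f z) - \<mu> *\<^sub>R f x) = 0" by (simp add: inner_diff_right)
    qed
    thus ?thesis by simp
  qed
  thus ?thesis by blast
qed

lemma card_relation_set:
  assumes "i \<le> d"
  shows "card (relation_set i x) = intersection_number i i 0"
proof -
  have "relation_set i x = {z. (x, z) \<in> R i \<and> (z, x) \<in> R i}"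
    using R_sym[OF assms] by (auto simp: relation_set_def)
  thus ?thesis using intersection_number[of i i 0 x x] assms by (simp add: R0)
qed

text \<open>The factor of proportionality is found from the inner product with \<open>f x\<close>.\<close>

lemma relation_sum:
  assumes i: "i \<le> d" and t: "\<And>x z. (x, z) \<in> R i \<Longrightarrow> f x \<bullet> f z = t"
  shows "(\<Sum>z\<in>relation_set i x. f z) = (real (intersection_number i i 0) * t) *\<^sub>R f x"
proof -
  obtain \<mu> where \<mu>: "\<And>x. (\<Sum>z\<in>relation_set i x. f z) = \<mu> *\<^sub>R f x" using relation_sum_proportional[OF i] by blast
  have "f x \<bullet> (\<Sum>z\<in>relation_set i x. f z) = real (card (relation_set i x)) * t"
    using t by (simp add: inner_sum_right relation_set_def)
  moreover have "f x \<bullet> f x = 1" using norm_f by (simp add: norm_eq_1)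
  ultimately have "\<mu> = real (card (relation_set i x)) * t" unfolding \<mu> by simp
  thus ?thesis using \<mu> card_relation_set[OF i] by simp
qed

definition X :: "(real^3) set" where "X = range f"

definition \<theta> :: real where "\<theta> = Max {f x \<bullet> f y | x y. x \<noteq> y}"

lemma exists_three_points: "\<exists>x y z :: 'x. x \<noteq> y \<and> y \<noteq> z \<and> x \<noteq> z"
proof -
  have "dim (UNIV :: (real^3) set) \<le> card (range f)"
    by (rule dim_le_card) (use span_f in auto)
  also have "\<dots> = CARD('x)" using inj_f by (simp add: card_image)
  finally have "3 \<le> CARD('x)" by simp
  then obtain T :: "'x set" where "card T = 3" using obtain_subset_with_card_n by blast
  thus ?thesis by (auto simp: card_3_iff)
qed

lemma theta_properties:
  "finite {f x \<bullet> f y | x y. x \<noteq> y}" "\<theta> \<in> {f x \<bullet> f y | x y. x \<noteq> y}"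
  "\<And>x y. x \<noteq> y \<Longrightarrow> f x \<bullet> f y \<le> \<theta>"
proof -
  have "{f x \<bullet> f y | x y. x \<noteq> y} \<subseteq> (\<lambda>(x, y). f x \<bullet> f y) ` UNIV" by auto
  thus fin: "finite {f x \<bullet> f y | x y. x \<noteq> y}" by (rule finite_subset) simp
  have ne: "{f x \<bullet> f y | x y. x \<noteq> y} \<noteq> {}" using exists_three_points by blast
  show "\<theta> \<in> {f x \<bullet> f y | x y. x \<noteq> y}" unfolding \<theta>_def by (rule Max_in[OF fin ne])
  show "f x \<bullet> f y \<le> \<theta>" if "x \<noteq> y" for x y unfolding \<theta>_def by (rule Max_ge[OF fin]) (use that in auto)
qed

lemma unit_eq_iff: "f x \<bullet> f y = 1 \<longleftrightarrow> x = y" "f x \<bullet> f y = - 1 \<Longrightarrow> f y = - f x"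
proof -
  have u: "f x \<bullet> f x = 1" for x using norm_f by (simp add: norm_eq_1)
  have "(f x - f y) \<bullet> (f x - f y) = 2 * (1 - f x \<bullet> f y)"
    by (simp add: inner_diff_left inner_diff_right u inner_commute)
  thus "f x \<bullet> f y = 1 \<longleftrightarrow> x = y" using inj_f u by (auto simp: inj_eq)
  have "(f y + f x) \<bullet> (f y + f x) = 2 * (1 + f x \<bullet> f y)"
    by (simp add: inner_add_left inner_add_right u inner_commute)
  thus "f y = - f x" if "f x \<bullet> f y = - 1" using that by (auto simp: eq_neg_iff_add_eq_0)
qed

lemma separated_points_X: "separated_points X \<theta>"
proof
  show "finite X" "X \<noteq> {}" "span X = UNIV" by (simp_all add: X_def span_f)
  show "norm x = 1" if "x \<in> X" for x using that norm_f by (auto simp: X_def)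
  show "x \<bullet> y \<le> \<theta>" if xy: "x \<in> X" "y \<in> X" "x \<noteq> y" for x y
  proof -
    obtain a b where "x = f a" "y = f b" using xy by (auto simp: X_def)
    thus ?thesis using xy(3) by (auto intro: theta_properties(3))
  qed
  have ge: "- 1 \<le> f x \<bullet> f y" and le: "f x \<bullet> f y \<le> 1" for x y
    using Cauchy_Schwarz_ineq2[of "f x" "f y"] by (simp_all add: norm_f abs_le_iff)
  obtain x y where xy: "x \<noteq> y" "\<theta> = f x \<bullet> f y" using theta_properties(2) by auto
  show "\<theta> < 1" using le[of x y] unit_eq_iff(1)[of x y] xy by (simp add: less_le)
  show "- 1 < \<theta>"
  proof (rule ccontr)
    assume "\<not> - 1 < \<theta>"
    hence m: "f y = - f x" if "x \<noteq> y" for x y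
      using theta_properties(3)[OF that] ge[of x y] by (intro unit_eq_iff(2)) simp
    obtain a b c :: 'x where "a \<noteq> b" "b \<noteq> c" "a \<noteq> c" using exists_three_points by blast
    hence "f b = f c" using m[of a b] m[of a c] by simp
    thus False using inj_f \<open>b \<noteq> c\<close> by (simp add: inj_eq)
  qed
qed

text \<open>A single neighbour would be a multiple of the point itself, by its centroid, and two neighbours
would be opposite to each other.\<close>

lemma minimal_relation_valency:
  assumes i: "i \<le> d" and t: "\<And>x z. (x, z) \<in> R i \<Longrightarrow> f x \<bullet> f z = \<theta>"
  shows "3 \<le> intersection_number i i 0"
proof (rule ccontr)
  interpret separated_points X \<theta> by (rule separated_points_X)
  let ?k = "intersection_number i i 0"
  assume "\<not> 3 \<le> ?k"
  moreover have "?k \<noteq> 0"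
  proof
    assume "?k = 0"
    obtain x y where "(x, y) \<in> R i" using R_nonempty[OF i] by auto
    hence "relation_set i x \<noteq> {}" by (auto simp: relation_set_def)
    thus False using card_relation_set[OF i, of x] \<open>?k = 0\<close> by simp
  qed
  ultimately consider "?k = 1" | "?k = 2" by linarith
  thus False
  proof cases
    case 1
    fix x :: 'x
    obtain z where z: "relation_set i x = {z}"
      using card_relation_set[OF i, of x] 1 by (auto simp: card_1_singleton_iff)
    hence "f z = \<theta> *\<^sub>R f x" using relation_sum[OF i t, of x] 1 by simp
    hence "norm (f z) = \<bar>\<theta>\<bar> * norm (f x)" by simp
    thus False using theta by (simp add: norm_f)
  next
    case 2
    define N where "N = (\<lambda>v. f ` relation_set i (inv f v))"
    have N: "N (f x) = f ` relation_set i x" for x by (simp add: N_def inv_f_f[OF inj_f])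
    show False
    proof (rule no_two_valent_neighbours[of N])
      fix v assume "v \<in> X"
      then obtain x where x: "v = f x" by (auto simp: X_def)
      show "N v \<subseteq> neighbours X \<theta> v" unfolding x N using t by (auto simp: neighbours_def X_def relation_set_def)
      show "card (N v) = 2" unfolding x N
        using card_image[OF inj_on_subset[OF inj_f subset_UNIV], of "relation_set i x"] card_relation_set[OF i] 2 by simp
      show "(\<Sum>y\<in>N v. y) = (2 * \<theta>) *\<^sub>R v" unfolding x N
        using relation_sum[OF i t, of x] 2 by (simp add: sum.reindex[OF inj_on_subset[OF inj_f subset_UNIV]])
      fix w assume "w \<in> N v"
      then obtain z where "w = f z" "(x, z) \<in> R i" unfolding x N by (auto simp: relation_set_def)
      thus "v \<in> N w" using R_sym[OF i] by (simp add: x N relation_set_def)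
    qed
  qed
qed

text \<open>Two relations at the minimal distance would give a point six neighbours.\<close>

lemma minimal_relation_unique:
  obtains i where "i \<le> d" "\<forall>x z. f x \<bullet> f z = \<theta> \<longleftrightarrow> (x, z) \<in> R i"
proof -
  interpret separated_points X \<theta> by (rule separated_points_X)
  obtain c where c: "\<And>k x y. k \<le> d \<Longrightarrow> (x, y) \<in> R k \<Longrightarrow> f x \<bullet> f y = c k" using inner_by_relation by blast
  obtain x y where xy: "x \<noteq> y" "\<theta> = f x \<bullet> f y" using theta_properties(2) by auto
  obtain i where i: "i \<le> d" "(x, y) \<in> R i" using relation_of by blast
  have ci: "c i = \<theta>" using c[OF i] xy by simp
  have uniq: "j = i" if j: "j \<le> d" "c j = \<theta>" for j
  proof (rule ccontr)
    assume "j \<noteq> i"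
    have disj: "relation_set i x \<inter> relation_set j x = {}"
      using relation_unique[OF i(1) j(1)] \<open>j \<noteq> i\<close> by (auto simp: relation_set_def)
    have three: "3 \<le> card (relation_set i x)" "3 \<le> card (relation_set j x)"
      using minimal_relation_valency[OF i(1)] minimal_relation_valency[OF j(1)] c[OF i(1)] c[OF j(1)] ci j
      by (simp_all add: card_relation_set i j)
    have "f ` (relation_set i x \<union> relation_set j x) \<subseteq> neighbours X \<theta> (f x)"
      using c[OF i(1)] c[OF j(1)] ci j by (auto simp: neighbours_def X_def relation_set_def)
    moreover have "finite (neighbours X \<theta> (f x))" by (simp add: neighbours_def X_def)
    ultimately have "card (f ` (relation_set i x \<union> relation_set j x)) \<le> card (neighbours X \<theta> (f x))"
      by (intro card_mono)
    moreover have "card (f ` (relation_set i x \<union> relation_set j x)) = card (relation_set i x) + card (relation_set j x)"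
      using disj by (simp add: card_image[OF inj_on_subset[OF inj_f subset_UNIV]] card_Un_disjoint)
    ultimately show False using three card_neighbours_le_5[of "f x"] by (simp add: X_def)
  qed
  show ?thesis
  proof (rule that[OF i(1)], intro allI)
    fix u v
    obtain k where k: "k \<le> d" "(u, v) \<in> R k" using relation_of by blast
    show "f u \<bullet> f v = \<theta> \<longleftrightarrow> (u, v) \<in> R i"
    proof
      assume "f u \<bullet> f v = \<theta>"
      hence "k = i" using c[OF k] by (intro uniq[OF k(1)]) simp
      thus "(u, v) \<in> R i" using k(2) by simp
    next
      assume "(u, v) \<in> R i"
      thus "f u \<bullet> f v = \<theta>" using c[OF i(1)] ci by simp
    qed
  qed
qed

lemma edge_regular_X: "\<exists>q r. edge_regular X \<theta> q r \<and> q \<in> {3, 4, 5}"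
proof -
  interpret separated_points X \<theta> by (rule separated_points_X)
  obtain i where i: "i \<le> d" "\<forall>x z. f x \<bullet> f z = \<theta> \<longleftrightarrow> (x, z) \<in> R i" using minimal_relation_unique .
  let ?q = "intersection_number i i 0"
  have N: "neighbours X \<theta> (f x) = f ` relation_set i x" for x
    by (auto simp: neighbours_def X_def relation_set_def i(2))
  have inj: "inj_on f S" for S using inj_f by (rule inj_on_subset) simp
  have card: "card (neighbours X \<theta> v) = ?q" if v: "v \<in> X" for v
  proof -
    obtain x where "v = f x" using v by (auto simp: X_def)
    thus ?thesis using card_relation_set[OF i(1)] by (simp add: N card_image[OF inj])
  qed
  have q3: "3 \<le> ?q" by (rule minimal_relation_valency[OF i(1)]) (simp add: i(2))
  have "?q \<le> 5"
  proof -
    obtain v where "v \<in> X" using nonempty by auto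
    thus ?thesis using card_neighbours_le_5 card by metis
  qed
  hence "?q \<in> {3, 4, 5}" using q3 by auto
  moreover have "edge_regular X \<theta> ?q (intersection_number i i i)"
  proof
    show "3 \<le> ?q" by (rule q3)
    fix v assume v: "v \<in> X"
    then obtain x where x: "v = f x" by (auto simp: X_def)
    show "card (neighbours X \<theta> v) = ?q" by (rule card[OF v])
    show "(\<Sum>y\<in>neighbours X \<theta> v. y) = (real ?q * \<theta>) *\<^sub>R v"
      using relation_sum[OF i(1), of \<theta> x] i(2) by (simp add: x N sum.reindex[OF inj])
    fix w assume "w \<in> neighbours X \<theta> v"
    then obtain y where y: "w = f y" "(x, y) \<in> R i" by (auto simp: x N relation_set_def)
    have "neighbours X \<theta> v \<inter> neighbours X \<theta> w = f ` {z. (x, z) \<in> R i \<and> (z, y) \<in> R i}"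
      using R_sym[OF i(1)] unfolding x y(1) N image_Int[OF inj_f, symmetric]
      by (intro arg_cong[of _ _ "\<lambda>S. f ` S"]) (auto simp: relation_set_def)
    thus "card (neighbours X \<theta> v \<inter> neighbours X \<theta> w) = intersection_number i i i"
      using intersection_number[OF i(1) i(1) i(1) y(2)] by (simp add: card_image[OF inj])
  qed
  ultimately show ?thesis by blast
qed

lemma embedded_polyhedron:
  defines "P \<equiv> convex hull X"
  shows "vertices P = X" "regular_tetrahedron P \<and> card X = 4 \<or>
     regular_octahedron P \<and> card X = 6 \<or> cube P \<and> card X = 8 \<or>
     regular_icosahedron P \<and> card X = 12 \<or>
     quasi_regular_polyhedron [3,4,3,4] P \<and> card X = 12 \<or>
     regular_dodecahedron P \<and> card X = 20 \<or>
     quasi_regular_polyhedron [3,5,3,5] P \<and> card X = 30"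
proof -
  interpret separated_points X \<theta> by (rule separated_points_X)
  show "vertices P = X" unfolding P_def by (rule vertices_hull)
  obtain q r where q: "edge_regular X \<theta> q r" "q \<in> {3, 4, 5}" using edge_regular_X by blast
  hence nb: "neighbour_balanced X \<theta> q" by (simp add: edge_regular_def)
  consider "q = 3" | "q = 4" | "q = 5" using q(2) by auto
  thus "regular_tetrahedron P \<and> card X = 4 \<or>
     regular_octahedron P \<and> card X = 6 \<or> cube P \<and> card X = 8 \<or>
     regular_icosahedron P \<and> card X = 12 \<or>
     quasi_regular_polyhedron [3,4,3,4] P \<and> card X = 12 \<or>
     regular_dodecahedron P \<and> card X = 20 \<or>
     quasi_regular_polyhedron [3,5,3,5] P \<and> card X = 30"
  proof cases
    case 1
    hence "three_neighbours X \<theta>" using nb by (simp add: three_neighbours_def)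
    thus ?thesis using three_neighbours.classification_three unfolding P_def by blast
  next
    case 2
    hence "four_neighbours X \<theta>" using nb by (simp add: four_neighbours_def)
    thus ?thesis using four_neighbours.classification_four unfolding P_def by blast
  next
    case 3
    hence "five_neighbours X \<theta> r" using q(1) by (simp add: five_neighbours_def)
    thus ?thesis using five_neighbours.classification_five unfolding P_def by blast
  qed
qed

end

theorem theorem3:
  fixes d :: nat
    and R :: "nat \<Rightarrow> ('x::finite \<times> 'x) set"
    and E\<^sub>1 :: "real^'x^'x"
    and \<iota> :: "real^'x \<Rightarrow> real^3"
  assumes "symmetric_association_scheme d R"
    and "primitive_idempotent_of E\<^sub>1 (bose_mesner_algebra d R)"
    and "rank E\<^sub>1 = 3"
    and "column_space_identification E\<^sub>1 \<iota>"
    and "faithful_embedding (spherical_embedding E\<^sub>1 \<iota>)"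
  shows "\<exists>P f. vertices P \<subseteq> sphere 0 1 \<and>
           orthogonal_transformation f \<and>
           f ` range (spherical_embedding E\<^sub>1 \<iota>) = vertices P \<and>
           (regular_tetrahedron P \<and> CARD('x) = 4 \<or>
            regular_octahedron P \<and> CARD('x) = 6 \<or>
            cube P \<and> CARD('x) = 8 \<or>
            regular_icosahedron P \<and> CARD('x) = 12 \<or>
            quasi_regular_polyhedron [3,4,3,4] P \<and> CARD('x) = 12 \<or>
            regular_dodecahedron P \<and> CARD('x) = 20 \<or>
            quasi_regular_polyhedron [3,5,3,5] P \<and> CARD('x) = 30)"
proof -
  interpret spherical_scheme d R E\<^sub>1 \<iota> by unfold_locales (fact assms)+
  have X: "range (spherical_embedding E\<^sub>1 \<iota>) = X" by (simp add: X_def f_def)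
  have card: "card X = CARD('x)" unfolding X_def using inj_f by (rule card_image)
  have sphere: "X \<subseteq> sphere 0 1" using norm_f by (auto simp: X_def)
  show ?thesis
    unfolding X
    by (intro exI[of _ "convex hull X"] exI[of _ "\<lambda>x. x"])
      (use sphere embedded_polyhedron in \<open>simp add: card\<close>)
qed

end
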